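(* Let $\lambda(t)$ be the linear intensity process described in the context, with initial value $\lambda(0)=\lambda>0$, and let $\Lambda(t)=\int_0^t\lambda(s)\,ds$ be the integrated intensity. Put $\rho:=\beta E[X]-\alpha$, $A:=2\alpha\lambda_0+\beta^2E[X^2]$, and assume $\rho\ne0$. Define $$m_0=-\frac{\alpha\lambda_0}{\rho},\quad m_1=\frac{\alpha\lambda_0}{\rho}+\lambda,\quad v_0=\frac{A\alpha\lambda_0}{2\rho^2},\quad v_1=-\frac{A}{\rho}\Big(\frac{\alpha\lambda_0}{\rho}+\lambda\Big),\quad v_2=\frac{A}{2\rho^2}(\alpha\lambda_0+2\rho\lambda)+\lambda^2.$$ Then for all $t\ge0$, $$E[\Lambda^2(t)]=k_0+k_1t+k_2t^2+(C_0+C_1t)e^{\rho t}+C_2e^{2\rho t},$$ where $$k_0=\frac{2m_0(m_0-2m_1)-2v_0+2v_1+v_2}{\rho^2},\qquad k_1=\frac{2m_0(m_0-m_1)-2v_0}{\rho},\qquad k_2=m_0^2,$$ $$C_0=\frac{2\big(m_0(2m_1-m_0)+v_0-v_1-v_2\big)}{\rho^2},\qquad C_1=\frac{2(v_1-m_0m_1)}{\rho},\qquad C_2=\frac{v_2}{\rho^2}.$$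
   Context: Linear self-exciting intensity: let $\{T_n\}_{n\ge1}$ be a non-negative non-decreasing sequence of random times adapted to a filtration $\{\mathcal F_t\}_{t\ge0}$, with counting process $N(t)=\sum_{n\ge1}1_{\{T_n\le t\}}$ having $\mathcal F_t$-adapted, càdlàg, non-negative intensity $\lambda(t)$, meaning $E[\int_0^\infty f(s)\,dN(s)]=E[\int_0^\infty f(s)\lambda(s)\,ds]$ for all non-negative predictable $f$. Put $U(t)=\sum_{n=1}^{N(t)}X_n$, where the jump sizes $X_n$ are i.i.d. with the law of a random variable $X$, each $X_n$ being independent of the history strictly before $T_n$ (in particular of the value of the intensity); $E[X^2]<\infty$, and the jump law is such that $\lambda_0-\lambda(T_n-)\le X_n$ for every $n$. The intensity solves $$d\lambda(t)=\alpha(\lambda_0-\lambda(t))\,dt+\beta\,dU(t),$$ with constants $\alpha,\beta\in\mathbb R$, $\lambda_0>0$, started from a deterministic value $\lambda(0)=\lambda$; the process $\lambda(t)$ is Markov.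
   Formalization: The formal theorem adds that event times are almost surely strictly increasing while finite, not merely non-decreasing; with simultaneous events in pairs the intensity jumps by a sum of two jump sizes and the stated formula fails. *)

theory Defs
  imports "HOL-Probability.Probability"
begin

text \<open>
  Filtrations \<open>F\<close> are indexed by \<open>ennreal\<close>, so that the index set is exactly \<open>[0, \<infinity>]\<close> and the
  library's \<open>filtration\<close> and \<open>stopping_time\<close> apply to random times that may be infinite; processes
  are functions on \<open>real\<close>, of which only the values at times \<open>t \<ge> 0\<close> matter.
  The event times \<open>T\<close> and the jump sizes are numbered from \<open>0\<close>.
\<close>

definition cadlag :: "(real \<Rightarrow> real) \<Rightarrow> bool" where
  "cadlag x \<longleftrightarrow> (\<forall>t\<ge>0. continuous (at_right t) x) \<and> (\<forall>t>0. \<exists>l. (x \<longlongrightarrow> l) (at_left t))"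

definition left_lim :: "(real \<Rightarrow> real) \<Rightarrow> real \<Rightarrow> real" where
  "left_lim x t = Lim (at_left t) x"

text \<open>The predictable \<open>\<sigma>\<close>-algebra on \<open>[0, \<infinity>) \<times> \<Omega>\<close>.\<close>

definition predictable_sigma :: "'a set \<Rightarrow> (ennreal \<Rightarrow> 'a measure) \<Rightarrow> (real \<times> 'a) measure" where
  "predictable_sigma \<Omega> F = sigma ({0..} \<times> \<Omega>)
     ({{0} \<times> A |A. A \<in> sets (F 0)} \<union>
      {{s<..t} \<times> A |s t A. 0 \<le> s \<and> s \<le> t \<and> A \<in> sets (F (ennreal s))})"

text \<open>The \<open>\<sigma>\<close>-algebra of the history strictly before a stopping time \<open>S\<close>.\<close>

definition history_before :: "'a set \<Rightarrow> (ennreal \<Rightarrow> 'a measure) \<Rightarrow> ('a \<Rightarrow> ennreal) \<Rightarrow> 'a measure" where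
  "history_before \<Omega> F S = sigma \<Omega>
     (sets (F 0) \<union> {A \<inter> {\<omega>\<in>\<Omega>. t < S \<omega>} |A t. A \<in> sets (F t)})"

text \<open>
  \<open>card\<close> is \<open>0\<close> on infinite sets, so \<open>counting T t \<omega>\<close> is \<open>N(t)\<close> unless infinitely many events
  occur up to time \<open>t\<close>. In the locale below this is a null event: the intensity has locally bounded
  paths. The integral against \<open>dN\<close> is defined without recourse to \<open>counting\<close>, and is \<open>\<infinity>\<close> where the
  sum over the event times diverges.
\<close>

definition counting :: "(nat \<Rightarrow> 'a \<Rightarrow> ennreal) \<Rightarrow> real \<Rightarrow> 'a \<Rightarrow> nat" where
  "counting T t \<omega> = card {n. T n \<omega> \<le> ennreal t}"

definition counting_integral ::
    "(nat \<Rightarrow> 'a \<Rightarrow> ennreal) \<Rightarrow> (real \<times> 'a \<Rightarrow> ennreal) \<Rightarrow> 'a \<Rightarrow> ennreal" where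
  "counting_integral T f \<omega> = (\<Sum>n. if T n \<omega> < \<infinity> then f (enn2real (T n \<omega>), \<omega>) else 0)"

definition jump_sum ::
    "(nat \<Rightarrow> 'a \<Rightarrow> ennreal) \<Rightarrow> (nat \<Rightarrow> 'a \<Rightarrow> real) \<Rightarrow> real \<Rightarrow> 'a \<Rightarrow> real" where
  "jump_sum T J t \<omega> = (\<Sum>n<counting T t \<omega>. J n \<omega>)"

definition generated_sigma :: "'a set \<Rightarrow> (real \<Rightarrow> 'a \<Rightarrow> real) \<Rightarrow> real set \<Rightarrow> 'a measure" where
  "generated_sigma \<Omega> L I = sigma \<Omega> {L u -` B \<inter> \<Omega> |u B. u \<in> I \<and> B \<in> sets borel}"

definition markov_process :: "'a measure \<Rightarrow> (real \<Rightarrow> 'a \<Rightarrow> real) \<Rightarrow> bool" where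
  "markov_process M L \<longleftrightarrow> (\<forall>s t B. 0 \<le> s \<and> s \<le> t \<and> B \<in> sets borel \<longrightarrow>
     (AE \<omega> in M.
        real_cond_exp M (generated_sigma (space M) L {0..s}) (\<lambda>\<omega>. indicator B (L t \<omega>)) \<omega> =
        real_cond_exp M (generated_sigma (space M) L {s}) (\<lambda>\<omega>. indicator B (L t \<omega>)) \<omega>))"

text \<open>
  Event times \<open>T\<close>, jump sizes \<open>J\<close> with the law of \<open>X\<close>, intensity \<open>L\<close>, initial intensity \<open>l\<close>.

  The assumption \<open>simple\<close> says that distinct events do not occur at the same time. It does not
  follow from the existence of an intensity: if events come in simultaneous pairs at rate
  \<open>L / 2\<close>, then \<open>L\<close> still is an intensity of the counting process, but the jumps of the intensity
  are sums of two jump sizes and its second moment is different in general.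
\<close>

locale linear_self_exciting = prob_space M + filtration "space M" F
  for M :: "'a measure" and F :: "ennreal \<Rightarrow> 'a measure" +
  fixes T :: "nat \<Rightarrow> 'a \<Rightarrow> ennreal"
    and J :: "nat \<Rightarrow> 'a \<Rightarrow> real"
    and X :: "'a \<Rightarrow> real"
    and L :: "real \<Rightarrow> 'a \<Rightarrow> real"
    and \<alpha> \<beta> lam\<^sub>0 l :: real
  assumes sets_F: "\<And>t. sets (F t) \<subseteq> sets M"
    and stopping_times: "\<And>n. stopping_time F (T n)"
    and nondecreasing: "\<And>n \<omega>. \<omega> \<in> space M \<Longrightarrow> T n \<omega> \<le> T (Suc n) \<omega>"
    and simple: "AE \<omega> in M. \<forall>n. T n \<omega> < \<infinity> \<longrightarrow> T n \<omega> < T (Suc n) \<omega>"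
    and adapted: "\<And>t. 0 \<le> t \<Longrightarrow> L t \<in> borel_measurable (F (ennreal t))"
    and paths: "\<And>\<omega>. \<omega> \<in> space M \<Longrightarrow> cadlag (\<lambda>t. L t \<omega>)"
    and nonneg: "\<And>t \<omega>. 0 \<le> t \<Longrightarrow> \<omega> \<in> space M \<Longrightarrow> 0 \<le> L t \<omega>"
    and intensity: "\<And>f. f \<in> borel_measurable (predictable_sigma (space M) F) \<Longrightarrow>
      (\<integral>\<^sup>+\<omega>. counting_integral T f \<omega> \<partial>M) =
      (\<integral>\<^sup>+\<omega>. (\<integral>\<^sup>+s\<in>{0..}. f (s, \<omega>) * ennreal (L s \<omega>) \<partial>lborel) \<partial>M)"
    and X_measurable: "random_variable borel X"
    and X_square_integrable: "integrable M (\<lambda>\<omega>. (X \<omega>)\<^sup>2)"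
    and jumps_indep: "indep_vars (\<lambda>_. borel) J UNIV"
    and jumps_law: "\<And>n. distr M borel (J n) = distr M borel X"
    and jumps_indep_history: "\<And>n. indep_set {J n -` B \<inter> space M |B. B \<in> sets borel}
      (sets (history_before (space M) F (T n)))"
    and jumps_lower_bound: "AE \<omega> in M. \<forall>n. T n \<omega> < \<infinity> \<longrightarrow>
      lam\<^sub>0 - left_lim (\<lambda>s. L s \<omega>) (enn2real (T n \<omega>)) \<le> J n \<omega>"
    and base_pos: "0 < lam\<^sub>0"
    and initial: "\<And>\<omega>. \<omega> \<in> space M \<Longrightarrow> L 0 \<omega> = l"
    and dynamics: "AE \<omega> in M. \<forall>t\<ge>0.
      L t \<omega> = l + (LBINT s:{0..t}. \<alpha> * (lam\<^sub>0 - L s \<omega>)) + \<beta> * jump_sum T J t \<omega>"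
    and markov: "markov_process M L"

definition integrated_intensity :: "(real \<Rightarrow> 'a \<Rightarrow> real) \<Rightarrow> real \<Rightarrow> 'a \<Rightarrow> real" where
  "integrated_intensity L t \<omega> = (LBINT s:{0..t}. L s \<omega>)"

end

theory Submission
  imports Defs
begin

text \<open>
  With \<open>\<psi> r = (exp (\<rho> * r) - 1) / \<rho>\<close>, the conditional expectation of \<open>\<Lambda> t\<close> given the history up to \<open>u\<close>
  is \<open>Z u = \<Lambda> u + \<psi> (t - u) * L u + \<Psi> (t - u)\<close> with a deterministic function \<open>\<Psi>\<close>. Pathwise, \<open>Z\<close> is
  \<open>Z 0\<close> plus the integral of \<open>\<beta> * \<psi> (t - s)\<close> against \<open>dU s - E X * L s ds\<close>. Squaring by the product
  rule for paths with finitely many jumps and taking expectations gives the isometry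
  \<open>E (\<Lambda> t)^2 = (Z 0)^2 + \<beta>^2 * E X^2 * E (\<integral> \<psi> (t - s)^2 * L s ds)\<close>. The last mean comes from the
  identity that the product rule yields for \<open>\<theta> (t - s) * L s\<close>, where \<open>\<theta>' - \<rho> * \<theta> = \<psi>^2\<close>.

  Expectations of sums over events are computed by combining the intensity property with the
  independence of \<open>J n\<close> from the history before \<open>T n\<close>; this needs integrands that are predictable,
  which is why left limits of \<open>L\<close> appear. Integrability follows from a Gronwall bound on the second moment
  of \<open>L\<close> localized at the event times, which also excludes explosion.
\<close>

subsection \<open>Deterministic jump paths\<close>

text \<open>Squaring \<open>Z\<close> takes the place of a closed system of differential equations
  for the mean and the mixed moments of \<open>L\<close> and \<Lambda>: no expectation is ever
  differentiated. The equation \<psi>' = 1 + \<rho> \<psi> with \<psi> 0 = 0 is forced: its constant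
  1 cancels the increment of \<Lambda>, and the rest of the drift of \<open>Z\<close> is exactly
  minus the compensator of its jumps. In the mean of the square the cross term therefore cancels
  against its compensator, and only the squared jumps survive, leaving one mean that is linear in
  \<open>L\<close>.

  The function \<theta> is the convolution of exp (\<rho> r) with \<psi>^2. The exponential
  contained in \<psi>^2 resonates with this kernel and produces the term r exp (\<rho> r), one of
  the sources of the coefficient of t exp (\<rho> t).

  The obstacle is that the cancellation is legitimate only once the cross term is integrable,
  whereas no moment of \<open>L\<close> is given. Sums of non-negative terms can be compensated
  without such knowledge, so all estimates leading to the second moment are made in
  \<open>ennreal\<close>, each jump contribution being majorized by a predictable factor times a
  function of the jump size.\<close>

lemma sum_mult_sum_split:
  fixes j k :: "nat \<Rightarrow> real"
  shows "(\<Sum>n<N. j n) * (\<Sum>n<N. k n) =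
    (\<Sum>n<N. (\<Sum>m<n. j m) * k n + (\<Sum>m<n. k m) * j n + j n * k n)"
  by (induction N) (auto simp: algebra_simps sum.distrib)

text \<open>A jump at \<open>\<tau> n\<close> switches the constant \<open>j n\<close> on from
  \<open>\<tau> n\<close> onwards, so it contributes the integral of \<open>b\<close> over the
  remaining interval.\<close>

lemma has_integral_mult_jumps:
  fixes b :: "real \<Rightarrow> real" and \<tau> j :: "nat \<Rightarrow> real"
  assumes "\<And>n. n < N \<Longrightarrow> \<tau> n \<in> {0..t}" "b integrable_on {0..t}"
  shows "((\<lambda>s. (\<Sum>n<N. if \<tau> n \<le> s then j n else 0) * b s) has_integral
     (\<Sum>n<N. j n * (integral {0..t} b - integral {0..\<tau> n} b))) {0..t}"
proof -
  have "((\<lambda>s. if s \<in> {\<tau> n..t} then b s else 0) has_integral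
      integral {0..t} b - integral {0..\<tau> n} b) {0..t}" if "n < N" for n
  proof -
    have \<tau>: "\<tau> n \<in> {0..t}" using assms(1) that by blast
    have "b integrable_on {\<tau> n..t}"
      by (rule integrable_subinterval_real[OF assms(2)]) (use \<tau> in auto)
    moreover have "integral {0..\<tau> n} b + integral {\<tau> n..t} b = integral {0..t} b"
      by (rule Henstock_Kurzweil_Integration.integral_combine) (use \<tau> assms(2) in auto)
    ultimately have "(b has_integral integral {0..t} b - integral {0..\<tau> n} b) {\<tau> n..t}"
      by (metis add_diff_cancel_left' integrable_integral)
    then show ?thesis
      using \<tau> by (subst has_integral_restrict) auto
  qed
  then have "((\<lambda>s. \<Sum>n<N. j n * (if s \<in> {\<tau> n..t} then b s else 0)) has_integral
     (\<Sum>n<N. j n * (integral {0..t} b - integral {0..\<tau> n} b))) {0..t}"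
    by (auto simp only: lessThan_iff finite_lessThan intro!: has_integral_sum finite_lessThan has_integral_mult_right)
  then show ?thesis
    by (rule has_integral_eq[rotated]) (auto simp: sum_distrib_right intro!: sum.cong)
qed

text \<open>Each path is an indefinite integral plus a finite step function, and the four resulting
  products are treated separately. For strictly increasing times \<open>\<tau> n\<close>, the
  numbers \<open>x_pre n\<close> and \<open>y_pre n\<close> are the values just before the
  \<open>n\<close>-th jump, and \<open>j n * k n\<close> is the covariation.\<close>

lemma jump_product_rule:
  fixes a b x y :: "real \<Rightarrow> real" and j k \<tau> :: "nat \<Rightarrow> real" and x\<^sub>0 y\<^sub>0 t :: real
  defines "x_pre \<equiv> \<lambda>n. x\<^sub>0 + integral {0..\<tau> n} a + (\<Sum>m<n. j m)"
    and "y_pre \<equiv> \<lambda>n. y\<^sub>0 + integral {0..\<tau> n} b + (\<Sum>m<n. k m)"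
  assumes t: "0 \<le> t" and \<tau>: "\<And>n. n < N \<Longrightarrow> \<tau> n \<in> {0..t}"
    and a: "a integrable_on {0..t}" "\<And>s. s \<in> {0<..<t} - \<tau> ` {..<N} \<Longrightarrow> isCont a s"
    and b: "b integrable_on {0..t}" "\<And>s. s \<in> {0<..<t} - \<tau> ` {..<N} \<Longrightarrow> isCont b s"
    and x: "\<And>u. u \<in> {0..t} \<Longrightarrow> x u = x\<^sub>0 + integral {0..u} a + (\<Sum>n<N. if \<tau> n \<le> u then j n else 0)"
    and y: "\<And>u. u \<in> {0..t} \<Longrightarrow> y u = y\<^sub>0 + integral {0..u} b + (\<Sum>n<N. if \<tau> n \<le> u then k n else 0)"
  shows "((\<lambda>s. x s * b s + y s * a s) has_integral
    x t * y t - x\<^sub>0 * y\<^sub>0 - (\<Sum>n<N. x_pre n * k n + y_pre n * j n + j n * k n)) {0..t}"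
proof -
  define C where "C u = x\<^sub>0 + integral {0..u} a" for u
  define C' where "C' u = y\<^sub>0 + integral {0..u} b" for u
  let ?D = "\<lambda>s. \<Sum>n<N. if \<tau> n \<le> s then j n else 0"
  let ?D' = "\<lambda>s. \<Sum>n<N. if \<tau> n \<le> s then k n else 0"
  have deriv: "((\<lambda>u. integral {0..u} f) has_vector_derivative f s) (at s)"
    if "f integrable_on {0..t}" "isCont f s" "s \<in> {0<..<t}" for f :: "real \<Rightarrow> real" and s
  proof -
    have "((\<lambda>u. integral {0..u} f) has_vector_derivative f s) (at s within {0..t} - {})"
      using that by (intro integral_has_vector_derivative_continuous_at)
        (auto intro: continuous_at_imp_continuous_at_within)
    moreover have "at s within {0..t} - {} = at s"
      using that(3) by (simp add: at_within_Icc_at)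
    ultimately show ?thesis by simp
  qed
  \<comment> \<open>The densities may be discontinuous at the jump times; the exceptional set of
    this form of the fundamental theorem absorbs these finitely many points.\<close>
  have c: "((\<lambda>s. C s * b s + a s * C' s) has_integral C t * C' t - C 0 * C' 0) {0..t}"
  proof (rule fundamental_theorem_of_calculus_interior_strong[of "\<tau> ` {..<N}"])
    show "continuous_on {0..t} (\<lambda>u. C u * C' u)"
      unfolding C_def C'_def
      by (intro continuous_intros indefinite_integral_continuous_1 a b)
    fix s assume s: "s \<in> {0<..<t} - \<tau> ` {..<N}"
    have "(C has_vector_derivative a s) (at s)" "(C' has_vector_derivative b s) (at s)"
      using deriv[OF a(1) a(2)[OF s]] deriv[OF b(1) b(2)[OF s]] s
      unfolding C_def C'_def by (auto intro!: derivative_eq_intros)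
    then show "((\<lambda>u. C u * C' u) has_vector_derivative C s * b s + a s * C' s) (at s)"
      using has_vector_derivative_mult by blast
  qed (use t in auto)
  have d: "((\<lambda>s. ?D s * b s) has_integral (\<Sum>n<N. j n * (C' t - C' (\<tau> n)))) {0..t}"
    using has_integral_mult_jumps[OF \<tau> b(1)] by (simp add: C'_def)
  have d': "((\<lambda>s. ?D' s * a s) has_integral (\<Sum>n<N. k n * (C t - C (\<tau> n)))) {0..t}"
    using has_integral_mult_jumps[OF \<tau> a(1)] by (simp add: C_def)
  have D: "?D t = (\<Sum>n<N. j n)" "?D' t = (\<Sum>n<N. k n)"
    using \<tau> by (auto intro!: sum.cong)
  have xt: "x t = C t + (\<Sum>n<N. j n)" "y t = C' t + (\<Sum>n<N. k n)"
    using x[of t] y[of t] t unfolding D by (auto simp: C_def C'_def)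
  \<comment> \<open>The product of the two step parts at time \<open>t\<close> is expanded by
    \<open>sum_mult_sum_split\<close>; its partial sums complete \<open>C (\<tau> n)\<close> and
    \<open>C' (\<tau> n)\<close> to \<open>x_pre n\<close> and \<open>y_pre n\<close>.\<close>
  have "C t * C' t - C 0 * C' 0 + (\<Sum>n<N. j n * (C' t - C' (\<tau> n))) + (\<Sum>n<N. k n * (C t - C (\<tau> n))) =
    x t * y t - x\<^sub>0 * y\<^sub>0 - (\<Sum>n<N. x_pre n * k n + y_pre n * j n + j n * k n)"
    using sum_mult_sum_split[of j N k]
    by (simp add: xt x_pre_def y_pre_def C_def C'_def algebra_simps sum.distrib sum_subtractf
      sum_distrib_left sum_distrib_right)
  with has_integral_add[OF has_integral_add[OF c d] d']
  have "((\<lambda>s. (C s * b s + a s * C' s + ?D s * b s) + ?D' s * a s) has_integral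
     x t * y t - x\<^sub>0 * y\<^sub>0 - (\<Sum>n<N. x_pre n * k n + y_pre n * j n + j n * k n)) {0..t}"
    by simp
  then show ?thesis
    by (rule has_integral_eq[rotated]) (simp add: x y C_def C'_def algebra_simps)
qed

section \<open>Gronwall's inequality and boundedness of cadlag paths\<close>

lemma gronwall_nn_integral:
  fixes v :: "real \<Rightarrow> ennreal"
  assumes "0 < c" "0 \<le> B" "M < \<infinity>" "\<And>s. s \<in> {0..t} \<Longrightarrow> v s \<le> M"
    and ineq: "\<And>s. s \<in> {0..t} \<Longrightarrow> v s \<le> ennreal B + ennreal c * (\<integral>\<^sup>+r\<in>{0..s}. v r \<partial>lborel)"
    and "0 \<le> t"
  shows "v t \<le> ennreal (2 * B * exp (2 * c * t))"
proof -
  \<comment> \<open>Inserting \<open>v s \<le> m * exp (2 * c * s)\<close> into the inequality gives \<open>m \<le> B + m / 2\<close>.\<close>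
  define m where "m = (SUP s\<in>{0..t}. v s * ennreal (exp (- (2 * c * s))))"
  have "v s * ennreal (exp (- (2 * c * s))) \<le> M" if "s \<in> {0..t}" for s
  proof -
    have "v s * ennreal (exp (- (2 * c * s))) \<le> M * 1"
      using assms(1) that by (intro mult_mono assms) (auto simp: ennreal_le_1)
    then show ?thesis by simp
  qed
  \<comment> \<open>The a priori bound \<open>M\<close> enters here: for infinite \<open>m\<close>
    the final inequality m \<le> B + m / 2 would say nothing. The value of \<open>M\<close> does not
    reach the conclusion.\<close>
  then have "m < \<infinity>"
    using \<open>M < \<infinity>\<close> unfolding m_def by (metis (no_types, lifting) SUP_least order_le_less_trans)
  then obtain m' where m': "m = ennreal m'" "0 \<le> m'" by (metis infinity_ennreal_def ennreal_cases less_irrefl)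
  have vm: "v s \<le> ennreal (m' * exp (2 * c * s))" if "s \<in> {0..t}" for s
  proof -
    have "v s * ennreal (exp (- (2 * c * s))) \<le> ennreal m'"
      using that unfolding m'(1)[symmetric] m_def by (intro SUP_upper)
    then have "v s * ennreal (exp (- (2 * c * s))) * ennreal (exp (2 * c * s)) \<le> ennreal m' * ennreal (exp (2 * c * s))"
      by (intro mult_right_mono) auto
    moreover have "ennreal (exp (- (2 * c * s))) * ennreal (exp (2 * c * s)) = 1"
      by (simp flip: ennreal_mult exp_add)
    ultimately show ?thesis using m'(2) by (simp add: mult.assoc ennreal_mult)
  qed
  have "v s * ennreal (exp (- (2 * c * s))) \<le> ennreal (B + m' / 2)" if s: "s \<in> {0..t}" for s
  proof -
    have "(\<integral>\<^sup>+r\<in>{0..s}. v r \<partial>lborel) \<le> (\<integral>\<^sup>+r\<in>{0..s}. ennreal (m' * exp (2 * c * r)) \<partial>lborel)"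
      using vm s by (intro nn_integral_mono) (auto simp: indicator_def)
    also have "\<dots> = ennreal (m' * exp (2 * c * s) / (2 * c) - m' * exp (2 * c * 0) / (2 * c))"
      using s assms(1) m'(2)
      by (intro nn_integral_FTC_Icc) (auto intro!: derivative_eq_intros)
    also have "\<dots> \<le> ennreal (m' * exp (2 * c * s) / (2 * c))"
      using m'(2) assms(1) by (intro ennreal_leI) auto
    finally have "v s \<le> ennreal B + ennreal c * ennreal (m' * exp (2 * c * s) / (2 * c))"
      using ineq[OF s] by (meson add_left_mono dual_order.trans mult_left_mono zero_le)
    also have "\<dots> = ennreal (B + m' * exp (2 * c * s) / 2)"
      using assms m'(2) by (simp flip: ennreal_mult ennreal_plus)
    finally have "v s * ennreal (exp (- (2 * c * s))) \<le> ennreal (B + m' * exp (2 * c * s) / 2) * ennreal (exp (- (2 * c * s)))"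
      by (intro mult_right_mono) auto
    also have "\<dots> = ennreal ((B + m' * exp (2 * c * s) / 2) * exp (- (2 * c * s)))"
      using assms m'(2) by (subst ennreal_mult) auto
    also have "\<dots> \<le> ennreal (B + m' / 2)"
    proof (rule ennreal_leI)
      have "B * exp (- (2 * c * s)) \<le> B * 1"
        using assms s by (intro mult_left_mono) auto
      moreover have "exp (2 * c * s) * exp (- (2 * c * s)) = 1" by (simp flip: exp_add)
      ultimately show "(B + m' * exp (2 * c * s) / 2) * exp (- (2 * c * s)) \<le> B + m' / 2"
        by (simp add: distrib_right mult.assoc)
    qed
    finally show ?thesis .
  qed
  then have "m \<le> ennreal (B + m' / 2)" unfolding m_def by (rule SUP_least)
  then have "m' \<le> B + m' / 2"
    using m' assms(2) by (subst (asm) m'(1), subst (asm) ennreal_le_iff) auto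
  then have "m' \<le> 2 * B" by simp
  then show ?thesis
    using vm[of t] \<open>0 \<le> t\<close> by (force elim!: order_trans intro!: ennreal_leI)
qed

text \<open>Bisection: near each point the path stays close to its value there on the right and
  close to its left limit on the left, so it is locally bounded, and boundedness passes to the union
  of adjacent intervals.\<close>

lemma cadlag_bounded_Icc:
  assumes "cadlag x"
  shows "bounded (x ` {0..t})"
proof (cases "0 \<le> t")
  case True
  \<comment> \<open>The local intervals around time 0 reach below 0, where \<open>cadlag\<close>
    says nothing; hence the intersection with \<open>{0..}\<close>.\<close>
  define Q where "Q a b \<longleftrightarrow> bounded (x ` ({a..b} \<inter> {0..}))" for a b
  have "Q 0 t"
    using True
  proof (induction rule: Bolzano)
    case (trans a b c)
    have "{a..c} \<inter> {0..} = ({a..b} \<inter> {0..}) \<union> ({b..c} \<inter> {0..})"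
      using trans by auto
    then show ?case using trans by (simp only: Q_def image_Un bounded_Un)
  next
    case (local s)
    have "(x \<longlongrightarrow> x s) (at_right s)"
      using assms local unfolding cadlag_def continuous_within by auto
    then have "\<forall>\<^sub>F r in at_right s. dist (x r) (x s) < 1"
      using tendstoD zero_less_one by blast
    then obtain d where d: "0 < d" "\<And>r. r > s \<Longrightarrow> dist r s < d \<Longrightarrow> dist (x r) (x s) < 1"
      unfolding eventually_at by auto
    obtain e m where e: "0 < e" "\<And>r. 0 \<le> r \<Longrightarrow> r < s \<Longrightarrow> dist r s < e \<Longrightarrow> dist (x r) m < 1"
    proof (cases "s = 0")
      case False
      then obtain m where "(x \<longlongrightarrow> m) (at_left s)"
        using assms local unfolding cadlag_def by force
      then have "\<forall>\<^sub>F r in at_left s. dist (x r) m < 1"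
        using tendstoD zero_less_one by blast
      then show ?thesis using that unfolding eventually_at by auto
    qed (use that[of 1] in auto)
    show ?case
    proof (intro exI[of _ "min d e"] conjI allI impI)
      fix a b assume ab: "a \<le> s \<and> s \<le> b \<and> b - a < min d e"
      have "x ` ({a..b} \<inter> {0..}) \<subseteq> ball (x s) 1 \<union> ball m 1"
      proof (rule image_subsetI)
        fix r assume "r \<in> {a..b} \<inter> {0..}"
        then show "x r \<in> ball (x s) 1 \<union> ball m 1"
          using d(2)[of r] e(2)[of r] ab
          by (cases r s rule: linorder_cases) (auto simp: dist_commute dist_real_def)
      qed
      then show "Q a b"
        unfolding Q_def by (rule bounded_subset[rotated]) simp
    qed (use d e in auto)
  qed
  moreover have "{0..t} \<inter> {0..} = {0..t}" by auto
  ultimately show ?thesis by (simp add: Q_def)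
qed simp

subsection \<open>Predictable processes\<close>

lemma ceiling_grid_less: "(real_of_int \<lceil>real (Suc j) * s\<rceil> - 1) / real (Suc j) < s"
  using ceiling_correct[of "real (Suc j) * s"]
  by (subst pos_divide_less_eq) (simp_all only: mult.commute of_nat_0_less_iff zero_less_Suc)

text \<open>This is the largest multiple of \<open>1 / real (Suc j)\<close> strictly below
  \<open>s\<close>, cut at 0. Being strictly earlier than \<open>s\<close>, it approximates left
  limits by values already known, which is what predictability demands.\<close>

lemma ceiling_grid_at_left:
  assumes "0 < s"
  shows "filterlim (\<lambda>j. max 0 ((real_of_int \<lceil>real (Suc j) * s\<rceil> - 1) / real (Suc j))) (at_left s) sequentially"
proof -
  let ?r = "\<lambda>j. max 0 ((real_of_int \<lceil>real (Suc j) * s\<rceil> - 1) / real (Suc j))"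
  have "?r \<longlonglongrightarrow> s"
  proof (rule tendsto_sandwich[OF always_eventually always_eventually])
    show "\<forall>j. s - 1 / real (Suc j) \<le> ?r j"
    proof
      fix j
      have "s - 1 / real (Suc j) = (real (Suc j) * s - 1) / real (Suc j)"
        by (simp add: diff_divide_distrib)
      also have "\<dots> \<le> (real_of_int \<lceil>real (Suc j) * s\<rceil> - 1) / real (Suc j)"
        by (intro divide_right_mono) auto
      finally show "s - 1 / real (Suc j) \<le> ?r j" by simp
    qed
    show "\<forall>j. ?r j \<le> s" using ceiling_grid_less[of _ s] assms by (auto intro: less_imp_le)
    show "(\<lambda>j. s - 1 / real (Suc j)) \<longlonglongrightarrow> s"
      using tendsto_diff[OF tendsto_const[of s] LIMSEQ_Suc[OF lim_1_over_n]] by simp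
  qed simp
  moreover have "?r j < s" for j
    using ceiling_grid_less[of j s] assms by (simp only: max_less_iff_conj)
  then have "\<forall>\<^sub>F j in sequentially. ?r j \<in> {..<s} \<and> ?r j \<noteq> s"
    by (intro always_eventually allI conjI) (simp only: lessThan_iff, metis less_irrefl)
  ultimately show ?thesis
    unfolding filterlim_at by (rule conjI[rotated])
qed

text \<open>The counterpart for right-continuous paths: the smallest multiple of
  \<open>1 / real (Suc j)\<close> strictly above \<open>s\<close>.\<close>

lemma floor_grid_at_right:
  "filterlim (\<lambda>j. (real_of_int \<lfloor>real (Suc j) * s\<rfloor> + 1) / real (Suc j)) (at_right s) sequentially"
proof -
  let ?r = "\<lambda>j. (real_of_int \<lfloor>real (Suc j) * s\<rfloor> + 1) / real (Suc j)"
  have gt: "s < ?r j" for j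
    using real_of_int_floor_add_one_gt[of "real (Suc j) * s"]
    by (subst pos_less_divide_eq) (simp_all only: mult.commute of_nat_0_less_iff zero_less_Suc)
  have "?r \<longlonglongrightarrow> s"
  proof (rule tendsto_sandwich[OF always_eventually always_eventually])
    show "\<forall>j. s \<le> ?r j" using gt by (auto intro: less_imp_le)
    show "\<forall>j. ?r j \<le> s + 1 / real (Suc j)"
    proof
      fix j
      have "?r j \<le> (real (Suc j) * s + 1) / real (Suc j)"
        by (intro divide_right_mono) auto
      also have "\<dots> = s + 1 / real (Suc j)" by (simp add: add_divide_distrib)
      finally show "?r j \<le> s + 1 / real (Suc j)" .
    qed
    show "(\<lambda>j. s + 1 / real (Suc j)) \<longlonglongrightarrow> s"
      using tendsto_add[OF tendsto_const[of s] LIMSEQ_Suc[OF lim_1_over_n]] by simp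
  qed simp
  moreover have "\<forall>\<^sub>F j in sequentially. ?r j \<in> {s<..} \<and> ?r j \<noteq> s"
    using gt by (intro always_eventually allI conjI) (simp only: greaterThan_iff, metis less_irrefl)
  ultimately show ?thesis
    unfolding filterlim_at by (rule conjI[rotated])
qed

context linear_self_exciting
begin

abbreviation predictable :: "(real \<times> 'a) measure" where
  "predictable \<equiv> predictable_sigma (space M) F"

abbreviation history :: "nat \<Rightarrow> 'a measure" where
  "history n \<equiv> history_before (space M) F (T n)"

lemma sets_F_into_space: "A \<in> sets (F t) \<Longrightarrow> A \<subseteq> space M"
  using sets.sets_into_space space_F by fastforce

lemma space_in_F: "space M \<in> sets (F t)"
  using sets.top[of "F t"] by (simp add: space_F)

lemma predictable_generators:
  "{{0} \<times> A |A. A \<in> sets (F 0)} \<union>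
   {{s<..t} \<times> A |s t A. 0 \<le> s \<and> s \<le> t \<and> A \<in> sets (F (ennreal s))} \<subseteq> Pow ({0::real..} \<times> space M)"
  using sets_F_into_space by fastforce

lemma space_predictable: "space predictable = {0..} \<times> space M"
  unfolding predictable_sigma_def by (rule space_measure_of[OF predictable_generators])

lemma sets_predictable:
  "sets predictable = sigma_sets ({0..} \<times> space M)
     ({{0} \<times> A |A. A \<in> sets (F 0)} \<union>
      {{s<..t} \<times> A |s t A. 0 \<le> s \<and> s \<le> t \<and> A \<in> sets (F (ennreal s))})"
  unfolding predictable_sigma_def by (rule sets_measure_of[OF predictable_generators])

lemma greaterThan_in_predictable:
  assumes "0 \<le> s" "A \<in> sets (F (ennreal s))"
  shows "{s<..} \<times> A \<in> sets predictable"
proof -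
  have "{s<..} \<times> A = (\<Union>n. {s<..s + real n} \<times> A)"
  proof safe
    fix r w assume "s < r" "w \<in> A"
    obtain n where "r - s \<le> real n" using real_arch_simple by blast
    then show "(r, w) \<in> (\<Union>n. {s<..s + real n} \<times> A)"
      using \<open>s < r\<close> \<open>w \<in> A\<close> by (auto intro!: exI[of _ n])
  qed auto
  also have "\<dots> \<in> sets predictable"
  proof (intro sets.countable_UN image_subsetI)
    fix n
    have "{s<..s + real n} \<times> A \<in> {{0} \<times> A |A. A \<in> sets (F 0)} \<union>
      {{s<..t} \<times> A |s t A. 0 \<le> s \<and> s \<le> t \<and> A \<in> sets (F (ennreal s))}"
      using assms by (intro UnI2 CollectI exI[of _ s] exI[of _ "s + real n"] exI[of _ A]) auto
    then show "{s<..s + real n} \<times> A \<in> sets predictable"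
      unfolding sets_predictable by (rule sigma_sets.Basic)
  qed
  finally show ?thesis .
qed

lemma sets_predictable_subset: "sets predictable \<subseteq> sets (borel \<Otimes>\<^sub>M M)"
proof -
  have "({{0::real} \<times> A |A. A \<in> sets (F 0)} \<union>
      {{s<..t} \<times> A |s t A. 0 \<le> s \<and> s \<le> t \<and> A \<in> sets (F (ennreal s))}) \<subseteq> sets (borel \<Otimes>\<^sub>M M)"
    using sets_F by (force intro!: pair_measureI)
  moreover have "{0::real..} \<times> space M \<in> sets (borel \<Otimes>\<^sub>M M)"
    by (intro pair_measureI) auto
  ultimately show ?thesis
    unfolding sets_predictable
    by (intro subsetI) (metis (no_types, lifting) sets.sigma_sets_subset' subsetD)
qed

text \<open>The predictable space contains only times from 0 on, while Fubini arguments use Lebesgue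
  measure on the whole line; the constant \<open>c\<close> fills the negative times.\<close>

lemma predictable_joint:
  assumes "f \<in> measurable predictable N" "c \<in> space N"
  shows "(\<lambda>(s, w). if 0 \<le> s then f (s, w) else c) \<in> measurable (borel \<Otimes>\<^sub>M M) N"
proof -
  have sp: "{0::real..} \<times> space M \<in> sets (borel \<Otimes>\<^sub>M M)"
    by (intro pair_measureI) simp_all
  have "f \<in> measurable (restrict_space (borel \<Otimes>\<^sub>M M) ({0..} \<times> space M)) N"
  proof (rule subsetD[OF measurable_mono assms(1)])
    show "sets predictable \<le> sets (restrict_space (borel \<Otimes>\<^sub>M M) ({0..} \<times> space M))"
      using sets_predictable_subset sets.sets_into_space[of _ predictable] space_predictable sp
      by (auto simp: sets_restrict_space_iff)
  qed (auto simp: space_predictable space_restrict_space space_pair_measure)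
  then have "(\<lambda>x. if x \<in> {0..} \<times> space M then f x else c) \<in> measurable (borel \<Otimes>\<^sub>M M) N"
    using assms(2) sp
    by (subst (asm) measurable_restrict_space_iff) (auto simp: space_pair_measure Int_absorb2)
  then show ?thesis
    by (rule measurable_cong[THEN iffD1, rotated]) (auto simp: space_pair_measure split: if_splits)
qed

lemma fst_predictable [measurable]: "fst \<in> borel_measurable predictable"
proof (rule borel_measurable_iff_greater[THEN iffD2], rule allI)
  fix a :: real
  show "{x \<in> space predictable. a < fst x} \<in> sets predictable"
  proof (cases "0 \<le> a")
    case True
    then have "{x \<in> space predictable. a < fst x} = {a<..} \<times> space M"
      by (auto simp: space_predictable)
    then show ?thesis using greaterThan_in_predictable[OF True space_in_F] by simp
  next
    case False
    then have "{x \<in> space predictable. a < fst x} = space predictable"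
      by (auto simp: space_predictable)
    then show ?thesis by simp
  qed
qed

text \<open>The stochastic interval up to \<open>T n\<close> is closed on the right, and so its
  complement is a countable union of generators: \<open>s\<close> exceeds \<open>T n\<close> iff
  some rational \<open>q\<close> satisfies T n \<le> q < s, and T n \<le> q is decided at time
  \<open>q\<close>.\<close>

lemma before_time_predictable [measurable]:
  "Measurable.pred predictable (\<lambda>(s, w). ennreal s \<le> T n w)"
proof -
  have "{x \<in> space predictable. ennreal (fst x) \<le> T n (snd x)} =
    space predictable - (\<Union>q\<in>\<rat> \<inter> {0..}. {q<..} \<times> {w \<in> space M. T n w \<le> ennreal q})"
  proof safe
    fix s w q assume "(s, w) \<in> space predictable" "ennreal (fst (s, w)) \<le> T n (snd (s, w))"
      "q \<in> \<rat>" "0 \<le> q" "q < s" "T n w \<le> ennreal q"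
    then show False using ennreal_less_iff[of q s] by auto
  next
    fix s w assume s: "(s, w) \<in> space predictable"
      and *: "(s, w) \<notin> (\<Union>q\<in>\<rat> \<inter> {0..}. {q<..} \<times> {w \<in> space M. T n w \<le> ennreal q})"
    show "ennreal (fst (s, w)) \<le> T n (snd (s, w))"
    proof (rule ccontr)
      assume "\<not> ennreal (fst (s, w)) \<le> T n (snd (s, w))"
      then have "T n w < ennreal s" by simp
      then obtain r where r: "T n w = ennreal r" "0 \<le> r" "r < s"
        by (metis ennreal_cases ennreal_less_iff not_less_iff_gr_or_eq top.extremum_strict)
      obtain q where "q \<in> \<rat>" "r < q" "q < s" using Rats_dense_in_real[OF r(3)] by auto
      then show False using * r s
        by (auto simp: space_predictable intro!: ennreal_leI)
    qed
  qed
  moreover have "(\<Union>q\<in>\<rat> \<inter> {0..}. {q<..} \<times> {w \<in> space M. T n w \<le> ennreal q}) \<in> sets predictable"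
  proof (intro sets.countable_UN'' greaterThan_in_predictable)
    show "countable (\<rat> \<inter> {0::real..})" using countable_rat by blast
    fix q :: real assume "q \<in> \<rat> \<inter> {0..}"
    then show "{w \<in> space M. T n w \<le> ennreal q} \<in> sets (F (ennreal q))" "0 \<le> q"
      using stopping_timeD[OF stopping_times[of n], of "ennreal q"]
      by (auto simp: Measurable.pred_def space_F)
  qed
  ultimately have "{x \<in> space predictable. ennreal (fst x) \<le> T n (snd x)} \<in> sets predictable"
    by auto
  then show ?thesis by (simp add: Measurable.pred_def case_prod_beta)
qed

section \<open>Measurability of the intensity and of its left limits\<close>

lemma L_measurable [measurable]: "0 \<le> t \<Longrightarrow> L t \<in> borel_measurable M"
  using adapted[of t] sets_F[of "ennreal t"] space_F
  by (auto simp: measurable_def)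

text \<open>Joint measurability does not refer to the filtration, so the right-continuous paths may
  be approximated by values at later grid times. The cut at 0 removes the arbitrary values at
  negative times.\<close>

lemma L_joint_measurable [measurable]:
  "(\<lambda>(s, w). if 0 \<le> s then L s w else 0) \<in> borel_measurable (borel \<Otimes>\<^sub>M M)"
proof (rule borel_measurable_LIMSEQ_real)
  let ?r = "\<lambda>j i. max 0 ((real_of_int i + 1) / real (Suc j))"
  fix x :: "real \<times> 'a" assume x: "x \<in> space (borel \<Otimes>\<^sub>M M)"
  show "(\<lambda>j. if 0 \<le> fst x then L (?r j \<lfloor>real (Suc j) * fst x\<rfloor>) (snd x) else 0)
    \<longlonglongrightarrow> (case x of (s, w) \<Rightarrow> if 0 \<le> s then L s w else 0)"
  proof (cases "0 \<le> fst x")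
    case True
    have "((\<lambda>s. L s (snd x)) \<longlongrightarrow> L (fst x) (snd x)) (at_right (fst x))"
      using paths[of "snd x"] x True
      by (auto simp: space_pair_measure cadlag_def continuous_within)
    from filterlim_compose[OF this floor_grid_at_right]
    have "(\<lambda>j. L ((real_of_int \<lfloor>real (Suc j) * fst x\<rfloor> + 1) / real (Suc j)) (snd x)) \<longlonglongrightarrow> L (fst x) (snd x)" .
    moreover have "0 \<le> (real_of_int \<lfloor>real (Suc j) * fst x\<rfloor> + 1) / real (Suc j)" for j
    proof -
      have "0 \<le> \<lfloor>real (Suc j) * fst x\<rfloor>" using True by (simp only: zero_le_floor) simp
      then show ?thesis by simp
    qed
    ultimately show ?thesis using True by (simp add: case_prod_beta max_def)
  qed (auto simp: case_prod_beta)
next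
  fix j :: nat
  let ?r = "\<lambda>j i. max 0 ((real_of_int i + 1) / real (Suc j))"
  have "(\<lambda>x. L (?r j i) (snd x)) \<in> borel_measurable (borel \<Otimes>\<^sub>M M)" for i
    using L_measurable[of "?r j i"] by measurable
  then have "(\<lambda>x. L (?r j \<lfloor>real (Suc j) * fst x\<rfloor>) (snd x)) \<in> borel_measurable ((borel :: real measure) \<Otimes>\<^sub>M M)"
    by (rule measurable_compose_countable) measurable
  then show "(\<lambda>x. if 0 \<le> fst x then L (?r j \<lfloor>real (Suc j) * fst x\<rfloor>) (snd x) else 0)
    \<in> borel_measurable (borel \<Otimes>\<^sub>M M)"
    by measurable
qed

text \<open>At time \<open>0\<close> the left limit in \<open>Defs\<close> would involve the junk values at negative times.\<close>

definition left_intensity :: "real \<Rightarrow> 'a \<Rightarrow> real" where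
  "left_intensity s w = (if s = 0 then l else left_lim (\<lambda>s. L s w) s)"

lemma tendsto_left_intensity:
  assumes "w \<in> space M" "0 < s"
  shows "((\<lambda>s. L s w) \<longlongrightarrow> left_intensity s w) (at_left s)"
proof -
  obtain m where m: "((\<lambda>s. L s w) \<longlongrightarrow> m) (at_left s)"
    using paths[OF assms(1)] assms(2) unfolding cadlag_def by blast
  then have "Lim (at_left s) (\<lambda>s. L s w) = m" by (rule tendsto_Lim[OF trivial_limit_at_left_real])
  with m show ?thesis using assms(2) by (simp add: left_intensity_def left_lim_def)
qed

lemma left_intensity_grid:
  assumes "w \<in> space M" "0 \<le> s"
  shows "(\<lambda>j. L (max 0 ((real_of_int \<lceil>real (Suc j) * s\<rceil> - 1) / real (Suc j))) w) \<longlonglongrightarrow> left_intensity s w"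
proof (cases "s = 0")
  \<comment> \<open>At time 0 the grid value before the cut is negative, so the sequence is
    constantly \<open>L 0 w = l\<close>, in accordance with the convention for
    \<open>left_intensity\<close> at 0.\<close>
  case True
  then show ?thesis using initial[OF assms(1)] by (simp add: left_intensity_def max_def)
next
  case False
  then show ?thesis
    using filterlim_compose[OF tendsto_left_intensity ceiling_grid_at_left, of w s] assms by simp
qed

lemma left_intensity_nonneg:
  assumes "w \<in> space M" "0 \<le> s"
  shows "0 \<le> left_intensity s w"
  by (rule LIMSEQ_le_const[OF left_intensity_grid[OF assms]]) (use nonneg assms in auto)

text \<open>The elementary predictable process: a value known at time \<open>r\<close> is used only
  strictly later.\<close>

lemma frozen_intensity_predictable:
  assumes "0 \<le> r"
  shows "(\<lambda>x. if r < fst x then L r (snd x) else 0) \<in> borel_measurable predictable"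
proof (rule borel_measurable_iff_greater[THEN iffD2], rule allI)
  fix a :: real
  show "{x \<in> space predictable. a < (if r < fst x then L r (snd x) else 0)} \<in> sets predictable"
  proof (cases "0 \<le> a")
    case True
    then have "{x \<in> space predictable. a < (if r < fst x then L r (snd x) else 0)} =
        {r<..} \<times> {w \<in> space M. a < L r w}"
      using assms by (auto simp: space_predictable)
    moreover have "{w \<in> space M. a < L r w} \<in> sets (F (ennreal r))"
      using adapted[OF assms] space_F unfolding borel_measurable_iff_greater by simp
    ultimately show ?thesis using greaterThan_in_predictable[OF assms] by simp
  next
    case False
    then have "{x \<in> space predictable. a < (if r < fst x then L r (snd x) else 0)} = space predictable"
      using assms nonneg[OF assms] by (fastforce simp: space_predictable)
    then show ?thesis by simp
  qed
qed

text \<open>Left limits along the grid are limits of elementary predictable processes, one for each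
  of the countably many values of the ceiling.\<close>

lemma left_intensity_predictable [measurable]:
  "(\<lambda>(s, w). left_intensity s w) \<in> borel_measurable predictable"
proof (rule borel_measurable_LIMSEQ_real)
  let ?r = "\<lambda>j i. max 0 ((real_of_int i - 1) / real (Suc j))"
  fix x assume x: "x \<in> space predictable"
  then have "(\<lambda>j. L (?r j \<lceil>real (Suc j) * fst x\<rceil>) (snd x)) \<longlonglongrightarrow> left_intensity (fst x) (snd x)"
    by (intro left_intensity_grid) (auto simp: space_predictable)
  moreover have "(if ?r j \<lceil>real (Suc j) * fst x\<rceil> < fst x then L (?r j \<lceil>real (Suc j) * fst x\<rceil>) (snd x) else 0)
      + (if fst x = 0 then l else 0) = L (?r j \<lceil>real (Suc j) * fst x\<rceil>) (snd x)" for j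
    using x ceiling_grid_less[of j "fst x"] initial[of "snd x"]
    by (cases "fst x = 0") (auto simp: space_predictable max_def)
  ultimately show "(\<lambda>j. (if ?r j \<lceil>real (Suc j) * fst x\<rceil> < fst x then L (?r j \<lceil>real (Suc j) * fst x\<rceil>) (snd x) else 0)
      + (if fst x = 0 then l else 0)) \<longlonglongrightarrow> (case x of (s, w) \<Rightarrow> left_intensity s w)"
    by (simp add: case_prod_beta)
next
  fix j :: nat
  let ?r = "\<lambda>j i. max 0 ((real_of_int i - 1) / real (Suc j))"
  have "(\<lambda>x. if ?r j i < fst x then L (?r j i) (snd x) else 0) \<in> borel_measurable predictable" for i
    by (rule frozen_intensity_predictable) simp
  then have "(\<lambda>x. if ?r j \<lceil>real (Suc j) * fst x\<rceil> < fst x then L (?r j \<lceil>real (Suc j) * fst x\<rceil>) (snd x) else 0)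
      \<in> borel_measurable predictable"
    by (rule measurable_compose_countable) measurable
  then show "(\<lambda>x. (if ?r j \<lceil>real (Suc j) * fst x\<rceil> < fst x then L (?r j \<lceil>real (Suc j) * fst x\<rceil>) (snd x) else 0)
      + (if fst x = 0 then l else 0)) \<in> borel_measurable predictable"
    by measurable
qed

text \<open>A predictable version of the integrated intensity. It integrates left limits because
  their grid approximations at u \<le> s use times strictly before \<open>s\<close>; approximating
  \<open>L u w\<close> from the right could look beyond \<open>s\<close>.\<close>

lemma left_integral_predictable [measurable]:
  "(\<lambda>(s, w). LBINT u. indicator {0<..s} u * left_intensity u w) \<in> borel_measurable predictable"
proof -
  have "(\<lambda>y. indicator {0<..fst (fst y)} (snd y) * left_intensity (snd y) (snd (fst y)))
    \<in> borel_measurable (predictable \<Otimes>\<^sub>M (lborel :: real measure))"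
  proof (rule borel_measurable_LIMSEQ_real)
    let ?r = "\<lambda>j i. max 0 ((real_of_int i - 1) / real (Suc j))"
    fix y :: "(real \<times> 'a) \<times> real" assume y: "y \<in> space (predictable \<Otimes>\<^sub>M lborel)"
    have "(\<lambda>j. indicator {0<..fst (fst y)} (snd y) * L (?r j \<lceil>real (Suc j) * snd y\<rceil>) (snd (fst y)))
        \<longlonglongrightarrow> indicator {0<..fst (fst y)} (snd y) * left_intensity (snd y) (snd (fst y))"
    proof (cases "0 \<le> snd y")
      case True
      then show ?thesis using y
        by (intro tendsto_intros left_intensity_grid) (auto simp: space_pair_measure space_predictable)
    qed auto
    \<comment> \<open>The cutoff inserted here changes nothing where the indicator is 1, since the
      grid time lies below \<open>snd y\<close>, but it makes each approximation predictable in
      \<open>fst y\<close>.\<close>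
    moreover have "indicator {0<..fst (fst y)} (snd y) *
       (if ?r j \<lceil>real (Suc j) * snd y\<rceil> < fst (fst y) then L (?r j \<lceil>real (Suc j) * snd y\<rceil>) (snd (fst y)) else 0)
      = indicator {0<..fst (fst y)} (snd y) * L (?r j \<lceil>real (Suc j) * snd y\<rceil>) (snd (fst y))" for j
    proof (cases "snd y \<in> {0<..fst (fst y)}")
      case True
      then have "?r j \<lceil>real (Suc j) * snd y\<rceil> < fst (fst y)"
        using ceiling_grid_less[of j "snd y"] by (auto simp: max_def)
      then show ?thesis by simp
    qed (auto simp: indicator_def)
    ultimately show "(\<lambda>j. indicator {0<..fst (fst y)} (snd y) *
       (if ?r j \<lceil>real (Suc j) * snd y\<rceil> < fst (fst y) then L (?r j \<lceil>real (Suc j) * snd y\<rceil>) (snd (fst y)) else 0))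
        \<longlonglongrightarrow> indicator {0<..fst (fst y)} (snd y) * left_intensity (snd y) (snd (fst y))"
      by (simp only:)
  next
    fix j :: nat
    let ?r = "\<lambda>j i. max 0 ((real_of_int i - 1) / real (Suc j))"
    have "(\<lambda>y. if ?r j i < fst (fst y) then L (?r j i) (snd (fst y)) else 0)
        \<in> borel_measurable (predictable \<Otimes>\<^sub>M (lborel :: real measure))" for i
      using measurable_compose[OF measurable_fst frozen_intensity_predictable[of "?r j i"]] by simp
    then have "(\<lambda>y. if ?r j \<lceil>real (Suc j) * snd y\<rceil> < fst (fst y) then L (?r j \<lceil>real (Suc j) * snd y\<rceil>) (snd (fst y)) else 0)
        \<in> borel_measurable (predictable \<Otimes>\<^sub>M (lborel :: real measure))"
      by (rule measurable_compose_countable) measurable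
    moreover have "(\<lambda>y. indicator {0<..fst (fst y)} (snd y) :: real) \<in> borel_measurable (predictable \<Otimes>\<^sub>M (lborel :: real measure))"
      by (simp add: indicator_def) measurable
    ultimately show "(\<lambda>y. indicator {0<..fst (fst y)} (snd y) *
       (if ?r j \<lceil>real (Suc j) * snd y\<rceil> < fst (fst y) then L (?r j \<lceil>real (Suc j) * snd y\<rceil>) (snd (fst y)) else 0))
        \<in> borel_measurable (predictable \<Otimes>\<^sub>M lborel)"
      by (rule borel_measurable_times[rotated])
  qed
  then have "(\<lambda>x. LBINT u. indicator {0<..fst x} u * left_intensity u (snd x)) \<in> borel_measurable predictable"
    by (intro lborel.borel_measurable_lebesgue_integral) (simp add: case_prod_beta)
  then show ?thesis by (simp add: case_prod_beta)
qed

subsection \<open>The compensation formula\<close>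

lemma history_generators:
  "sets (F 0) \<union> {A \<inter> {w\<in>space M. t < T n w} |A t. A \<in> sets (F t)} \<subseteq> Pow (space M)"
  using sets_F_into_space by fastforce

lemma space_history: "space (history n) = space M"
  unfolding history_before_def by (rule space_measure_of[OF history_generators])

lemma sets_history:
  "sets (history n) = sigma_sets (space M)
    (sets (F 0) \<union> {A \<inter> {w\<in>space M. t < T n w} |A t. A \<in> sets (F t)})"
  unfolding history_before_def by (rule sets_measure_of[OF history_generators])

lemma initial_in_history: "A \<in> sets (F 0) \<Longrightarrow> A \<in> sets (history n)"
  unfolding sets_history by (rule sigma_sets.Basic) simp

lemma before_in_history: "A \<in> sets (F t) \<Longrightarrow> A \<inter> {w\<in>space M. t < T n w} \<in> sets (history n)"
  unfolding sets_history by (rule sigma_sets.Basic) blast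

lemma less_in_history: "{w\<in>space M. t < T n w} \<in> sets (history n)"
  using before_in_history[OF space_in_F, of t n] by (simp add: Int_absorb1 Collect_conj_eq inf_commute)

lemma T_less_top_in_history: "{w \<in> space M. T n w < \<infinity>} \<in> sets (history n)"
proof -
  have "x < \<infinity> \<longleftrightarrow> (\<exists>k. \<not> of_nat k < x)" for x :: ennreal
    using ennreal_Ex_less_of_nat[of x] order_le_less_trans[OF _ of_nat_less_top, of x]
    by (auto simp: not_less) (blast intro: less_imp_le)+
  then have "{w \<in> space M. T n w < \<infinity>} = space (history n) - (\<Inter>k. {w\<in>space M. of_nat k < T n w})"
    by (auto simp: space_history)
  also have "\<dots> \<in> sets (history n)"
    by (intro sets.Diff sets.top sets.countable_INT) (auto intro: less_in_history)
  finally show ?thesis .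
qed

text \<open>The generators of the two sigma-algebras correspond: the interval from \<open>s\<close>
  to \<open>t\<close> times \<open>A\<close> pulls back to \<open>A\<close> with s < T n, minus the
  event t < T n, and time 0 times \<open>A\<close> pulls back to \<open>A\<close> minus the event 0
  < T n. Hence the value of a predictable integrand at \<open>T n\<close> belongs to the history
  strictly before \<open>T n\<close>, which is independent of \<open>J n\<close>. Infinite times are
  cut out because \<open>enn2real\<close> sends them to 0.\<close>

lemma event_time_measurable_history:
  "(\<lambda>w. (enn2real (T n w), w)) \<in> measurable (restrict_space (history n) {w \<in> space M. T n w < \<infinity>}) predictable"
  unfolding predictable_sigma_def
proof (rule measurable_measure_of[OF predictable_generators])
  let ?H = "restrict_space (history n) {w \<in> space M. T n w < \<infinity>}"
  have space: "space ?H = {w \<in> space M. T n w < \<infinity>}"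
    by (auto simp: space_restrict_space space_history)
  then show "(\<lambda>w. (enn2real (T n w), w)) \<in> space ?H \<rightarrow> {0..} \<times> space M" by auto
  have in_H: "B \<in> sets ?H" if "B = B' \<inter> {w \<in> space M. T n w < \<infinity>}" "B' \<in> sets (history n)" for B B'
    using that T_less_top_in_history[of n] by (subst sets_restrict_space_iff) (auto simp: space_history Int_absorb2)
  fix E assume "E \<in> {{0} \<times> A |A. A \<in> sets (F 0)} \<union>
      {{s<..t} \<times> A |s t A. 0 \<le> s \<and> s \<le> t \<and> A \<in> sets (F (ennreal s))}"
  then show "(\<lambda>w. (enn2real (T n w), w)) -` E \<inter> space ?H \<in> sets ?H"
  proof (elim UnE CollectE exE conjE)
    fix A assume A: "E = {0} \<times> A" "A \<in> sets (F 0)"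
    show ?thesis
    proof (rule in_H)
      show "(\<lambda>w. (enn2real (T n w), w)) -` E \<inter> space ?H =
          (A - {w \<in> space M. 0 < T n w}) \<inter> {w \<in> space M. T n w < \<infinity>}"
        unfolding space A(1) by (auto simp: enn2real_eq_0_iff)
      show "A - {w \<in> space M. 0 < T n w} \<in> sets (history n)"
        by (intro sets.Diff initial_in_history less_in_history A)
    qed
  next
    fix s t A assume A: "E = {s<..t} \<times> A" "0 \<le> s" "s \<le> t" "A \<in> sets (F (ennreal s))"
    show ?thesis
    proof (rule in_H)
      have *: "s < enn2real x \<longleftrightarrow> ennreal s < x" "enn2real x \<le> t \<longleftrightarrow> x \<le> ennreal t" if "x < \<infinity>" for x
        using that A(2,3) by (cases x; simp add: ennreal_less_iff ennreal_le_iff)+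
      show "(\<lambda>w. (enn2real (T n w), w)) -` E \<inter> space ?H =
          (A \<inter> {w \<in> space M. ennreal s < T n w} - {w \<in> space M. ennreal t < T n w}) \<inter> {w \<in> space M. T n w < \<infinity>}"
        unfolding space A(1) using * by (auto simp: not_less)
      show "A \<inter> {w \<in> space M. ennreal s < T n w} - {w \<in> space M. ennreal t < T n w} \<in> sets (history n)"
        by (intro sets.Diff before_in_history less_in_history A)
    qed
  qed
qed

lemma predictable_at_event_time:
  assumes "f \<in> measurable predictable N" "c \<in> space N"
  shows "(\<lambda>w. if T n w < \<infinity> then f (enn2real (T n w), w) else c) \<in> measurable (history n) N"
proof -
  have "{w \<in> space M. T n w < \<infinity>} \<inter> space (history n) \<in> sets (history n)"
    using T_less_top_in_history by auto
  from measurable_restrict_space_iff[THEN iffD1, OF this assms(2)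
      measurable_compose[OF event_time_measurable_history assms(1)]]
  show ?thesis
    by (rule measurable_cong[THEN iffD1, rotated]) (simp add: space_history)
qed

section \<open>Independence of a jump from its past\<close>

lemma sets_history_subset: "sets (history n) \<subseteq> sets M"
  using jumps_indep_history[of n] by (rule indep_setD_ev2)

lemma measurable_historyD: "f \<in> measurable (history n) N \<Longrightarrow> f \<in> measurable M N"
  using sets_history_subset[of n] space_history by (auto simp: measurable_def)

lemma J_measurable [measurable]: "J n \<in> borel_measurable M"
  using jumps_indep unfolding indep_vars_def by auto

lemma T_measurable [measurable]: "T n \<in> borel_measurable M"
  by (rule measurable_stopping_time[OF stopping_times sets_F space_F])

text \<open>The preimages of Borel sets under \<open>J n\<close> already form a sigma-algebra, so it
  contains the one generated by \<open>g (J n w)\<close>; likewise \<open>history n\<close> contains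
  the one generated by \<open>Y\<close>. Independence passes to these subfamilies.\<close>

lemma indep_var_history_jump:
  assumes Y: "Y \<in> measurable (history n) S" and g: "g \<in> measurable borel R"
  shows "indep_var S Y R (\<lambda>w. g (J n w))"
  unfolding indep_var_eq
proof (intro conjI)
  show "random_variable S Y" by (rule measurable_historyD[OF Y])
  show gJ: "random_variable R (\<lambda>w. g (J n w))" using g by measurable
  have 1: "sigma_sets (space M) {Y -` A \<inter> space M |A. A \<in> sets S} \<subseteq> sets (history n)"
    using measurable_sets[OF Y] sets.top[of "history n"] unfolding space_history
    by (intro sets.sigma_sets_subset') auto
  have 2: "sigma_sets (space M) {(\<lambda>w. g (J n w)) -` A \<inter> space M |A. A \<in> sets R}
      \<subseteq> {J n -` B \<inter> space M |B. B \<in> sets borel}"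
  proof -
    let ?V = "vimage_algebra (space M) (J n) borel"
    have V: "sets ?V = {J n -` B \<inter> space M |B. B \<in> sets borel}"
      by (rule sets_vimage_algebra2) simp
    have "(\<lambda>w. g (J n w)) -` A \<inter> space M \<in> sets ?V" if "A \<in> sets R" for A
      unfolding V using measurable_sets[OF g that]
      by (intro CollectI exI[of _ "g -` A"]) (simp add: vimage_def)
    then have "{(\<lambda>w. g (J n w)) -` A \<inter> space M |A. A \<in> sets R} \<subseteq> sets ?V" by blast
    moreover have "space M \<in> sets ?V" using sets.top[of ?V] by simp
    ultimately show ?thesis unfolding V[symmetric] by (rule sets.sigma_sets_subset')
  qed
  show "indep_set (sigma_sets (space M) {Y -` A \<inter> space M |A. A \<in> sets S})
     (sigma_sets (space M) {(\<lambda>w. g (J n w)) -` A \<inter> space M |A. A \<in> sets R})"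
    unfolding indep_sets2_eq
  proof (intro conjI ballI)
    note J = jumps_indep_history[of n, unfolded indep_sets2_eq]
    show "sigma_sets (space M) {Y -` A \<inter> space M |A. A \<in> sets S} \<subseteq> events"
      by (rule order_trans[OF 1 sets_history_subset])
    show "sigma_sets (space M) {(\<lambda>w. g (J n w)) -` A \<inter> space M |A. A \<in> sets R} \<subseteq> events"
      by (rule order_trans[OF 2 J[THEN conjunct1]])
    fix a b assume ab: "a \<in> sigma_sets (space M) {Y -` A \<inter> space M |A. A \<in> sets S}"
      "b \<in> sigma_sets (space M) {(\<lambda>w. g (J n w)) -` A \<inter> space M |A. A \<in> sets R}"
    have "prob (b \<inter> a) = prob b * prob a"
      using J subsetD[OF 1 ab(1)] subsetD[OF 2 ab(2)] by (elim conjE) (drule (1) bspec)+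
    then show "prob (a \<inter> b) = prob a * prob b" by (simp add: inf_commute mult.commute)
  qed
qed

lemma nn_integral_jump:
  assumes "g \<in> borel_measurable borel"
  shows "(\<integral>\<^sup>+w. g (J n w) \<partial>M) = (\<integral>\<^sup>+w. g (X w) \<partial>M)"
  using nn_integral_distr[of "J n" M borel g] nn_integral_distr[of X M borel g] assms
    X_measurable jumps_law[of n] by simp

lemma integrable_jump:
  fixes g :: "real \<Rightarrow> real"
  assumes "integrable M (\<lambda>w. g (X w))" "g \<in> borel_measurable borel"
  shows "integrable M (\<lambda>w. g (J n w))" "(\<integral>w. g (J n w) \<partial>M) = (\<integral>w. g (X w) \<partial>M)"
  using integrable_distr_eq[of "J n" M borel g] integrable_distr_eq[of X M borel g]
    integral_distr[of "J n" M borel g] integral_distr[of X M borel g] assms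
    X_measurable jumps_law[of n] by simp_all

lemma nn_integral_mult_indep:
  fixes Y Z :: "'a \<Rightarrow> ennreal"
  assumes "indep_var borel Y borel Z"
  shows "(\<integral>\<^sup>+w. Y w * Z w \<partial>M) = (\<integral>\<^sup>+w. Y w \<partial>M) * (\<integral>\<^sup>+w. Z w \<partial>M)"
proof -
  have "case_bool borel borel = (\<lambda>_. borel :: ennreal measure)" by (auto split: bool.split)
  then have "indep_vars (\<lambda>_. borel) (case_bool Y Z) UNIV" using assms by (simp add: indep_var_def)
  from indep_vars_nn_integral[OF _ this] show ?thesis by (simp add: UNIV_bool mult.commute)
qed

section \<open>Expectations of sums over events\<close>

text \<open>Independence is applied to each term, the predictable factor at \<open>T n\<close> being
  in the past of \<open>J n\<close>. Once the common mean of \<open>g (J n w)\<close> is factored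
  out, the sum is a counting integral, to which the intensity property applies.\<close>

lemma nn_compensation:
  fixes f :: "real \<times> 'a \<Rightarrow> ennreal" and g :: "real \<Rightarrow> ennreal"
  assumes f: "f \<in> borel_measurable predictable" and g: "g \<in> borel_measurable borel"
  shows "(\<integral>\<^sup>+w. (\<Sum>n. if T n w < \<infinity> then f (enn2real (T n w), w) * g (J n w) else 0) \<partial>M) =
    (\<integral>\<^sup>+w. g (X w) \<partial>M) * (\<integral>\<^sup>+w. (\<integral>\<^sup>+s\<in>{0..}. f (s, w) * ennreal (L s w) \<partial>lborel) \<partial>M)"
proof -
  let ?Y = "\<lambda>n w. if T n w < \<infinity> then f (enn2real (T n w), w) else 0"
  have Y: "?Y n \<in> borel_measurable (history n)" for n
    by (rule predictable_at_event_time[OF f]) simp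
  then have [measurable]: "?Y n \<in> borel_measurable M" for n by (rule measurable_historyD)
  have [measurable]: "(\<lambda>w. g (J n w)) \<in> borel_measurable M" for n using g by measurable
  have "(\<integral>\<^sup>+w. (\<Sum>n. if T n w < \<infinity> then f (enn2real (T n w), w) * g (J n w) else 0) \<partial>M) =
    (\<integral>\<^sup>+w. (\<Sum>n. ?Y n w * g (J n w)) \<partial>M)"
    by (intro nn_integral_cong suminf_cong) simp
  also have "\<dots> = (\<Sum>n. \<integral>\<^sup>+w. ?Y n w * g (J n w) \<partial>M)"
    by (rule nn_integral_suminf) measurable
  also have "\<dots> = (\<Sum>n. (\<integral>\<^sup>+w. g (X w) \<partial>M) * (\<integral>\<^sup>+w. ?Y n w \<partial>M))"
    using nn_integral_mult_indep[OF indep_var_history_jump[OF Y g]] nn_integral_jump[OF g]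
    by (simp add: mult.commute)
  also have "\<dots> = (\<integral>\<^sup>+w. g (X w) \<partial>M) * (\<Sum>n. \<integral>\<^sup>+w. ?Y n w \<partial>M)"
    by (rule ennreal_suminf_cmult)
  also have "(\<Sum>n. \<integral>\<^sup>+w. ?Y n w \<partial>M) = (\<integral>\<^sup>+w. counting_integral T f w \<partial>M)"
    unfolding counting_integral_def by (rule nn_integral_suminf[symmetric]) measurable
  finally show ?thesis unfolding intensity[OF f] .
qed

lemma L_section_measurable [measurable]:
  assumes "w \<in> space M"
  shows "(\<lambda>s. if 0 \<le> s then L s w else 0) \<in> borel_measurable borel"
  using measurable_compose[OF measurable_Pair2'[OF assms] L_joint_measurable] by simp

lemma predictable_L_joint_measurable:
  fixes f :: "real \<times> 'a \<Rightarrow> real"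
  assumes f: "f \<in> borel_measurable predictable"
  shows "(\<lambda>(s, w). indicator {0..} s * (f (s, w) * L s w)) \<in> borel_measurable (lborel \<Otimes>\<^sub>M M)"
proof -
  have "(\<lambda>x. (case x of (s, w) \<Rightarrow> if 0 \<le> s then f (s, w) else 0) *
      (case x of (s, w) \<Rightarrow> if 0 \<le> s then L s w else 0)) \<in> borel_measurable (borel \<Otimes>\<^sub>M M)"
    by (intro borel_measurable_times predictable_joint f L_joint_measurable) simp
  also have "(\<lambda>x. (case x of (s, w) \<Rightarrow> if 0 \<le> s then f (s, w) else 0) *
      (case x of (s, w) \<Rightarrow> if 0 \<le> s then L s w else 0)) =
      (\<lambda>(s, w). indicator {0..} s * (f (s, w) * L s w))"
    by (auto simp: indicator_def)
  also have "borel_measurable ((borel :: real measure) \<Otimes>\<^sub>M M) = borel_measurable (lborel \<Otimes>\<^sub>M M)"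
    by (intro measurable_cong_sets sets_pair_measure_cong) auto
  finally show ?thesis .
qed

lemma predictable_L_integrable:
  fixes f :: "real \<times> 'a \<Rightarrow> real"
  assumes f: "f \<in> borel_measurable predictable"
    and fin: "(\<integral>\<^sup>+w. (\<integral>\<^sup>+s\<in>{0..}. ennreal \<bar>f (s, w)\<bar> * ennreal (L s w) \<partial>lborel) \<partial>M) < \<infinity>"
  shows "integrable (M \<Otimes>\<^sub>M lborel) (\<lambda>(w, s). indicator {0..} s * (f (s, w) * L s w))"
proof (rule integrableI_bounded)
  have "(\<lambda>(s, w). indicator {0..} s * (f (s, w) * L s w)) \<in> borel_measurable (lborel \<Otimes>\<^sub>M M)"
    by (rule predictable_L_joint_measurable[OF f])
  from measurable_compose[OF measurable_pair_swap' this]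
  show m: "(\<lambda>(w, s). indicator {0..} s * (f (s, w) * L s w)) \<in> borel_measurable (M \<Otimes>\<^sub>M lborel)"
    by (simp only: case_prod_unfold fst_conv snd_conv)
  have "(\<integral>\<^sup>+x. ennreal (norm (case x of (w, s) \<Rightarrow> indicator {0..} s * (f (s, w) * L s w))) \<partial>(M \<Otimes>\<^sub>M lborel)) =
     (\<integral>\<^sup>+w. \<integral>\<^sup>+s. ennreal (norm (indicator {0..} s * (f (s, w) * L s w))) \<partial>lborel \<partial>M)"
    using m by (subst lborel.nn_integral_fst[symmetric]) auto
  also have "\<dots> = (\<integral>\<^sup>+w. (\<integral>\<^sup>+s\<in>{0..}. ennreal \<bar>f (s, w)\<bar> * ennreal (L s w) \<partial>lborel) \<partial>M)"
    using nonneg by (intro nn_integral_cong) (auto simp: indicator_def abs_mult ennreal_mult)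
  finally show "(\<integral>\<^sup>+x. ennreal (norm (case x of (w, s) \<Rightarrow> indicator {0..} s * (f (s, w) * L s w))) \<partial>(M \<Otimes>\<^sub>M lborel)) < \<infinity>"
    using fin by simp
qed

text \<open>The intensity property in real-valued form. The second claim is phrased with
  \<open>sums\<close>, so that the claims for the positive and the negative part of an integrand can
  be subtracted.\<close>

lemma compensation_nonneg:
  fixes f :: "real \<times> 'a \<Rightarrow> real"
  assumes f: "f \<in> borel_measurable predictable" and pos: "\<And>x. 0 \<le> f x"
    and fin: "(\<integral>\<^sup>+w. (\<integral>\<^sup>+s\<in>{0..}. ennreal (f (s, w)) * ennreal (L s w) \<partial>lborel) \<partial>M) < \<infinity>"
  shows "\<And>n. integrable M (\<lambda>w. if T n w < \<infinity> then f (enn2real (T n w), w) else 0)" (is "\<And>n. ?I n")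
    and "(\<lambda>n. \<integral>w. (if T n w < \<infinity> then f (enn2real (T n w), w) else 0) \<partial>M) sums
      (\<integral>w. (LBINT s:{0..}. f (s, w) * L s w) \<partial>M)"
proof -
  let ?Y = "\<lambda>n w. if T n w < \<infinity> then f (enn2real (T n w), w) else 0"
  have Y [measurable]: "?Y n \<in> borel_measurable M" for n
    by (rule measurable_historyD[OF predictable_at_event_time[OF f]]) simp
  have fe: "(\<lambda>x. ennreal (f x)) \<in> borel_measurable predictable" using f by measurable
  have "(\<integral>\<^sup>+w. (\<Sum>n. ennreal (?Y n w)) \<partial>M) =
      (\<integral>\<^sup>+w. (\<integral>\<^sup>+s\<in>{0..}. ennreal (f (s, w)) * ennreal (L s w) \<partial>lborel) \<partial>M)"
    unfolding intensity[OF fe, symmetric] counting_integral_def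
    by (intro nn_integral_cong suminf_cong) simp
  moreover have "(\<integral>\<^sup>+w. (\<Sum>n. ennreal (?Y n w)) \<partial>M) = (\<Sum>n. \<integral>\<^sup>+w. ennreal (?Y n w) \<partial>M)"
    by (rule nn_integral_suminf) measurable
  ultimately have sum: "(\<Sum>n. \<integral>\<^sup>+w. ennreal (?Y n w) \<partial>M) =
      (\<integral>\<^sup>+w. (\<integral>\<^sup>+s\<in>{0..}. ennreal (f (s, w)) * ennreal (L s w) \<partial>lborel) \<partial>M)" by simp
  show int: "integrable M (?Y n)" for n
  proof (rule integrableI_nonneg[OF Y])
    have "(\<integral>\<^sup>+w. ennreal (?Y n w) \<partial>M) \<le> (\<Sum>n. \<integral>\<^sup>+w. ennreal (?Y n w) \<partial>M)"
      using sum_le_suminf[OF summableI, of "{n}" "\<lambda>n. \<integral>\<^sup>+w. ennreal (?Y n w) \<partial>M"] by simp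
    then show "(\<integral>\<^sup>+w. ennreal (?Y n w) \<partial>M) < \<infinity>" using fin sum by simp
  qed (use pos in auto)
  have fin': "(\<integral>\<^sup>+w. (\<integral>\<^sup>+s\<in>{0..}. ennreal \<bar>f (s, w)\<bar> * ennreal (L s w) \<partial>lborel) \<partial>M) < \<infinity>"
    using fin pos by simp
  interpret pair_sigma_finite M lborel ..
  note P = predictable_L_integrable[OF f fin']
  have "ennreal (\<integral>w. (LBINT s:{0..}. f (s, w) * L s w) \<partial>M) =
      ennreal (\<integral>x. (case x of (w, s) \<Rightarrow> indicator {0..} s * (f (s, w) * L s w)) \<partial>(M \<Otimes>\<^sub>M lborel))"
    using integral_fst'[OF P] by (simp add: set_lebesgue_integral_def)
  also have "\<dots> = (\<integral>\<^sup>+x. ennreal (case x of (w, s) \<Rightarrow> indicator {0..} s * (f (s, w) * L s w)) \<partial>(M \<Otimes>\<^sub>M lborel))"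
    by (rule nn_integral_eq_integral[symmetric, OF P])
      (use pos nonneg in \<open>auto simp: space_pair_measure indicator_def intro!: AE_I2\<close>)
  also have "\<dots> = (\<integral>\<^sup>+w. \<integral>\<^sup>+s. ennreal (indicator {0..} s * (f (s, w) * L s w)) \<partial>lborel \<partial>M)"
    using borel_measurable_integrable[OF P] by (subst lborel.nn_integral_fst[symmetric]) auto
  also have "\<dots> = (\<integral>\<^sup>+w. (\<integral>\<^sup>+s\<in>{0..}. ennreal (f (s, w)) * ennreal (L s w) \<partial>lborel) \<partial>M)"
    using nonneg pos by (intro nn_integral_cong) (auto simp: indicator_def ennreal_mult)
  also have "\<dots> = (\<Sum>n. \<integral>\<^sup>+w. ennreal (?Y n w) \<partial>M)" by (rule sum[symmetric])
  also have "\<dots> = (\<Sum>n. ennreal (\<integral>w. ?Y n w \<partial>M))"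
    by (intro suminf_cong nn_integral_eq_integral int) (use pos in auto)
  finally have *: "(\<Sum>n. ennreal (\<integral>w. ?Y n w \<partial>M)) = ennreal (\<integral>w. (LBINT s:{0..}. f (s, w) * L s w) \<partial>M)"
    by simp
  have "(\<lambda>n. ennreal (\<integral>w. ?Y n w \<partial>M)) sums ennreal (\<integral>w. (LBINT s:{0..}. f (s, w) * L s w) \<partial>M)"
    unfolding *[symmetric] by (rule summable_sums[OF summableI])
  then show "(\<lambda>n. \<integral>w. ?Y n w \<partial>M) sums (\<integral>w. (LBINT s:{0..}. f (s, w) * L s w) \<partial>M)"
    by (rule sums_ennreal[THEN iffD1, rotated 2])
      (use pos nonneg in \<open>auto intro!: Bochner_Integration.integral_nonneg simp: set_lebesgue_integral_def indicator_def\<close>)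
qed

text \<open>The signed form of \<open>nn_compensation\<close>. Only \<open>f\<close> is split into
  positive and negative parts; the factor \<open>g (J n w)\<close> stays whole, as independence
  gives integrability and the mean of each product.\<close>

lemma compensation:
  fixes f :: "real \<times> 'a \<Rightarrow> real" and g :: "real \<Rightarrow> real"
  assumes f: "f \<in> borel_measurable predictable"
    and fin: "(\<integral>\<^sup>+w. (\<integral>\<^sup>+s\<in>{0..}. ennreal \<bar>f (s, w)\<bar> * ennreal (L s w) \<partial>lborel) \<partial>M) < \<infinity>"
    and g: "integrable M (\<lambda>w. g (X w))" "g \<in> borel_measurable borel"
  shows integrable_compensation_sum:
      "integrable M (\<lambda>w. \<Sum>n. if T n w < \<infinity> then f (enn2real (T n w), w) * g (J n w) else 0)"
    and integrable_compensator: "integrable M (\<lambda>w. LBINT s:{0..}. f (s, w) * L s w)"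
    and integral_compensation_sum:
      "(\<integral>w. (\<Sum>n. if T n w < \<infinity> then f (enn2real (T n w), w) * g (J n w) else 0) \<partial>M) =
       (\<integral>w. g (X w) \<partial>M) * (\<integral>w. (LBINT s:{0..}. f (s, w) * L s w) \<partial>M)"
proof -
  let ?Y = "\<lambda>f n w. if T n w < \<infinity> then f (enn2real (T n w), w) else (0::real)"
  define fp where "fp x = max 0 (f x)" for x
  define fn where "fn x = max 0 (- f x)" for x
  let ?Z = "\<lambda>n w. ?Y f n w * g (J n w)"
  interpret pair_sigma_finite M lborel ..
  have fpn: "fp \<in> borel_measurable predictable" "fn \<in> borel_measurable predictable"
    using f unfolding fp_def fn_def by measurable
  have pos: "\<And>x. 0 \<le> fp x" "\<And>x. 0 \<le> fn x" by (auto simp: fp_def fn_def)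
  have finp: "(\<integral>\<^sup>+w. (\<integral>\<^sup>+s\<in>{0..}. ennreal (fp (s, w)) * ennreal (L s w) \<partial>lborel) \<partial>M) < \<infinity>"
    by (rule order_le_less_trans[OF _ fin])
      (auto intro!: nn_integral_mono mult_right_mono ennreal_leI simp: fp_def)
  have finn: "(\<integral>\<^sup>+w. (\<integral>\<^sup>+s\<in>{0..}. ennreal (fn (s, w)) * ennreal (L s w) \<partial>lborel) \<partial>M) < \<infinity>"
    by (rule order_le_less_trans[OF _ fin])
      (auto intro!: nn_integral_mono mult_right_mono ennreal_leI simp: fn_def)
  note P = compensation_nonneg[OF fpn(1) pos(1) finp] and N = compensation_nonneg[OF fpn(2) pos(2) finn]
  have split: "?Y f n w = ?Y fp n w - ?Y fn n w" for n w by (simp add: fp_def fn_def max_def)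
  have Yint: "integrable M (?Y f n)" for n
    unfolding split by (rule Bochner_Integration.integrable_diff[OF P(1) N(1)])
  note PL = predictable_L_integrable[OF f fin]
  show "integrable M (\<lambda>w. LBINT s:{0..}. f (s, w) * L s w)"
    using integrable_fst'[OF PL] by (simp add: set_lebesgue_integral_def)
  have fst_int: "(\<integral>w. (LBINT s:{0..}. h (s, w) * L s w) \<partial>M) =
      (\<integral>x. (case x of (w, s) \<Rightarrow> indicator {0..} s * (h (s, w) * L s w)) \<partial>(M \<Otimes>\<^sub>M lborel))"
    "integrable (M \<Otimes>\<^sub>M lborel) (\<lambda>(w, s). indicator {0..} s * (h (s, w) * L s w))"
    if "h \<in> borel_measurable predictable" "\<And>x. 0 \<le> h x"
      "(\<integral>\<^sup>+w. (\<integral>\<^sup>+s\<in>{0..}. ennreal (h (s, w)) * ennreal (L s w) \<partial>lborel) \<partial>M) < \<infinity>" for h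
  proof -
    show *: "integrable (M \<Otimes>\<^sub>M lborel) (\<lambda>(w, s). indicator {0..} s * (h (s, w) * L s w))"
      using that by (intro predictable_L_integrable) auto
    show "(\<integral>w. (LBINT s:{0..}. h (s, w) * L s w) \<partial>M) =
      (\<integral>x. (case x of (w, s) \<Rightarrow> indicator {0..} s * (h (s, w) * L s w)) \<partial>(M \<Otimes>\<^sub>M lborel))"
      using integral_fst'[OF *] by (simp add: set_lebesgue_integral_def)
  qed
  have "(\<integral>w. (LBINT s:{0..}. fp (s, w) * L s w) \<partial>M) - (\<integral>w. (LBINT s:{0..}. fn (s, w) * L s w) \<partial>M) =
    (\<integral>x. (case x of (w, s) \<Rightarrow> indicator {0..} s * (fp (s, w) * L s w)) -
        (case x of (w, s) \<Rightarrow> indicator {0..} s * (fn (s, w) * L s w)) \<partial>(M \<Otimes>\<^sub>M lborel))"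
    unfolding fst_int(1)[OF fpn(1) pos(1) finp] fst_int(1)[OF fpn(2) pos(2) finn]
    by (rule Bochner_Integration.integral_diff[symmetric, OF fst_int(2)[OF fpn(1) pos(1) finp]
          fst_int(2)[OF fpn(2) pos(2) finn]])
  also have "\<dots> = (\<integral>x. (case x of (w, s) \<Rightarrow> indicator {0..} s * (f (s, w) * L s w)) \<partial>(M \<Otimes>\<^sub>M lborel))"
    by (intro Bochner_Integration.integral_cong) (auto simp: fp_def fn_def indicator_def max_def)
  also have "\<dots> = (\<integral>w. (LBINT s:{0..}. f (s, w) * L s w) \<partial>M)"
    using integral_fst'[OF PL] by (simp add: set_lebesgue_integral_def)
  finally have sumsY: "(\<lambda>n. \<integral>w. ?Y f n w \<partial>M) sums (\<integral>w. (LBINT s:{0..}. f (s, w) * L s w) \<partial>M)"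
    unfolding split Bochner_Integration.integral_diff[OF P(1) N(1)] using sums_diff[OF P(2) N(2)] by simp
  have indep: "indep_var borel (?Y f n) borel (\<lambda>w. g (J n w))" for n
    by (rule indep_var_history_jump[OF predictable_at_event_time[OF f] g(2)]) simp
  have Zint: "integrable M (?Z n)" for n
    by (rule indep_var_integrable[OF indep Yint integrable_jump(1)[OF g]])
  have EZ: "(\<integral>w. ?Z n w \<partial>M) = (\<integral>w. ?Y f n w \<partial>M) * (\<integral>w. g (X w) \<partial>M)" for n
    using indep_var_lebesgue_integral[OF indep Yint integrable_jump(1)[OF g]] integrable_jump(2)[OF g] by simp
  \<comment> \<open>The non-negative formula for the absolute values bounds the mean of the sum of
    all \<open>norm (?Z n w)\<close>. This yields both almost sure summability and summability of
    the means, which justify exchanging sum and integral.\<close>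
  have "(\<lambda>x. ennreal \<bar>f x\<bar>) \<in> borel_measurable predictable" "(\<lambda>x. ennreal \<bar>g x\<bar>) \<in> borel_measurable borel"
    using f g(2) by measurable
  note nn_compensation[OF this]
  moreover have "(\<integral>\<^sup>+w. ennreal \<bar>g (X w)\<bar> \<partial>M) < \<infinity>"
    using g(1) by (simp add: integrable_iff_bounded)
  ultimately have "(\<integral>\<^sup>+w. (\<Sum>n. if T n w < \<infinity> then ennreal \<bar>f (enn2real (T n w), w)\<bar> * ennreal \<bar>g (J n w)\<bar> else 0) \<partial>M) < \<infinity>"
    using fin by (simp add: ennreal_mult_less_top)
  also have "(\<integral>\<^sup>+w. (\<Sum>n. if T n w < \<infinity> then ennreal \<bar>f (enn2real (T n w), w)\<bar> * ennreal \<bar>g (J n w)\<bar> else 0) \<partial>M)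
      = (\<integral>\<^sup>+w. (\<Sum>n. ennreal (norm (?Z n w))) \<partial>M)"
    by (intro nn_integral_cong suminf_cong) (simp add: abs_mult ennreal_mult)
  finally have finZ: "(\<integral>\<^sup>+w. (\<Sum>n. ennreal (norm (?Z n w))) \<partial>M) < \<infinity>" .
  have Zm [measurable]: "(\<lambda>w. ennreal (norm (?Z n w))) \<in> borel_measurable M" for n
    by (rule measurable_compose[OF measurable_compose[OF borel_measurable_integrable[OF Zint] borel_measurable_norm] measurable_ennreal])
  have "AE w in M. (\<Sum>n. ennreal (norm (?Z n w))) \<noteq> \<infinity>"
    by (rule nn_integral_noteq_infinite[OF borel_measurable_suminf_order[OF Zm] less_imp_neq[OF finZ]])
  then have summable: "AE w in M. summable (\<lambda>n. norm (?Z n w))"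
    by eventually_elim (rule summable_suminf_not_top, simp_all only: norm_ge_zero infinity_ennreal_def not_False_eq_True)
  have "(\<Sum>n. ennreal (\<integral>w. norm (?Z n w) \<partial>M)) = (\<Sum>n. \<integral>\<^sup>+w. ennreal (norm (?Z n w)) \<partial>M)"
    by (intro suminf_cong nn_integral_eq_integral[symmetric] integrable_norm Zint) simp
  also have "\<dots> < \<infinity>" using finZ by (subst (asm) nn_integral_suminf[OF Zm]) simp
  finally have "(\<Sum>n. ennreal (\<integral>w. norm (?Z n w) \<partial>M)) < top" by simp
  then have summable': "summable (\<lambda>n. \<integral>w. norm (?Z n w) \<partial>M)"
    by (intro summable_suminf_not_top[OF Bochner_Integration.integral_nonneg[OF norm_ge_zero]] less_imp_neq)
  have Z: "(\<Sum>n. if T n w < \<infinity> then f (enn2real (T n w), w) * g (J n w) else 0) = (\<Sum>n. ?Z n w)" for w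
    by (intro suminf_cong) simp
  show "integrable M (\<lambda>w. \<Sum>n. if T n w < \<infinity> then f (enn2real (T n w), w) * g (J n w) else 0)"
    unfolding Z by (rule integrable_suminf[OF Zint summable summable'])
  show "(\<integral>w. (\<Sum>n. if T n w < \<infinity> then f (enn2real (T n w), w) * g (J n w) else 0) \<partial>M) =
       (\<integral>w. g (X w) \<partial>M) * (\<integral>w. (LBINT s:{0..}. f (s, w) * L s w) \<partial>M)"
    unfolding Z integral_suminf[OF Zint summable summable'] EZ
    using sums_unique[OF sums_mult2[OF sumsY]] by (simp add: mult.commute)
qed

end

subsection \<open>Paths of the intensity\<close>

lemma finite_initial_segment:
  fixes S :: "nat set"
  assumes "finite S" "\<And>m n. m \<le> n \<Longrightarrow> n \<in> S \<Longrightarrow> m \<in> S"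
  shows "S = {..<card S}"
proof -
  have "S \<noteq> UNIV" using assms(1) by auto
  then obtain k where k: "k \<notin> S" "\<And>m. m < k \<Longrightarrow> m \<in> S"
    using exists_least_iff[of "\<lambda>k. k \<notin> S"] by blast
  have "S = {..<k}" using k assms(2) by (auto simp: not_le[symmetric])
  then show ?thesis by simp
qed

lemma isCont_step:
  fixes s \<tau> c :: real
  assumes "s \<noteq> \<tau>"
  shows "isCont (\<lambda>u. if \<tau> \<le> u then c else 0) s"
proof (cases "s < \<tau>")
  case True
  have "\<forall>\<^sub>F u in nhds s. u \<in> {..<\<tau>}" using True by (intro eventually_nhds_in_open) auto
  then have "\<forall>\<^sub>F u in nhds s. (if \<tau> \<le> u then c else 0) = 0" by eventually_elim auto
  then show ?thesis by (subst isCont_cong) auto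
next
  case False
  have "\<forall>\<^sub>F u in nhds s. u \<in> {\<tau><..}" using False assms by (intro eventually_nhds_in_open) auto
  then have "\<forall>\<^sub>F u in nhds s. (if \<tau> \<le> u then c else 0) = c" by eventually_elim auto
  then show ?thesis by (subst isCont_cong) auto
qed

lemma step_at_left:
  fixes s \<tau> c :: real
  shows "((\<lambda>u. if \<tau> \<le> u then c else 0) \<longlongrightarrow> (if \<tau> < s then c else 0)) (at_left s)"
proof (rule tendsto_eventually, cases "\<tau> < s")
  case True
  from eventually_at_left_real[OF True]
  show "\<forall>\<^sub>F u in at_left s. (if \<tau> \<le> u then c else 0) = (if \<tau> < s then c else 0)"
    by eventually_elim auto
next
  case False
  have "\<forall>\<^sub>F u in at_left s. u < s" by (auto simp: eventually_at_filter)
  then show "\<forall>\<^sub>F u in at_left s. (if \<tau> \<le> u then c else 0) = (if \<tau> < s then c else 0)"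
    by eventually_elim (use False in auto)
qed

lemma has_integral_reflected_deriv:
  fixes f f' :: "real \<Rightarrow> real"
  assumes f: "\<And>r. (f has_real_derivative f' r) (at r)" and u: "0 \<le> u"
  shows "((\<lambda>s. - f' (t - s)) has_integral f (t - u) - f t) {0..u}"
proof -
  have "((\<lambda>s. f (t - s)) has_real_derivative f' (t - x) * (0 - 1)) (at x within {0..u})" for x
    by (rule DERIV_chain2[OF f DERIV_diff[OF DERIV_const DERIV_ident]])
  then have "((\<lambda>s. - f' (t - s)) has_integral f (t - u) - f (t - 0)) {0..u}"
    using u by (intro fundamental_theorem_of_calculus)
      (auto simp flip: has_real_derivative_iff_has_vector_derivative)
  then show ?thesis by simp
qed

lemma bounded_imp_abs_le:
  fixes f :: "'b \<Rightarrow> real"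
  shows "bounded (f ` S) \<Longrightarrow> \<exists>B. \<forall>s\<in>S. \<bar>f s\<bar> \<le> B"
  by (auto simp: bounded_iff)

lemma set_integrable_bounded_Icc:
  fixes f :: "real \<Rightarrow> real"
  assumes "f \<in> borel_measurable borel" "bounded (f ` {0..t})"
  shows "set_integrable lborel {0..t} f"
proof -
  obtain B where "\<forall>s\<in>{0..t}. \<bar>f s\<bar> \<le> B" using bounded_imp_abs_le[OF assms(2)] by blast
  then show ?thesis
    unfolding set_integrable_def using assms(1)
    by (intro integrableI_bounded_set_indicator[of _ _ _ B] AE_I2) (auto simp: emeasure_lborel_Icc_eq)
qed

context linear_self_exciting
begin

text \<open>Collects what holds only almost surely, namely distinct event times and the integral
  equation, so that path arguments can be made for one fixed \<open>w\<close>.\<close>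

definition regular_path :: "'a \<Rightarrow> bool" where
  "regular_path w \<longleftrightarrow> w \<in> space M \<and> (\<forall>n. T n w < \<infinity> \<longrightarrow> T n w < T (Suc n) w) \<and>
    (\<forall>t\<ge>0. L t w = l + (LBINT s:{0..t}. \<alpha> * (lam\<^sub>0 - L s w)) + \<beta> * jump_sum T J t w)"

abbreviation event_time :: "nat \<Rightarrow> 'a \<Rightarrow> real" where
  "event_time n w \<equiv> enn2real (T n w)"

abbreviation drift :: "'a \<Rightarrow> real \<Rightarrow> real" where
  "drift w \<equiv> \<lambda>s. \<alpha> * (lam\<^sub>0 - L s w)"

lemma AE_regular_path: "AE w in M. regular_path w"
  using simple dynamics AE_space by eventually_elim (simp add: regular_path_def)

lemma T_mono: "w \<in> space M \<Longrightarrow> m \<le> n \<Longrightarrow> T m w \<le> T n w"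
  by (rule lift_Suc_mono_le[of "\<lambda>n. T n w"]) (rule nondecreasing)

lemma T_strict_mono:
  assumes "regular_path w" "m < n" "T m w < \<infinity>"
  shows "T m w < T n w"
proof -
  have "T m w < T (Suc m) w" using assms by (simp add: regular_path_def)
  also have "\<dots> \<le> T n w" using assms by (intro T_mono) (auto simp: regular_path_def)
  finally show ?thesis .
qed

lemma L_bounded: "w \<in> space M \<Longrightarrow> bounded ((\<lambda>s. L s w) ` {0..t})"
  by (rule cadlag_bounded_Icc[OF paths])

lemma mult_L_set_integrable:
  fixes h :: "real \<Rightarrow> real"
  assumes "w \<in> space M" "continuous_on UNIV h"
  shows "set_integrable lborel {0..t} (\<lambda>s. h s * L s w)"
proof -
  have "compact (h ` {0..t})"
    by (intro compact_continuous_image continuous_on_subset[OF assms(2)]) auto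
  then obtain B where B: "\<forall>s\<in>{0..t}. \<bar>h s\<bar> \<le> B"
    using bounded_imp_abs_le[OF compact_imp_bounded] by blast
  obtain C where C: "\<forall>s\<in>{0..t}. \<bar>L s w\<bar> \<le> C"
    using bounded_imp_abs_le[OF L_bounded[OF assms(1)]] by blast
  \<comment> \<open>The cut at 0 is needed for measurability on the whole line: at negative times
    \<open>L\<close> is arbitrary.\<close>
  have "set_integrable lborel {0..t} (\<lambda>s. h s * (if 0 \<le> s then L s w else 0))"
  proof (rule set_integrable_bounded_Icc)
    show "(\<lambda>s. h s * (if 0 \<le> s then L s w else 0)) \<in> borel_measurable borel"
      by (intro borel_measurable_times L_section_measurable borel_measurable_continuous_onI assms)
    show "bounded ((\<lambda>s. h s * (if 0 \<le> s then L s w else 0)) ` {0..t})"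
    proof (rule boundedI, elim imageE)
      fix x s assume "x = h s * (if 0 \<le> s then L s w else 0)" "s \<in> {0..t}"
      moreover have "\<bar>h s\<bar> * \<bar>if 0 \<le> s then L s w else 0\<bar> \<le> B * C" if "s \<in> {0..t}"
        using bspec[OF B that] bspec[OF C that] that by (intro mult_mono) auto
      ultimately show "norm x \<le> B * C" by (simp add: abs_mult)
    qed
  qed
  then show ?thesis
    by (rule set_integrable_cong[THEN iffD1, rotated -1]) auto
qed

lemma L_set_integrable: "w \<in> space M \<Longrightarrow> set_integrable lborel {0..t} (\<lambda>s. L s w)"
  using mult_L_set_integrable[of w "\<lambda>_. 1" t] by simp

lemma drift_set_integrable:
  assumes "w \<in> space M"
  shows "set_integrable lborel {0..t} (drift w)"
proof -
  have "set_integrable lborel {0..t} (\<lambda>s. lam\<^sub>0)"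
    by (rule set_integrable_bounded_Icc) (auto simp: bounded_iff)
  then show ?thesis
    by (intro set_integrable_mult_right set_integral_diff L_set_integrable assms)
qed

text \<open>Event times are ordered, so the events up to \<open>t\<close> form an initial segment of
  the numbering. Finiteness is assumed because \<open>card\<close>, and with it
  \<open>counting\<close>, is 0 on infinite sets.\<close>

lemma events_before:
  assumes "regular_path w" "finite {n. T n w \<le> ennreal t}"
  shows "{n. T n w \<le> ennreal t} = {..<counting T t w}"
  unfolding counting_def using assms T_mono[of w]
  by (intro finite_initial_segment) (auto simp: regular_path_def intro: order_trans)

lemma event_time_le:
  assumes "regular_path w" "finite {n. T n w \<le> ennreal t}" "0 \<le> t" "n < counting T t w"
  shows "event_time n w \<in> {0..t}" "T n w = ennreal (event_time n w)" "T n w < \<infinity>"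
proof -
  have le: "T n w \<le> ennreal t" using events_before[OF assms(1,2)] assms(4) by auto
  then show "T n w < \<infinity>" by (rule order_le_less_trans) simp
  then show "T n w = ennreal (event_time n w)" by simp
  then show "event_time n w \<in> {0..t}" using le assms(3) by (metis atLeastAtMost_iff enn2real_nonneg ennreal_le_iff)
qed

lemma event_time_less_iff:
  assumes "regular_path w" "finite {n. T n w \<le> ennreal t}" "0 \<le> t" "n < counting T t w" "m < counting T t w"
  shows "event_time m w < event_time n w \<longleftrightarrow> m < n"
proof -
  have *: "event_time m w < event_time n w" if "m < n" "m < counting T t w" "n < counting T t w" for m n
    using T_strict_mono[OF assms(1) that(1)] event_time_le[OF assms(1-3) that(2)] event_time_le[OF assms(1-3) that(3)]
    by (metis enn2real_nonneg ennreal_less_iff)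
  show ?thesis using *[of m n] *[of n m] assms(4,5) by (cases m n rule: linorder_cases) auto
qed

text \<open>Replaces a sum whose length varies with \<open>u\<close> by a step function of
  \<open>u\<close> over a fixed index set, the form in which \<open>jump_product_rule\<close> takes
  its paths.\<close>

lemma sum_events_before:
  fixes f :: "nat \<Rightarrow> real"
  assumes "regular_path w" "finite {n. T n w \<le> ennreal t}" "u \<in> {0..t}"
  shows "finite {n. T n w \<le> ennreal u}"
    "(\<Sum>n<counting T u w. f n) = (\<Sum>n<counting T t w. if event_time n w \<le> u then f n else 0)"
proof -
  have sub: "{n. T n w \<le> ennreal u} \<subseteq> {n. T n w \<le> ennreal t}"
    using assms(3) by (auto intro: order_trans ennreal_leI)
  then show fin: "finite {n. T n w \<le> ennreal u}" using assms(2) by (rule finite_subset)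
  have "{n. T n w \<le> ennreal u} = {n \<in> {..<counting T t w}. event_time n w \<le> u}"
  proof (intro set_eqI iffI)
    fix n assume "n \<in> {n. T n w \<le> ennreal u}"
    then show "n \<in> {n \<in> {..<counting T t w}. event_time n w \<le> u}"
      unfolding events_before[OF assms(1,2), symmetric] using sub assms(3) by (auto intro: enn2real_leI)
  next
    fix n assume n: "n \<in> {n \<in> {..<counting T t w}. event_time n w \<le> u}"
    then have "T n w = ennreal (event_time n w)"
      using assms(3) by (intro event_time_le(2)[OF assms(1,2)]) auto
    also have "\<dots> \<le> ennreal u" using n by (intro ennreal_leI) simp
    finally show "n \<in> {n. T n w \<le> ennreal u}" by simp
  qed
  then have "{..<counting T u w} = {n \<in> {..<counting T t w}. event_time n w \<le> u}"
    by (simp only: events_before[OF assms(1) fin])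
  then show "(\<Sum>n<counting T u w. f n) = (\<Sum>n<counting T t w. if event_time n w \<le> u then f n else 0)"
    by (simp add: sum.If_cases Int_def)
qed

lemma path_decomposition:
  assumes "regular_path w" "finite {n. T n w \<le> ennreal t}" "u \<in> {0..t}"
  shows "L u w = l + integral {0..u} (drift w) +
    (\<Sum>n<counting T t w. if event_time n w \<le> u then \<beta> * J n w else 0)"
proof -
  have w: "w \<in> space M" using assms(1) by (simp add: regular_path_def)
  have "L u w = l + (LBINT s:{0..u}. \<alpha> * (lam\<^sub>0 - L s w)) + \<beta> * jump_sum T J u w"
    using assms(1,3) by (simp add: regular_path_def)
  also have "(LBINT s:{0..u}. \<alpha> * (lam\<^sub>0 - L s w)) = integral {0..u} (drift w)"
    by (rule set_borel_integral_eq_integral(2)[OF drift_set_integrable[OF w]])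
  finally show ?thesis
    unfolding jump_sum_def sum_distrib_left using sum_events_before(2)[OF assms, of "\<lambda>n. \<beta> * J n w"] by simp
qed

lemma path_continuous_off_events:
  assumes "regular_path w" "finite {n. T n w \<le> ennreal t}"
    and s: "s \<in> {0<..<t} - (\<lambda>n. event_time n w) ` {..<counting T t w}"
  shows "isCont (\<lambda>s. L s w) s"
proof -
  have w: "w \<in> space M" using assms(1) by (simp add: regular_path_def)
  have "continuous_on {0<..<t} (\<lambda>u. integral {0..u} (drift w))"
    by (rule continuous_on_subset[OF indefinite_integral_continuous_1[of _ 0 t]])
      (auto intro: set_borel_integral_eq_integral(1)[OF drift_set_integrable[OF w]])
  then have "isCont (\<lambda>u. integral {0..u} (drift w)) s"
    using s by (simp add: continuous_on_eq_continuous_at)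
  then have "isCont (\<lambda>u. l + integral {0..u} (drift w) +
      (\<Sum>n<counting T t w. if event_time n w \<le> u then \<beta> * J n w else 0)) s"
    using s by (intro continuous_intros isCont_step) auto
  moreover have "\<forall>\<^sub>F u in nhds s. u \<in> {0<..<t}" using s by (intro eventually_nhds_in_open) auto
  then have "\<forall>\<^sub>F u in nhds s. L u w = l + integral {0..u} (drift w) +
      (\<Sum>n<counting T t w. if event_time n w \<le> u then \<beta> * J n w else 0)"
    by eventually_elim (rule path_decomposition[OF assms(1,2)], simp)
  ultimately show ?thesis by (simp add: isCont_cong)
qed

text \<open>The integral is continuous, and each step loses its own jump time in the left limit:
  \<open>\<le>\<close> turns into \<open><\<close>.\<close>

lemma left_intensity_decomposition:
  assumes "regular_path w" "finite {n. T n w \<le> ennreal t}" "s \<in> {0..t}"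
  shows "left_intensity s w = l + integral {0..s} (drift w) +
    (\<Sum>n<counting T t w. if event_time n w < s then \<beta> * J n w else 0)"
proof (cases "s = 0")
  case True
  have "\<not> event_time n w < 0" for n by (simp add: not_less)
  with True show ?thesis by (simp add: left_intensity_def)
next
  case False
  then have s: "0 < s" using assms(3) by simp
  have w: "w \<in> space M" using assms(1) by (simp add: regular_path_def)
  have "continuous_on {0..s} (\<lambda>u. integral {0..u} (drift w))"
    by (rule indefinite_integral_continuous_1)
      (auto intro: set_borel_integral_eq_integral(1)[OF drift_set_integrable[OF w]])
  then have "((\<lambda>u. integral {0..u} (drift w)) \<longlongrightarrow> integral {0..s} (drift w)) (at s within {0..s})"
    using s by (auto simp: continuous_on_def)
  then have "((\<lambda>u. integral {0..u} (drift w)) \<longlongrightarrow> integral {0..s} (drift w)) (at_left s)"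
    using at_within_Icc_at_left[OF s] by simp
  then have "((\<lambda>u. l + integral {0..u} (drift w) +
      (\<Sum>n<counting T t w. if event_time n w \<le> u then \<beta> * J n w else 0)) \<longlongrightarrow>
      l + integral {0..s} (drift w) +
      (\<Sum>n<counting T t w. if event_time n w < s then \<beta> * J n w else 0)) (at_left s)"
    by (intro tendsto_intros step_at_left)
  moreover have "\<forall>\<^sub>F u in at_left s. u \<in> {0<..<s}" using eventually_at_left_real[OF s] .
  then have "\<forall>\<^sub>F u in at_left s. l + integral {0..u} (drift w) +
      (\<Sum>n<counting T t w. if event_time n w \<le> u then \<beta> * J n w else 0) = L u w"
    by eventually_elim (rule path_decomposition[OF assms(1,2), symmetric], use assms(3) in simp)
  ultimately have "((\<lambda>s. L s w) \<longlongrightarrow> l + integral {0..s} (drift w) +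
      (\<Sum>n<counting T t w. if event_time n w < s then \<beta> * J n w else 0)) (at_left s)"
    by (rule Lim_transform_eventually)
  then show ?thesis
    using tendsto_left_intensity[OF w s] tendsto_unique[OF trivial_limit_at_left_real] by blast
qed

text \<open>As event times are distinct, the jumps strictly before the \<open>n\<close>-th event
  time are those with smaller index. This identifies the terms \<open>x_pre n\<close> of
  \<open>jump_product_rule\<close> with left limits of \<open>L\<close>.\<close>

lemma left_intensity_at_event:
  assumes "regular_path w" "finite {n. T n w \<le> ennreal t}" "0 \<le> t" "n < counting T t w"
  shows "left_intensity (event_time n w) w =
    l + integral {0..event_time n w} (drift w) + (\<Sum>m<n. \<beta> * J m w)"
proof -
  have "(\<Sum>m<counting T t w. if event_time m w < event_time n w then \<beta> * J m w else 0) =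
    (\<Sum>m<counting T t w. if m < n then \<beta> * J m w else 0)"
    using event_time_less_iff[OF assms(1-4)] by (intro sum.cong) auto
  also have "\<dots> = (\<Sum>m<n. \<beta> * J m w)"
    using assms(4) by (simp add: sum.If_cases Int_def) (rule sum.cong, auto)
  finally show ?thesis
    using left_intensity_decomposition[OF assms(1,2) event_time_le(1)[OF assms]] by simp
qed

text \<open>Away from the event times the steps with \<open><\<close> and with \<open>\<le>\<close>
  agree. For an event that never occurs \<open>event_time\<close> is 0, so the hypothesis may
  exclude \<open>s = 0\<close> as well; this is one point only.\<close>

lemma left_intensity_off_events:
  assumes "regular_path w" "finite {n. T n w \<le> ennreal s}" "0 \<le> s" "\<And>n. event_time n w \<noteq> s"
  shows "left_intensity s w = L s w"
proof -
  have "(\<Sum>n<counting T s w. if event_time n w < s then \<beta> * J n w else 0) =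
    (\<Sum>n<counting T s w. if event_time n w \<le> s then \<beta> * J n w else 0)"
    using assms(4) by (intro sum.cong) (auto simp: less_le)
  then show ?thesis
    using left_intensity_decomposition[OF assms(1,2), of s] path_decomposition[OF assms(1,2), of s] assms(3)
    by simp
qed

section \<open>Product rules along a path of the intensity\<close>

text \<open>Product rule for \<open>L\<close> and a smooth deterministic weight, which has no jumps
  of its own. The function \<Theta> is chosen to absorb the constant part \<alpha>
  \<open>lam\<^sub>0\<close> of the drift, so that the remaining integrand is linear in
  \<open>L\<close>. Different weights serve to bound the paths, to form \<open>Z\<close> and to
  compute means.\<close>

lemma weighted_path_decomposition:
  fixes \<theta> \<theta>' \<Theta> :: "real \<Rightarrow> real"
  assumes "regular_path w" "finite {n. T n w \<le> ennreal t}" "u \<in> {0..t}"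
    and \<theta>: "\<And>r. (\<theta> has_real_derivative \<theta>' r) (at r)" "continuous_on UNIV \<theta>'"
    and \<Theta>: "\<And>r. (\<Theta> has_real_derivative \<alpha> * lam\<^sub>0 * \<theta> r) (at r)"
  shows "\<theta> (t - u) * L u w + \<Theta> (t - u) = \<theta> t * l + \<Theta> t +
    integral {0..u} (\<lambda>s. (- \<theta>' (t - s) - \<alpha> * \<theta> (t - s)) * L s w) +
    (\<Sum>n<counting T t w. if event_time n w \<le> u then \<beta> * \<theta> (t - event_time n w) * J n w else 0)"
proof -
  have w: "w \<in> space M" using assms(1) by (simp add: regular_path_def)
  have u: "0 \<le> u" using assms(3) by simp
  note fin_u = sum_events_before(1)[OF assms(1-3)]
  have FTC: "((\<lambda>s. - \<theta>' (t - s)) has_integral \<theta> (t - r) - \<theta> t) {0..r}" if "0 \<le> r" for r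
    by (rule has_integral_reflected_deriv[OF \<theta>(1) that])
  have FTC_\<Theta>: "((\<lambda>s. - (\<alpha> * lam\<^sub>0 * \<theta> (t - s))) has_integral \<Theta> (t - u) - \<Theta> t) {0..u}"
    by (rule has_integral_reflected_deriv[OF \<Theta> u])
  have \<theta>'_cont: "isCont (\<lambda>s. - \<theta>' (t - s)) s" for s
    using \<theta>(2) by (intro continuous_intros isCont_o2[of _ "\<lambda>s. t - s" \<theta>'])
      (auto simp: continuous_on_eq_continuous_at)
  have prod: "((\<lambda>s. L s w * - \<theta>' (t - s) + \<theta> (t - s) * (\<alpha> * (lam\<^sub>0 - L s w))) has_integral
    L u w * \<theta> (t - u) - l * \<theta> t -
    (\<Sum>n<counting T u w. (l + integral {0..event_time n w} (drift w) + (\<Sum>m<n. \<beta> * J m w)) * 0 +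
      (\<theta> t + integral {0..event_time n w} (\<lambda>s. - \<theta>' (t - s)) + (\<Sum>m<n. 0)) * (\<beta> * J n w) + \<beta> * J n w * 0)) {0..u}"
  proof (rule jump_product_rule[where x = "\<lambda>s. L s w" and y = "\<lambda>s. \<theta> (t - s)"
        and a = "drift w" and b = "\<lambda>s. - \<theta>' (t - s)"
        and j = "\<lambda>n. \<beta> * J n w" and k = "\<lambda>n. 0"
        and x\<^sub>0 = l and y\<^sub>0 = "\<theta> t" and \<tau> = "\<lambda>n. event_time n w" and N = "counting T u w", OF u])
    show "event_time n w \<in> {0..u}" if "n < counting T u w" for n
      by (rule event_time_le(1)[OF assms(1) fin_u u that])
    show "(drift w) integrable_on {0..u}"
      by (rule set_borel_integral_eq_integral(1)[OF drift_set_integrable[OF w]])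
    show "isCont (drift w) s"
      if "s \<in> {0<..<u} - (\<lambda>n. event_time n w) ` {..<counting T u w}" for s
      by (intro continuous_intros path_continuous_off_events[OF assms(1) fin_u that])
    show "(\<lambda>s. - \<theta>' (t - s)) integrable_on {0..u}" using FTC[OF u] by blast
    show "L r w = l + integral {0..r} (drift w) +
         (\<Sum>n<counting T u w. if event_time n w \<le> r then \<beta> * J n w else 0)" if "r \<in> {0..u}" for r
      by (rule path_decomposition[OF assms(1) fin_u that])
    show "\<theta> (t - r) = \<theta> t + integral {0..r} (\<lambda>s. - \<theta>' (t - s)) +
         (\<Sum>n<counting T u w. if event_time n w \<le> r then 0 else 0)" if "r \<in> {0..u}" for r
      using integral_unique[OF FTC[of r]] that by simp
  qed (rule \<theta>'_cont)
  have "((\<lambda>s. (- \<theta>' (t - s) - \<alpha> * \<theta> (t - s)) * L s w) has_integral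
    L u w * \<theta> (t - u) - l * \<theta> t -
    (\<Sum>n<counting T u w. (\<theta> t + integral {0..event_time n w} (\<lambda>s. - \<theta>' (t - s))) * (\<beta> * J n w)) + (\<Theta> (t - u) - \<Theta> t)) {0..u}"
  proof (rule has_integral_eq_rhs[OF has_integral_eq[OF _ has_integral_add[OF prod FTC_\<Theta>]]])
    show "L s w * - \<theta>' (t - s) + \<theta> (t - s) * (\<alpha> * (lam\<^sub>0 - L s w)) + - (\<alpha> * lam\<^sub>0 * \<theta> (t - s)) =
      (- \<theta>' (t - s) - \<alpha> * \<theta> (t - s)) * L s w" for s
      by (simp add: algebra_simps)
  qed simp
  from integral_unique[OF this]
  have "\<theta> (t - u) * L u w + \<Theta> (t - u) = \<theta> t * l + \<Theta> t +
    integral {0..u} (\<lambda>s. (- \<theta>' (t - s) - \<alpha> * \<theta> (t - s)) * L s w) +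
    (\<Sum>n<counting T u w. (\<theta> t + integral {0..event_time n w} (\<lambda>s. - \<theta>' (t - s))) * (\<beta> * J n w))"
    by (simp add: mult.commute)
  also have "(\<Sum>n<counting T u w. (\<theta> t + integral {0..event_time n w} (\<lambda>s. - \<theta>' (t - s))) * (\<beta> * J n w)) =
    (\<Sum>n<counting T u w. \<beta> * \<theta> (t - event_time n w) * J n w)"
    using integral_unique[OF FTC] by (intro sum.cong) auto
  also have "\<dots> = (\<Sum>n<counting T t w. if event_time n w \<le> u then \<beta> * \<theta> (t - event_time n w) * J n w else 0)"
    by (rule sum_events_before(2)[OF assms(1-3)])
  finally show ?thesis .
qed

text \<open>\<open>jump_product_rule\<close> with both paths equal to \<open>L\<close>. The cross
  terms carry left limits, as compensation requires.\<close>

lemma path_square: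
  assumes "regular_path w" "finite {n. T n w \<le> ennreal t}" "0 \<le> t"
  shows "((\<lambda>s. 2 * L s w * (\<alpha> * (lam\<^sub>0 - L s w))) has_integral
    (L t w)\<^sup>2 - l\<^sup>2 - (\<Sum>n<counting T t w.
      2 * left_intensity (event_time n w) w * (\<beta> * J n w) + (\<beta> * J n w)\<^sup>2)) {0..t}"
proof -
  have w: "w \<in> space M" using assms(1) by (simp add: regular_path_def)
  let ?x = "\<lambda>n. l + integral {0..event_time n w} (drift w) + (\<Sum>m<n. \<beta> * J m w)"
  have "((\<lambda>s. L s w * (\<alpha> * (lam\<^sub>0 - L s w)) + L s w * (\<alpha> * (lam\<^sub>0 - L s w))) has_integral
    L t w * L t w - l * l - (\<Sum>n<counting T t w.
      ?x n * (\<beta> * J n w) + ?x n * (\<beta> * J n w) + \<beta> * J n w * (\<beta> * J n w))) {0..t}"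
  proof (rule jump_product_rule[where x = "\<lambda>s. L s w" and y = "\<lambda>s. L s w"
        and a = "drift w" and b = "drift w"
        and j = "\<lambda>n. \<beta> * J n w" and k = "\<lambda>n. \<beta> * J n w"
        and x\<^sub>0 = l and y\<^sub>0 = l and \<tau> = "\<lambda>n. event_time n w" and N = "counting T t w", OF assms(3)])
    show "event_time n w \<in> {0..t}" if "n < counting T t w" for n
      by (rule event_time_le(1)[OF assms that])
    show "(drift w) integrable_on {0..t}"
      by (rule set_borel_integral_eq_integral(1)[OF drift_set_integrable[OF w]])
    show "isCont (drift w) s"
      if "s \<in> {0<..<t} - (\<lambda>n. event_time n w) ` {..<counting T t w}" for s
      by (intro continuous_intros path_continuous_off_events[OF assms(1,2) that])
    show "L r w = l + integral {0..r} (drift w) +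
         (\<Sum>n<counting T t w. if event_time n w \<le> r then \<beta> * J n w else 0)" if "r \<in> {0..t}" for r
      by (rule path_decomposition[OF assms(1,2) that])
    show "L r w = l + integral {0..r} (drift w) +
         (\<Sum>n<counting T t w. if event_time n w \<le> r then \<beta> * J n w else 0)" if "r \<in> {0..t}" for r
      by (rule path_decomposition[OF assms(1,2) that])
    show "(drift w) integrable_on {0..t}"
      by (rule set_borel_integral_eq_integral(1)[OF drift_set_integrable[OF w]])
    show "isCont (drift w) s"
      if "s \<in> {0<..<t} - (\<lambda>n. event_time n w) ` {..<counting T t w}" for s
      by (intro continuous_intros path_continuous_off_events[OF assms(1,2) that])
  qed
  moreover have "(\<Sum>n<counting T t w. ?x n * (\<beta> * J n w) + ?x n * (\<beta> * J n w) + \<beta> * J n w * (\<beta> * J n w)) =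
     (\<Sum>n<counting T t w. 2 * left_intensity (event_time n w) w * (\<beta> * J n w) + (\<beta> * J n w)\<^sup>2)"
    using left_intensity_at_event[OF assms] by (intro sum.cong) (auto simp: power2_eq_square)
  ultimately have sq: "((\<lambda>s. L s w * (\<alpha> * (lam\<^sub>0 - L s w)) + L s w * (\<alpha> * (lam\<^sub>0 - L s w))) has_integral
    (L t w)\<^sup>2 - l\<^sup>2 - (\<Sum>n<counting T t w.
      2 * left_intensity (event_time n w) w * (\<beta> * J n w) + (\<beta> * J n w)\<^sup>2)) {0..t}"
    by (simp only: power2_eq_square)
  show ?thesis by (rule has_integral_eq[OF _ sq]) simp
qed

subsection \<open>Second moments and absence of explosion\<close>

text \<open>Before \<open>T k\<close> only the events with index below \<open>k\<close> can have
  occurred; hence localizing at \<open>T k\<close> excludes explosion by itself.\<close>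

lemma finite_events_before:
  assumes "w \<in> space M" "ennreal s < T k w"
  shows "finite {n. T n w \<le> ennreal s}" "counting T s w \<le> k"
proof -
  have "{n. T n w \<le> ennreal s} \<subseteq> {..<k}"
  proof safe
    fix n assume "T n w \<le> ennreal s"
    then have "T n w < T k w" using assms(2) by (rule order_le_less_trans)
    then show "n < k" using T_mono[OF assms(1), of k n] by (meson leD leI)
  qed
  then show "finite {n. T n w \<le> ennreal s}" "counting T s w \<le> k"
    unfolding counting_def using finite_subset card_mono[of "{..<k}"] by fastforce+
qed

lemma integrable_jump_square: "integrable M (\<lambda>w. (J n w)\<^sup>2)"
  by (rule integrable_jump(1)[OF X_square_integrable]) measurable

lemma integrable_sum_jumps_square: "integrable M (\<lambda>w. (1 + (\<Sum>n<k. \<bar>J n w\<bar>))\<^sup>2)"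
proof (induction k)
  case (Suc k)
  show ?case
  proof (rule Bochner_Integration.integrable_bound)
    show "integrable M (\<lambda>w. 2 * (1 + (\<Sum>n<k. \<bar>J n w\<bar>))\<^sup>2 + 2 * (J k w)\<^sup>2)"
      using Suc integrable_jump_square by simp
    show "AE w in M. norm ((1 + (\<Sum>n<Suc k. \<bar>J n w\<bar>))\<^sup>2) \<le> norm (2 * (1 + (\<Sum>n<k. \<bar>J n w\<bar>))\<^sup>2 + 2 * (J k w)\<^sup>2)"
    proof (rule AE_I2)
      fix w
      have "(a + b)\<^sup>2 \<le> 2 * a\<^sup>2 + 2 * b\<^sup>2" for a b :: real
        using zero_le_power2[of "a - b"] by (simp add: power2_eq_square algebra_simps)
      from this[of "1 + (\<Sum>n<k. \<bar>J n w\<bar>)" "\<bar>J k w\<bar>"]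
      show "norm ((1 + (\<Sum>n<Suc k. \<bar>J n w\<bar>))\<^sup>2) \<le> norm (2 * (1 + (\<Sum>n<k. \<bar>J n w\<bar>))\<^sup>2 + 2 * (J k w)\<^sup>2)"
        by (simp add: add.assoc)
    qed
  qed measurable
qed simp

text \<open>Variation of constants expresses \<open>L\<close> explicitly through its jumps, with
  exponential weights bounded by \<open>E\<close> for either sign of \<alpha>. The constant
  \<open>C\<close> is uniform in \<open>w\<close>, \<open>s\<close> and \<open>k\<close>.\<close>

lemma intensity_bound_by_jumps:
  assumes "0 \<le> t"
  shows "\<exists>C\<ge>0. \<forall>w s k. regular_path w \<longrightarrow> s \<in> {0..t} \<longrightarrow> ennreal s < T k w \<longrightarrow>
    L s w \<le> C * (1 + (\<Sum>n<k. \<bar>J n w\<bar>))"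
proof -
  define E where "E = exp (\<bar>\<alpha>\<bar> * t)"
  have E: "exp (- \<alpha> * r) \<le> E" "0 \<le> E" if "r \<in> {0..t}" for r
  proof -
    have "- \<alpha> * r \<le> \<bar>\<alpha>\<bar> * r" using that by (intro mult_right_mono) auto
    also have "\<dots> \<le> \<bar>\<alpha>\<bar> * t" using that by (intro mult_left_mono) auto
    finally show "exp (- \<alpha> * r) \<le> E" by (simp add: E_def)
  qed (simp add: E_def)
  define C where "C = lam\<^sub>0 + E * \<bar>l - lam\<^sub>0\<bar> + \<bar>\<beta>\<bar> * E"
  have "L s w \<le> C * (1 + (\<Sum>n<k. \<bar>J n w\<bar>))"
    if w: "regular_path w" and s: "s \<in> {0..t}" and k: "ennreal s < T k w" for w s k
  proof -
    have sp: "w \<in> space M" using w by (simp add: regular_path_def)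
    note fin = finite_events_before[OF sp k]
    have s0: "0 \<le> s" "s \<in> {0..s}" using s by auto
    have d: "((\<lambda>r. exp (- \<alpha> * r)) has_real_derivative - \<alpha> * exp (- \<alpha> * r)) (at r)" for r
      by (auto intro!: derivative_eq_intros)
    have d': "((\<lambda>r. - lam\<^sub>0 * exp (- \<alpha> * r)) has_real_derivative \<alpha> * lam\<^sub>0 * exp (- \<alpha> * r)) (at r)" for r
      by (auto intro!: derivative_eq_intros)
    have c: "continuous_on UNIV (\<lambda>r. - \<alpha> * exp (- \<alpha> * r))" by (intro continuous_intros)
    \<comment> \<open>For the weight exp (-\<alpha> r) the factor -\<theta>' - \<alpha> \<theta>
      vanishes, and with it the integral over the path in
      \<open>weighted_path_decomposition\<close>.\<close>
    have "L s w = lam\<^sub>0 + exp (- \<alpha> * s) * (l - lam\<^sub>0) +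
      (\<Sum>n<counting T s w. if event_time n w \<le> s then \<beta> * exp (- \<alpha> * (s - event_time n w)) * J n w else 0)"
      using weighted_path_decomposition[OF w fin(1) s0(2) d c d'] by (simp add: algebra_simps)
    also have "\<dots> \<le> lam\<^sub>0 + E * \<bar>l - lam\<^sub>0\<bar> + (\<Sum>n<counting T s w. \<bar>\<beta>\<bar> * E * \<bar>J n w\<bar>)"
    proof (intro add_mono order_refl sum_mono)
      have "exp (- \<alpha> * s) * (l - lam\<^sub>0) \<le> exp (- \<alpha> * s) * \<bar>l - lam\<^sub>0\<bar>"
        by (intro mult_left_mono) auto
      also have "\<dots> \<le> E * \<bar>l - lam\<^sub>0\<bar>" using E[OF s] by (intro mult_right_mono) auto
      finally show "exp (- \<alpha> * s) * (l - lam\<^sub>0) \<le> E * \<bar>l - lam\<^sub>0\<bar>" .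
    next
      fix n assume "n \<in> {..<counting T s w}"
      then have n: "event_time n w \<in> {0..s}" by (intro event_time_le(1)[OF w fin(1) s0(1)]) simp
      then have r: "s - event_time n w \<in> {0..t}"
        using s unfolding atLeastAtMost_iff by linarith
      have "\<beta> * exp (- \<alpha> * (s - event_time n w)) * J n w \<le> \<bar>\<beta>\<bar> * exp (- \<alpha> * (s - event_time n w)) * \<bar>J n w\<bar>"
        using abs_ge_self[of "\<beta> * exp (- \<alpha> * (s - event_time n w)) * J n w"] by (simp add: abs_mult)
      also have "\<dots> \<le> \<bar>\<beta>\<bar> * E * \<bar>J n w\<bar>"
        using E[OF r] by (intro mult_mono mult_nonneg_nonneg) auto
      finally show "(if event_time n w \<le> s then \<beta> * exp (- \<alpha> * (s - event_time n w)) * J n w else 0) \<le> \<bar>\<beta>\<bar> * E * \<bar>J n w\<bar>"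
        using n by simp
    qed
    also have "(\<Sum>n<counting T s w. \<bar>\<beta>\<bar> * E * \<bar>J n w\<bar>) \<le> (\<Sum>n<k. \<bar>\<beta>\<bar> * E * \<bar>J n w\<bar>)"
      using fin(2) E[OF s] by (intro sum_mono2) auto
    also have "\<dots> = \<bar>\<beta>\<bar> * E * (\<Sum>n<k. \<bar>J n w\<bar>)" by (rule sum_distrib_left[symmetric])
    also have "lam\<^sub>0 + E * \<bar>l - lam\<^sub>0\<bar> + \<bar>\<beta>\<bar> * E * (\<Sum>n<k. \<bar>J n w\<bar>) \<le> C * (1 + (\<Sum>n<k. \<bar>J n w\<bar>))"
    proof -
      have "0 \<le> (\<Sum>n<k. \<bar>J n w\<bar>)" by (rule sum_nonneg) simp
      moreover have "0 \<le> lam\<^sub>0 + E * \<bar>l - lam\<^sub>0\<bar>" "0 \<le> \<bar>\<beta>\<bar> * E"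
        using base_pos E[OF s] by auto
      ultimately have "0 \<le> (lam\<^sub>0 + E * \<bar>l - lam\<^sub>0\<bar>) * (\<Sum>n<k. \<bar>J n w\<bar>) + \<bar>\<beta>\<bar> * E"
        using \<open>0 \<le> (\<Sum>n<k. \<bar>J n w\<bar>)\<close> by (intro add_nonneg_nonneg[OF mult_nonneg_nonneg])
      then show ?thesis unfolding C_def by (simp add: algebra_simps)
    qed
    finally show ?thesis by simp
  qed
  moreover have "0 \<le> C"
    using base_pos E(2)[of 0] assms unfolding C_def by auto
  ultimately show ?thesis by blast
qed

text \<open>
  Before \<open>T k\<close> the intensity is bounded by a multiple of the first \<open>k\<close> jump sizes, so the localized
  moment is finite for free, and Gronwall's inequality applies with constants not depending on \<open>k\<close>.
\<close>

definition localized_moment :: "nat \<Rightarrow> real \<Rightarrow> ennreal" where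
  "localized_moment k s = (\<integral>\<^sup>+w. (if ennreal s < T k w then ennreal ((L s w)\<^sup>2) else 0) \<partial>M)"

abbreviation stopped_square :: "nat \<Rightarrow> real \<Rightarrow> 'a \<Rightarrow> ennreal" where
  "stopped_square k r w \<equiv> if ennreal r < T k w then ennreal ((L r w)\<^sup>2) else 0"

lemma localized_moment_finite:
  assumes "0 \<le> t"
  shows "\<exists>K<\<infinity>. \<forall>s\<in>{0..t}. localized_moment k s \<le> K"
proof -
  obtain C where C: "0 \<le> C" "\<forall>w s k. regular_path w \<longrightarrow> s \<in> {0..t} \<longrightarrow> ennreal s < T k w \<longrightarrow>
    L s w \<le> C * (1 + (\<Sum>n<k. \<bar>J n w\<bar>))"
    using intensity_bound_by_jumps[OF assms] by blast
  show ?thesis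
  proof (intro exI conjI ballI)
    have "integrable M (\<lambda>w. C\<^sup>2 * (1 + (\<Sum>n<k. \<bar>J n w\<bar>))\<^sup>2)"
      by (intro integrable_mult_right integrable_sum_jumps_square)
    then show "(\<integral>\<^sup>+w. ennreal (C\<^sup>2 * (1 + (\<Sum>n<k. \<bar>J n w\<bar>))\<^sup>2) \<partial>M) < \<infinity>"
      by (simp add: nn_integral_eq_integral)
    fix s assume s: "s \<in> {0..t}"
    show "localized_moment k s \<le> (\<integral>\<^sup>+w. ennreal (C\<^sup>2 * (1 + (\<Sum>n<k. \<bar>J n w\<bar>))\<^sup>2) \<partial>M)"
      unfolding localized_moment_def
    proof (rule nn_integral_mono_AE, rule AE_mp[OF AE_regular_path], intro AE_I2 impI)
      fix w assume w: "w \<in> space M" "regular_path w"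
      show "(if ennreal s < T k w then ennreal ((L s w)\<^sup>2) else 0) \<le> ennreal (C\<^sup>2 * (1 + (\<Sum>n<k. \<bar>J n w\<bar>))\<^sup>2)"
      proof (cases "ennreal s < T k w")
        case True
        then have "L s w \<le> C * (1 + (\<Sum>n<k. \<bar>J n w\<bar>))" using C(2) w s by blast
        then have "(L s w)\<^sup>2 \<le> (C * (1 + (\<Sum>n<k. \<bar>J n w\<bar>)))\<^sup>2"
          using nonneg w s by (intro power_mono) auto
        then show ?thesis using True by (simp add: power_mult_distrib ennreal_leI)
      qed simp
    qed
  qed
qed

lemma set_integrable_L_square:
  assumes "w \<in> space M"
  shows "set_integrable lborel {0..t} (\<lambda>s. (L s w)\<^sup>2)"
proof -
  obtain C where C: "\<forall>s\<in>{0..t}. \<bar>L s w\<bar> \<le> C"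
    using bounded_imp_abs_le[OF L_bounded[OF assms]] by blast
  have "set_integrable lborel {0..t} (\<lambda>s. (if 0 \<le> s then L s w else 0)\<^sup>2)"
  proof (rule set_integrable_bounded_Icc)
    show "(\<lambda>s. (if 0 \<le> s then L s w else 0)\<^sup>2) \<in> borel_measurable borel"
      by (intro borel_measurable_power L_section_measurable assms)
    show "bounded ((\<lambda>s. (if 0 \<le> s then L s w else 0)\<^sup>2) ` {0..t})"
    proof (rule boundedI, elim imageE)
      fix x s assume "x = (if 0 \<le> s then L s w else 0)\<^sup>2" "s \<in> {0..t}"
      moreover have "\<bar>L s w\<bar>\<^sup>2 \<le> C\<^sup>2" if "s \<in> {0..t}"
        using bspec[OF C that] by (intro power_mono) auto
      ultimately show "norm x \<le> C\<^sup>2" by simp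
    qed
  qed
  then show ?thesis
    by (rule set_integrable_cong[THEN iffD1, rotated -1]) auto
qed

text \<open>All terms on the right are non-negative, so expectations can be taken before any
  integrability is known. Events before \<open>T (Suc j)\<close> have index at most \<open>j\<close>
  and thus occur no later than \<open>T j\<close>; the condition r \<le> T j is predictable, whereas
  r < T (Suc j) in general is not. This explains the shift between the two localizations.\<close>

lemma path_square_bound:
  assumes "regular_path w" "ennreal s < T (Suc j) w" "0 \<le> s"
  defines "c \<equiv> 2 * \<bar>\<alpha>\<bar> * (lam\<^sub>0 + 1)"
  shows "ennreal ((L s w)\<^sup>2) \<le> ennreal (l\<^sup>2) +
    ennreal c * (\<integral>\<^sup>+r\<in>{0..s}. 1 + stopped_square (Suc j) r w \<partial>lborel) +
    (\<Sum>n. if T n w < \<infinity> then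
       (if event_time n w \<le> s \<and> ennreal (event_time n w) \<le> T j w
        then ennreal (2 * left_intensity (event_time n w) w + 1) else 0) *
       ennreal (\<bar>\<beta> * J n w\<bar> + (\<beta> * J n w)\<^sup>2) else 0)"
proof -
  have w: "w \<in> space M" using assms(1) by (simp add: regular_path_def)
  note fin = finite_events_before[OF w assms(2)]
  let ?g = "\<lambda>n. (2 * left_intensity (event_time n w) w + 1) * (\<bar>\<beta> * J n w\<bar> + (\<beta> * J n w)\<^sup>2)"
  let ?h = "\<lambda>n. if T n w < \<infinity> then
       (if event_time n w \<le> s \<and> ennreal (event_time n w) \<le> T j w
        then ennreal (2 * left_intensity (event_time n w) w + 1) else 0) *
       ennreal (\<bar>\<beta> * J n w\<bar> + (\<beta> * J n w)\<^sup>2) else 0"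
  have c: "0 \<le> c" using base_pos by (simp add: c_def)
  have left: "0 \<le> left_intensity (event_time n w) w" for n
    by (rule left_intensity_nonneg[OF w]) simp
  have "set_integrable lborel {0..s} (\<lambda>r. 1 :: real)"
    by (rule set_integrable_bounded_Icc) (auto simp: bounded_iff)
  then have int: "set_integrable lborel {0..s} (\<lambda>r. c * (1 + (L r w)\<^sup>2))"
    by (intro set_integrable_mult_right set_integral_add(1) set_integrable_L_square w)
  have hi: "((\<lambda>r. c * (1 + (L r w)\<^sup>2)) has_integral (LBINT r:{0..s}. c * (1 + (L r w)\<^sup>2))) {0..s}"
    unfolding set_borel_integral_eq_integral(2)[OF int]
    by (rule integrable_integral[OF set_borel_integral_eq_integral(1)[OF int]])
  \<comment> \<open>The constant \<open>c\<close> arises from bounding \<alpha>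
    (\<open>lam\<^sub>0\<close> - L) by \<bar>\<alpha>\<bar> (\<open>lam\<^sub>0\<close> + L) and
    from L \<le> 1 + L^2.\<close>
  have drift: "2 * L r w * (\<alpha> * (lam\<^sub>0 - L r w)) \<le> c * (1 + (L r w)\<^sup>2)" if "r \<in> {0..s}" for r
  proof -
    have L0: "0 \<le> L r w" using nonneg[OF _ w] that by auto
    have "\<alpha> * (lam\<^sub>0 - L r w) \<le> \<bar>\<alpha>\<bar> * \<bar>lam\<^sub>0 - L r w\<bar>" by (metis abs_ge_self abs_mult)
    also have "\<dots> \<le> \<bar>\<alpha>\<bar> * (lam\<^sub>0 + L r w)" using base_pos L0 by (intro mult_left_mono) auto
    finally have "2 * L r w * (\<alpha> * (lam\<^sub>0 - L r w)) \<le> 2 * L r w * (\<bar>\<alpha>\<bar> * (lam\<^sub>0 + L r w))"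
      using L0 by (intro mult_left_mono) auto
    also have "\<dots> = 2 * \<bar>\<alpha>\<bar> * (lam\<^sub>0 * L r w + (L r w)\<^sup>2)" by (simp add: power2_eq_square algebra_simps)
    also have "\<dots> \<le> 2 * \<bar>\<alpha>\<bar> * ((lam\<^sub>0 + 1) * (1 + (L r w)\<^sup>2))"
    proof (intro mult_left_mono)
      have "L r w \<le> 1 + (L r w)\<^sup>2"
        using zero_le_power2[of "L r w - 1"] L0 by (simp add: power2_diff)
      then have "lam\<^sub>0 * L r w \<le> lam\<^sub>0 * (1 + (L r w)\<^sup>2)" using base_pos by (intro mult_left_mono) auto
      then show "lam\<^sub>0 * L r w + (L r w)\<^sup>2 \<le> (lam\<^sub>0 + 1) * (1 + (L r w)\<^sup>2)"
        by (simp add: algebra_simps)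
    qed simp
    finally show ?thesis by (simp add: c_def mult.assoc)
  qed
  have "(L s w)\<^sup>2 - l\<^sup>2 - (\<Sum>n<counting T s w.
      2 * left_intensity (event_time n w) w * (\<beta> * J n w) + (\<beta> * J n w)\<^sup>2)
      \<le> (LBINT r:{0..s}. c * (1 + (L r w)\<^sup>2))"
    by (rule has_integral_le[OF path_square[OF assms(1) fin(1) assms(3)] hi drift])
  \<comment> \<open>With x \<ge> 0 the left limit and y the jump of \<open>L\<close>, 2 x y + y^2
    \<le> (2 x + 1) (\<bar>y\<bar> + y^2). The product separates the predictable factor from the
    jump size, the form that \<open>nn_compensation\<close> accepts.\<close>
  moreover have "(\<Sum>n<counting T s w. 2 * left_intensity (event_time n w) w * (\<beta> * J n w) + (\<beta> * J n w)\<^sup>2)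
      \<le> (\<Sum>n<counting T s w. ?g n)"
  proof (rule sum_mono)
    fix n
    have "2 * left_intensity (event_time n w) w * (\<beta> * J n w) \<le> 2 * left_intensity (event_time n w) w * \<bar>\<beta> * J n w\<bar>"
      using left[of n] by (intro mult_left_mono) auto
    moreover have "0 \<le> left_intensity (event_time n w) w * (\<beta> * J n w)\<^sup>2" using left[of n] by simp
    ultimately show "2 * left_intensity (event_time n w) w * (\<beta> * J n w) + (\<beta> * J n w)\<^sup>2 \<le> ?g n"
      using abs_ge_zero[of "\<beta> * J n w"] by (simp only: distrib_left distrib_right mult_1_left)
  qed
  ultimately have "(L s w)\<^sup>2 \<le> l\<^sup>2 + (LBINT r:{0..s}. c * (1 + (L r w)\<^sup>2)) + (\<Sum>n<counting T s w. ?g n)"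
    by simp
  then have "ennreal ((L s w)\<^sup>2) \<le> ennreal (l\<^sup>2 + (LBINT r:{0..s}. c * (1 + (L r w)\<^sup>2)) + (\<Sum>n<counting T s w. ?g n))"
    by (rule ennreal_leI)
  also have "\<dots> = ennreal (l\<^sup>2) + ennreal (LBINT r:{0..s}. c * (1 + (L r w)\<^sup>2)) + ennreal (\<Sum>n<counting T s w. ?g n)"
  proof -
    have "0 \<le> (LBINT r:{0..s}. c * (1 + (L r w)\<^sup>2))"
      unfolding set_lebesgue_integral_def using c by (intro Bochner_Integration.integral_nonneg) simp
    moreover have "0 \<le> (\<Sum>n<counting T s w. ?g n)" using left by (intro sum_nonneg) simp
    ultimately show ?thesis by simp
  qed
  also have "ennreal (LBINT r:{0..s}. c * (1 + (L r w)\<^sup>2)) = (\<integral>\<^sup>+r\<in>{0..s}. ennreal (c * (1 + (L r w)\<^sup>2)) \<partial>lborel)"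
  proof -
    have "(\<integral>\<^sup>+r. ennreal (indicator {0..s} r *\<^sub>R (c * (1 + (L r w)\<^sup>2))) \<partial>lborel) = ennreal (LBINT r:{0..s}. c * (1 + (L r w)\<^sup>2))"
      unfolding set_lebesgue_integral_def using int c
      by (intro nn_integral_eq_integral) (auto simp: set_integrable_def)
    moreover have "(\<integral>\<^sup>+r. ennreal (indicator {0..s} r *\<^sub>R (c * (1 + (L r w)\<^sup>2))) \<partial>lborel) =
        (\<integral>\<^sup>+r\<in>{0..s}. ennreal (c * (1 + (L r w)\<^sup>2)) \<partial>lborel)"
      by (intro nn_integral_cong) (simp add: indicator_def)
    ultimately show ?thesis by (simp only:)
  qed
  also have "\<dots> = (\<integral>\<^sup>+r. ennreal c * ((1 + stopped_square (Suc j) r w) * indicator {0..s} r) \<partial>lborel)"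
  proof (intro nn_integral_cong)
    fix r
    have "ennreal r < T (Suc j) w" if "r \<le> s" using order_le_less_trans[OF ennreal_leI[OF that] assms(2)] .
    then show "ennreal (c * (1 + (L r w)\<^sup>2)) * indicator {0..s} r =
      ennreal c * ((1 + stopped_square (Suc j) r w) * indicator {0..s} r)"
      using c by (simp add: ennreal_mult indicator_def ennreal_plus)
  qed
  also have "\<dots> = ennreal c * (\<integral>\<^sup>+r\<in>{0..s}. 1 + stopped_square (Suc j) r w \<partial>lborel)"
  proof (rule nn_integral_cmult)
    have "(\<lambda>r. (1 + (if ennreal r < T (Suc j) w then ennreal ((if 0 \<le> r then L r w else 0)\<^sup>2) else 0)) * indicator {0..s} r) \<in> borel_measurable lborel"
      using L_section_measurable[OF w] by measurable
    then show "(\<lambda>r. (1 + stopped_square (Suc j) r w) * indicator {0..s} r) \<in> borel_measurable lborel"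
      by (rule measurable_cong[THEN iffD1, rotated]) (simp add: indicator_def)
  qed
  also have "ennreal (\<Sum>n<counting T s w. ?g n) = (\<Sum>n<counting T s w. ennreal (?g n))"
    using left by (intro sum_ennreal[symmetric]) simp
  also have "(\<Sum>n<counting T s w. ennreal (?g n)) = (\<Sum>n<counting T s w. ?h n)"
  proof (intro sum.cong refl)
    fix n assume "n \<in> {..<counting T s w}"
    then have n: "n < counting T s w" by simp
    note e = event_time_le[OF assms(1) fin(1) assms(3) n]
    have "T n w \<le> T j w" using n fin(2) by (intro T_mono w) simp
    then show "ennreal (?g n) = ?h n"
      using e left[of n] by (simp add: ennreal_mult)
  qed
  also have "\<dots> \<le> (\<Sum>n. ?h n)" by (rule sum_le_suminf[OF summableI]) simp_all
  finally show ?thesis by (simp add: add_left_mono)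
qed

lemma localized_square_measurable:
  "(\<lambda>(r, w). if ennreal r < T k w then ennreal ((if 0 \<le> r then L r w else 0)\<^sup>2) else 0)
    \<in> borel_measurable (lborel \<Otimes>\<^sub>M M)"
proof -
  have "(\<lambda>x. if ennreal (fst x) < T k (snd x) then ennreal ((case x of (r, w) \<Rightarrow> if 0 \<le> r then L r w else 0)\<^sup>2) else 0)
    \<in> borel_measurable (borel \<Otimes>\<^sub>M M)"
    using L_joint_measurable by measurable
  moreover have "borel_measurable ((borel :: real measure) \<Otimes>\<^sub>M M) = borel_measurable (lborel \<Otimes>\<^sub>M M)"
    by (intro measurable_cong_sets sets_pair_measure_cong) auto
  ultimately show ?thesis by (simp add: case_prod_unfold)
qed

lemma localized_moment_eq:
  assumes "0 \<le> r"
  shows "localized_moment k r =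
    (\<integral>\<^sup>+w. (if ennreal r < T k w then ennreal ((if 0 \<le> r then L r w else 0)\<^sup>2) else 0) \<partial>M)"
  unfolding localized_moment_def using assms by (intro nn_integral_cong) simp

lemma nn_integral_localized_square:
  assumes "0 \<le> s"
  shows "(\<integral>\<^sup>+w. (\<integral>\<^sup>+r\<in>{0..s}. 1 + stopped_square k r w \<partial>lborel) \<partial>M) =
    (\<integral>\<^sup>+r\<in>{0..s}. 1 + localized_moment k r \<partial>lborel)"
proof -
  interpret P: pair_sigma_finite lborel M ..
  let ?q = "\<lambda>r w. if ennreal r < T k w then ennreal ((if 0 \<le> r then L r w else 0)\<^sup>2) else 0"
  have q[measurable]: "(\<lambda>(r, w). ?q r w) \<in> borel_measurable (lborel \<Otimes>\<^sub>M M)"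
    by (rule localized_square_measurable)
  have m: "(\<lambda>(r, w). (1 + ?q r w) * indicator {0..s} r) \<in> borel_measurable (lborel \<Otimes>\<^sub>M M)"
  proof -
    have "(\<lambda>x. (1 + (case x of (r, w) \<Rightarrow> ?q r w)) * indicator {0..s} (fst x)) \<in> borel_measurable (lborel \<Otimes>\<^sub>M M)"
      by (intro borel_measurable_times_ennreal borel_measurable_add q borel_measurable_const
        measurable_compose[OF measurable_fst borel_measurable_indicator]) simp
    then show ?thesis by (simp only: case_prod_unfold)
  qed
  have "(\<integral>\<^sup>+w. (\<integral>\<^sup>+r\<in>{0..s}. 1 + stopped_square k r w \<partial>lborel) \<partial>M) =
    (\<integral>\<^sup>+w. \<integral>\<^sup>+r. (1 + ?q r w) * indicator {0..s} r \<partial>lborel \<partial>M)"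
    by (intro nn_integral_cong) (simp add: indicator_def)
  also have "\<dots> = (\<integral>\<^sup>+r. \<integral>\<^sup>+w. (1 + ?q r w) * indicator {0..s} r \<partial>M \<partial>lborel)"
    using P.Fubini'[OF m] by simp
  also have "\<dots> = (\<integral>\<^sup>+r\<in>{0..s}. 1 + localized_moment k r \<partial>lborel)"
  proof (rule nn_integral_cong)
    fix r :: real
    show "(\<integral>\<^sup>+w. (1 + ?q r w) * indicator {0..s} r \<partial>M) = (1 + localized_moment k r) * indicator {0..s} r"
    proof (cases "r \<in> {0..s}")
      case True
      then have r: "0 \<le> r" by simp
      have "?q r \<in> borel_measurable M"
        using measurable_compose[OF measurable_Pair1'[of r lborel] q] by simp
      then have "(\<integral>\<^sup>+w. 1 + ?q r w \<partial>M) = 1 + localized_moment k r"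
        unfolding localized_moment_eq[OF r] by (subst nn_integral_add) (simp_all add: emeasure_space_1)
      then show ?thesis using True by simp
    qed simp
  qed
  finally show ?thesis .
qed

text \<open>Distinct event times turn the predictable cutoff r \<le> T j back into r < T (Suc j),
  under which the localized moment controls \<open>L\<close>. The exceptional times for the left
  limit are countably many.\<close>

lemma AE_stopped_left_intensity:
  assumes "regular_path w"
  shows "AE r in lborel. 0 \<le> r \<longrightarrow> ennreal r \<le> T j w \<longrightarrow>
    ennreal r < T (Suc j) w \<and> left_intensity r w = L r w"
proof -
  have w: "w \<in> space M" using assms by (simp add: regular_path_def)
  have "countable (range (\<lambda>n. event_time n w))" by simp
  then have "AE r in lborel. r \<notin> range (\<lambda>n. event_time n w)"
    by (intro AE_not_in countable_imp_null_set_lborel)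
  then show ?thesis
  proof eventually_elim
    case (elim r)
    show ?case
    proof (intro impI conjI)
      assume r: "0 \<le> r" "ennreal r \<le> T j w"
      show lt: "ennreal r < T (Suc j) w"
      proof (cases "T j w < \<infinity>")
        case True
        show ?thesis by (rule order_le_less_trans[OF r(2) T_strict_mono[OF assms lessI True]])
      next
        case False
        then have "T (Suc j) w = \<infinity>" using T_mono[OF w, of j "Suc j"] by (simp add: top.not_eq_extremum[symmetric] top.extremum_unique)
        then show ?thesis by simp
      qed
      show "left_intensity r w = L r w"
        by (rule left_intensity_off_events[OF assms finite_events_before(1)[OF w lt] r(1)]) (use elim in blast)
    qed
  qed
qed

text \<open>For x \<ge> 0 one has (2 x + 1) x \<le> 3 (1 + x^2). The same bound serves in the
  Gronwall inequality and in counting the events.\<close>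

lemma stopped_compensator_bound:
  assumes "regular_path w"
  shows "(\<integral>\<^sup>+r\<in>{0..}. (if r \<le> s \<and> ennreal r \<le> T j w then ennreal (2 * left_intensity r w + 1) else 0) *
      ennreal (L r w) \<partial>lborel) \<le>
    3 * (\<integral>\<^sup>+r\<in>{0..s}. 1 + stopped_square (Suc j) r w \<partial>lborel)"
proof -
  have w: "w \<in> space M" using assms by (simp add: regular_path_def)
  have "(\<integral>\<^sup>+r\<in>{0..}. (if r \<le> s \<and> ennreal r \<le> T j w then ennreal (2 * left_intensity r w + 1) else 0) *
      ennreal (L r w) \<partial>lborel) \<le>
    (\<integral>\<^sup>+r. 3 * ((1 + stopped_square (Suc j) r w) * indicator {0..s} r) \<partial>lborel)"
  proof (rule nn_integral_mono_AE, rule AE_mp[OF AE_stopped_left_intensity[OF assms, of j]], intro AE_I2 impI)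
    fix r assume r: "0 \<le> r \<longrightarrow> ennreal r \<le> T j w \<longrightarrow> ennreal r < T (Suc j) w \<and> left_intensity r w = L r w"
    show "(if r \<le> s \<and> ennreal r \<le> T j w then ennreal (2 * left_intensity r w + 1) else 0) * ennreal (L r w) * indicator {0..} r
      \<le> 3 * ((1 + stopped_square (Suc j) r w) * indicator {0..s} r)"
    proof (cases "0 \<le> r \<and> r \<le> s \<and> ennreal r \<le> T j w")
      case True
      then have L0: "0 \<le> L r w" using nonneg[OF _ w] by simp
      have "(2 * L r w + 1) * L r w \<le> 3 * (1 + (L r w)\<^sup>2)"
        using zero_le_power2[of "L r w - 1"] L0 by (simp add: power2_eq_square algebra_simps)
      then have "ennreal ((2 * L r w + 1) * L r w) \<le> ennreal (3 * (1 + (L r w)\<^sup>2))" by (rule ennreal_leI)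
      also have "ennreal (3 * (1 + (L r w)\<^sup>2)) = 3 * (1 + ennreal ((L r w)\<^sup>2))"
        by (simp add: ennreal_mult)
      also have "ennreal ((2 * L r w + 1) * L r w) = ennreal (2 * L r w + 1) * ennreal (L r w)"
        using L0 by (intro ennreal_mult) auto
      finally show ?thesis using True r by simp
    qed (auto simp: indicator_def)
  qed
  also have "\<dots> = 3 * (\<integral>\<^sup>+r\<in>{0..s}. 1 + stopped_square (Suc j) r w \<partial>lborel)"
  proof (rule nn_integral_cmult)
    have "(\<lambda>r. (1 + (if ennreal r < T (Suc j) w then ennreal ((if 0 \<le> r then L r w else 0)\<^sup>2) else 0)) * indicator {0..s} r) \<in> borel_measurable lborel"
      using L_section_measurable[OF w] by measurable
    then show "(\<lambda>r. (1 + stopped_square (Suc j) r w) * indicator {0..s} r) \<in> borel_measurable lborel"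
      by (rule measurable_cong[THEN iffD1, rotated]) (simp add: indicator_def)
  qed
  finally show ?thesis .
qed

lemma stopped_predictable:
  "Measurable.pred predictable (\<lambda>x. fst x \<le> s \<and> ennreal (fst x) \<le> T j (snd x))"
proof -
  have [measurable]: "Measurable.pred predictable (\<lambda>x. ennreal (fst x) \<le> T j (snd x))"
    using before_time_predictable[of j] by (simp only: case_prod_unfold)
  show ?thesis by measurable
qed

lemma localized_integral_measurable:
  "(\<lambda>w. \<integral>\<^sup>+r\<in>{0..s}. 1 + stopped_square k r w \<partial>lborel) \<in> borel_measurable M"
proof -
  have "(\<lambda>x. (1 + (case x of (r, w) \<Rightarrow> if ennreal r < T (k) w then ennreal ((if 0 \<le> r then L r w else 0)\<^sup>2) else 0)) * indicator {0..s} (fst x))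
    \<in> borel_measurable (lborel \<Otimes>\<^sub>M M)"
    by (intro borel_measurable_times_ennreal borel_measurable_add localized_square_measurable borel_measurable_const
      measurable_compose[OF measurable_fst borel_measurable_indicator]) simp
  from measurable_compose[OF measurable_pair_swap' this]
  have "(\<lambda>w. \<integral>\<^sup>+r. (1 + (if ennreal r < T (k) w then ennreal ((if 0 \<le> r then L r w else 0)\<^sup>2) else 0)) * indicator {0..s} r \<partial>lborel) \<in> borel_measurable M"
    by (intro lborel.borel_measurable_nn_integral) (simp only: case_prod_unfold fst_conv snd_conv)
  then show ?thesis
    by (rule measurable_cong[THEN iffD1, rotated]) (intro nn_integral_cong, simp add: indicator_def)
qed

text \<open>The expectation of \<open>path_square_bound\<close>. Compensation splits off the mean of
  \<bar>\<beta> X\<bar> + (\<beta> X)^2 from the sum over events, and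
  \<open>stopped_compensator_bound\<close> brings what is left back to the localized moment, which
  closes the inequality.\<close>

lemma localized_moment_ineq:
  assumes "0 \<le> s"
  shows "localized_moment (Suc j) s \<le> ennreal (l\<^sup>2) +
    (ennreal (2 * \<bar>\<alpha>\<bar> * (lam\<^sub>0 + 1)) + 3 * (\<integral>\<^sup>+w. ennreal (\<bar>\<beta> * X w\<bar> + (\<beta> * X w)\<^sup>2) \<partial>M)) *
    (\<integral>\<^sup>+r\<in>{0..s}. 1 + localized_moment (Suc j) r \<partial>lborel)"
proof -
  let ?c = "ennreal (2 * \<bar>\<alpha>\<bar> * (lam\<^sub>0 + 1))"
  let ?G = "\<integral>\<^sup>+w. ennreal (\<bar>\<beta> * X w\<bar> + (\<beta> * X w)\<^sup>2) \<partial>M"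
  let ?I = "\<lambda>w. \<integral>\<^sup>+r\<in>{0..s}. 1 + stopped_square (Suc j) r w \<partial>lborel"
  define f where "f = (\<lambda>(r, w). if r \<le> s \<and> ennreal r \<le> T j w then ennreal (2 * left_intensity r w + 1) else 0)"
  define g where "g x = ennreal (\<bar>\<beta> * x\<bar> + (\<beta> * x)\<^sup>2)" for x
  let ?S = "\<lambda>w. \<Sum>n. if T n w < \<infinity> then f (event_time n w, w) * g (J n w) else 0"
  have f: "f \<in> borel_measurable predictable"
  proof -
    have [measurable]: "(\<lambda>x. left_intensity (fst x) (snd x)) \<in> borel_measurable predictable"
      using left_intensity_predictable by (simp only: case_prod_unfold)
    note [measurable] = stopped_predictable
    have "(\<lambda>x. if fst x \<le> s \<and> ennreal (fst x) \<le> T j (snd x)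
       then ennreal (2 * left_intensity (fst x) (snd x) + 1) else 0) \<in> borel_measurable predictable"
      by measurable
    then show ?thesis unfolding f_def by (simp only: case_prod_unfold)
  qed
  have g: "g \<in> borel_measurable borel" unfolding g_def by measurable
  have Im: "?I \<in> borel_measurable M" by (rule localized_integral_measurable)
  have Sm: "?S \<in> borel_measurable M"
  proof -
    have "(\<lambda>w. (if T n w < \<infinity> then f (event_time n w, w) else 0) * g (J n w)) \<in> borel_measurable M" for n
      by (intro borel_measurable_times_ennreal measurable_historyD[OF predictable_at_event_time[OF f]]
          measurable_compose[OF J_measurable g]) simp
    then have "(\<lambda>w. \<Sum>n. (if T n w < \<infinity> then f (event_time n w, w) else 0) * g (J n w)) \<in> borel_measurable M"
      by (rule borel_measurable_suminf_order)
    then show ?thesis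
      by (rule measurable_cong[THEN iffD1, rotated]) (intro suminf_cong, simp)
  qed
  have "(\<integral>\<^sup>+w. ?S w \<partial>M) = ?G * (\<integral>\<^sup>+w. (\<integral>\<^sup>+r\<in>{0..}. f (r, w) * ennreal (L r w) \<partial>lborel) \<partial>M)"
    by (subst nn_compensation[OF f g]) (simp only: g_def)
  also have "\<dots> \<le> ?G * (\<integral>\<^sup>+w. 3 * ?I w \<partial>M)"
  proof (intro mult_left_mono nn_integral_mono_AE)
    show "AE w in M. (\<integral>\<^sup>+r\<in>{0..}. f (r, w) * ennreal (L r w) \<partial>lborel) \<le> 3 * ?I w"
      using AE_regular_path
      by (rule AE_mp) (intro AE_I2 impI, simp only: f_def prod.case, rule stopped_compensator_bound)
  qed simp
  also have "(\<integral>\<^sup>+w. 3 * ?I w \<partial>M) = 3 * (\<integral>\<^sup>+w. ?I w \<partial>M)"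
    by (rule nn_integral_cmult[OF Im])
  finally have S: "(\<integral>\<^sup>+w. ?S w \<partial>M) \<le> ?G * (3 * (\<integral>\<^sup>+w. ?I w \<partial>M))" .
  have "localized_moment (Suc j) s \<le> (\<integral>\<^sup>+w. ennreal (l\<^sup>2) + ?c * ?I w + ?S w \<partial>M)"
    unfolding localized_moment_def
  proof (rule nn_integral_mono_AE, rule AE_mp[OF AE_regular_path], intro AE_I2 impI)
    fix w assume w: "regular_path w"
    show "(if ennreal s < T (Suc j) w then ennreal ((L s w)\<^sup>2) else 0) \<le> ennreal (l\<^sup>2) + ?c * ?I w + ?S w"
      unfolding f_def g_def prod.case
      by (cases "ennreal s < T (Suc j) w")
        (simp_all only: if_True if_False zero_le path_square_bound[OF w _ assms])
  qed
  also have "\<dots> = ennreal (l\<^sup>2) + ?c * (\<integral>\<^sup>+w. ?I w \<partial>M) + (\<integral>\<^sup>+w. ?S w \<partial>M)"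
    using Im Sm by (simp add: nn_integral_add nn_integral_cmult emeasure_space_1)
  also have "\<dots> \<le> ennreal (l\<^sup>2) + ?c * (\<integral>\<^sup>+w. ?I w \<partial>M) + ?G * (3 * (\<integral>\<^sup>+w. ?I w \<partial>M))"
    by (rule add_left_mono[OF S])
  also have "\<dots> = ennreal (l\<^sup>2) + (?c + 3 * ?G) * (\<integral>\<^sup>+w. ?I w \<partial>M)"
    by (simp only: distrib_right mult.assoc mult.left_commute[of ?G] add.assoc)
  finally show ?thesis
    unfolding nn_integral_localized_square[OF assms] .
qed

lemma X_integrable: "integrable M X"
proof (rule Bochner_Integration.integrable_bound)
  show "integrable M (\<lambda>w. 1 + (X w)\<^sup>2)" using X_square_integrable by simp
  show "AE w in M. norm (X w) \<le> norm (1 + (X w)\<^sup>2)"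
  proof (rule AE_I2)
    fix w
    show "norm (X w) \<le> norm (1 + (X w)\<^sup>2)"
      using zero_le_power2[of "\<bar>X w\<bar> - 1"] by (simp add: power2_diff)
  qed
qed (rule X_measurable)

lemma localized_moment_bound:
  assumes "0 \<le> t"
  shows "\<exists>C\<ge>0. \<forall>s\<in>{0..t}. \<forall>j. localized_moment (Suc j) s \<le> ennreal C"
proof -
  let ?G = "\<integral>\<^sup>+w. ennreal (\<bar>\<beta> * X w\<bar> + (\<beta> * X w)\<^sup>2) \<partial>M"
  have "integrable M (\<lambda>w. \<bar>\<beta> * X w\<bar> + (\<beta> * X w)\<^sup>2)"
    using X_integrable X_square_integrable by (simp add: power_mult_distrib)
  then have "?G = ennreal (\<integral>w. \<bar>\<beta> * X w\<bar> + (\<beta> * X w)\<^sup>2 \<partial>M)"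
    by (intro nn_integral_eq_integral) auto
  then obtain G where G: "?G = ennreal G" "0 \<le> G"
    by (metis (no_types, lifting) Bochner_Integration.integral_nonneg abs_ge_zero add_nonneg_nonneg zero_le_power2)
  \<comment> \<open>The summand 1 keeps \<open>c\<close> positive even for \<alpha> = \<beta> = 0.
    The term \<open>c * t\<close> in \<open>B\<close> below absorbs the constant 1 under the
    integral of \<open>localized_moment_ineq\<close>.\<close>
  define c where "c = 2 * \<bar>\<alpha>\<bar> * (lam\<^sub>0 + 1) + 3 * G + 1"
  have c: "0 < c" using G(2) base_pos unfolding c_def by (auto intro!: add_nonneg_pos)
  define B where "B = l\<^sup>2 + c * t"
  have B: "0 \<le> B" using assms c by (simp add: B_def)
  have ineq: "localized_moment (Suc j) s \<le> ennreal B + ennreal c * (\<integral>\<^sup>+r\<in>{0..s}. localized_moment (Suc j) r \<partial>lborel)"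
    if s: "s \<in> {0..t}" for s j
  proof -
    have m: "(\<lambda>r. localized_moment (Suc j) r * indicator {0..s} r) \<in> borel_measurable lborel"
    proof -
      have "(\<lambda>r. \<integral>\<^sup>+w. (if ennreal r < T (Suc j) w then ennreal ((if 0 \<le> r then L r w else 0)\<^sup>2) else 0) \<partial>M) \<in> borel_measurable lborel"
        by (rule borel_measurable_nn_integral[OF localized_square_measurable])
      then have "(\<lambda>r. (\<integral>\<^sup>+w. (if ennreal r < T (Suc j) w then ennreal ((if 0 \<le> r then L r w else 0)\<^sup>2) else 0) \<partial>M) * indicator {0..s} r) \<in> borel_measurable lborel"
        by (intro borel_measurable_times_ennreal borel_measurable_indicator) simp_all
      then show ?thesis
      proof (rule measurable_cong[THEN iffD1, rotated])
        fix r :: real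
        show "(\<integral>\<^sup>+w. (if ennreal r < T (Suc j) w then ennreal ((if 0 \<le> r then L r w else 0)\<^sup>2) else 0) \<partial>M) * indicator {0..s} r
            = localized_moment (Suc j) r * indicator {0..s} r"
        proof (cases "r \<in> {0..s}")
          case True
          then have "0 \<le> r" by simp
          then show ?thesis by (simp only: localized_moment_eq)
        qed simp
      qed
    qed
    have "(\<integral>\<^sup>+r\<in>{0..s}. 1 + localized_moment (Suc j) r \<partial>lborel) =
        (\<integral>\<^sup>+r. indicator {0..s} r + localized_moment (Suc j) r * indicator {0..s} r \<partial>lborel)"
      by (intro nn_integral_cong) (simp add: indicator_def)
    also have "\<dots> = ennreal s + (\<integral>\<^sup>+r\<in>{0..s}. localized_moment (Suc j) r \<partial>lborel)"
      using s by (subst nn_integral_add[OF _ m]) (simp_all add: emeasure_lborel_Icc)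
    finally have I: "(\<integral>\<^sup>+r\<in>{0..s}. 1 + localized_moment (Suc j) r \<partial>lborel) =
        ennreal s + (\<integral>\<^sup>+r\<in>{0..s}. localized_moment (Suc j) r \<partial>lborel)" .
    have c': "ennreal (2 * \<bar>\<alpha>\<bar> * (lam\<^sub>0 + 1)) + 3 * ?G \<le> ennreal c"
    proof -
      have "ennreal (2 * \<bar>\<alpha>\<bar> * (lam\<^sub>0 + 1)) + 3 * ?G = ennreal (2 * \<bar>\<alpha>\<bar> * (lam\<^sub>0 + 1)) + ennreal (3 * G)"
        unfolding G(1) using G(2) by (simp add: ennreal_mult)
      also have "\<dots> = ennreal (2 * \<bar>\<alpha>\<bar> * (lam\<^sub>0 + 1) + 3 * G)"
        using G(2) base_pos by (intro ennreal_plus[symmetric]) auto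
      also have "\<dots> \<le> ennreal c" by (intro ennreal_leI) (simp add: c_def)
      finally show ?thesis .
    qed
    have "localized_moment (Suc j) s \<le> ennreal (l\<^sup>2) + ennreal c * (ennreal s + (\<integral>\<^sup>+r\<in>{0..s}. localized_moment (Suc j) r \<partial>lborel))"
      using localized_moment_ineq[of s j] s c' unfolding I
      by (auto elim!: order_trans intro!: add_left_mono mult_right_mono)
    also have "\<dots> = ennreal (l\<^sup>2 + c * s) + ennreal c * (\<integral>\<^sup>+r\<in>{0..s}. localized_moment (Suc j) r \<partial>lborel)"
      using c s by (simp add: distrib_left ennreal_mult ennreal_plus add.assoc)
    also have "\<dots> \<le> ennreal B + ennreal c * (\<integral>\<^sup>+r\<in>{0..s}. localized_moment (Suc j) r \<partial>lborel)"
      using s c unfolding B_def by (intro add_right_mono ennreal_leI add_left_mono mult_left_mono) auto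
    finally show ?thesis .
  qed
  have "localized_moment (Suc j) s \<le> ennreal (2 * B * exp (2 * c * t))" if s: "s \<in> {0..t}" for s j
  proof -
    obtain K where K: "K < \<infinity>" "\<forall>s\<in>{0..t}. localized_moment (Suc j) s \<le> K"
      using localized_moment_finite[OF assms] by blast
    have "localized_moment (Suc j) s \<le> ennreal (2 * B * exp (2 * c * s))"
      using s K(2) ineq by (intro gronwall_nn_integral[OF c B K(1)]) auto
    also have "\<dots> \<le> ennreal (2 * B * exp (2 * c * t))"
      using s B c by (intro ennreal_leI mult_left_mono) auto
    finally show ?thesis .
  qed
  then show ?thesis using B by (intro exI[of _ "2 * B * exp (2 * c * t)"]) auto
qed

section \<open>Absence of explosion and the second moment of the intensity\<close>

text \<open>Those of the first \<open>Suc j\<close> events that occur up to \<open>t\<close> are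
  counted by the predictable indicator of the interval up to the minimum of \<open>t\<close> and
  \<open>T j\<close>. The mean of its compensator is bounded through the localized moment, uniformly
  in \<open>j\<close>.\<close>

lemma expected_events_finite:
  assumes "0 \<le> t"
  shows "(\<Sum>n. emeasure M {w \<in> space M. T n w \<le> ennreal t}) < \<infinity>"
proof -
  obtain C where C: "0 \<le> C" "\<forall>s\<in>{0..t}. \<forall>j. localized_moment (Suc j) s \<le> ennreal C"
    using localized_moment_bound[OF assms] by blast
  let ?A = "\<lambda>n. {w \<in> space M. T n w \<le> ennreal t}"
  have A [measurable]: "?A n \<in> sets M" for n by measurable
  have "(\<Sum>n<Suc j. emeasure M (?A n)) \<le> 3 * (ennreal (1 + C) * ennreal t)" for j
  proof -
    define f where "f = (\<lambda>(r, w). if r \<le> t \<and> ennreal r \<le> T j w then 1 else (0 :: ennreal))"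
    have f: "f \<in> borel_measurable predictable"
    proof -
      note [measurable] = stopped_predictable
      have "(\<lambda>x. if fst x \<le> t \<and> ennreal (fst x) \<le> T j (snd x) then 1 else (0 :: ennreal)) \<in> borel_measurable predictable"
        by measurable
      then show ?thesis unfolding f_def by (simp only: case_prod_unfold)
    qed
    have "(\<Sum>n<Suc j. emeasure M (?A n)) = (\<Sum>n<Suc j. \<integral>\<^sup>+w. indicator (?A n) w \<partial>M)"
      by (simp only: nn_integral_indicator[OF A])
    also have "\<dots> = (\<integral>\<^sup>+w. (\<Sum>n<Suc j. indicator (?A n) w) \<partial>M)"
      by (rule nn_integral_sum[symmetric]) measurable
    also have "\<dots> \<le> (\<integral>\<^sup>+w. counting_integral T f w \<partial>M)"
    proof (rule nn_integral_mono)
      fix w assume w: "w \<in> space M"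
      let ?h = "\<lambda>n. if T n w < \<infinity> then f (event_time n w, w) else 0"
      have "(\<Sum>n<Suc j. indicator (?A n) w) \<le> (\<Sum>n<Suc j. ?h n)"
      proof (rule sum_mono)
        fix n assume n: "n \<in> {..<Suc j}"
        show "indicator (?A n) w \<le> ?h n"
        proof (cases "T n w \<le> ennreal t")
          case True
          then have fin: "T n w < \<infinity>" by (rule order_le_less_trans) simp
          moreover have "event_time n w \<le> t" using True assms by (rule enn2real_leI[rotated])
          moreover have "ennreal (event_time n w) \<le> T j w"
            using T_mono[OF w, of n j] n fin by simp
          ultimately have "?h n = 1" by (simp add: f_def)
          then show ?thesis by (simp add: indicator_def)
        qed (simp add: indicator_def)
      qed
      also have "\<dots> \<le> (\<Sum>n. ?h n)" by (rule sum_le_suminf[OF summableI]) simp_all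
      finally show "(\<Sum>n<Suc j. indicator (?A n) w) \<le> counting_integral T f w"
        unfolding counting_integral_def .
    qed
    also have "\<dots> = (\<integral>\<^sup>+w. (\<integral>\<^sup>+s\<in>{0..}. f (s, w) * ennreal (L s w) \<partial>lborel) \<partial>M)"
      by (rule intensity[OF f])
    also have "\<dots> \<le> (\<integral>\<^sup>+w. 3 * (\<integral>\<^sup>+r\<in>{0..t}. 1 + stopped_square (Suc j) r w \<partial>lborel) \<partial>M)"
    proof (rule nn_integral_mono_AE, rule AE_mp[OF AE_regular_path], intro AE_I2 impI)
      fix w assume w: "w \<in> space M" "regular_path w"
      \<comment> \<open>Enlarging the indicator by the factor 2 \<open>left_intensity\<close> + 1
        \<ge> 1 makes \<open>stopped_compensator_bound\<close> applicable.\<close>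
      have "(\<integral>\<^sup>+s\<in>{0..}. f (s, w) * ennreal (L s w) \<partial>lborel) \<le>
        (\<integral>\<^sup>+r\<in>{0..}. (if r \<le> t \<and> ennreal r \<le> T j w then ennreal (2 * left_intensity r w + 1) else 0) *
          ennreal (L r w) \<partial>lborel)"
      proof (rule nn_integral_mono)
        fix r
        have "f (r, w) \<le> (if r \<le> t \<and> ennreal r \<le> T j w then ennreal (2 * left_intensity r w + 1) else 0)" if "0 \<le> r"
          using left_intensity_nonneg[OF w(1) that] by (simp add: f_def)
        then show "f (r, w) * ennreal (L r w) * indicator {0..} r \<le>
          (if r \<le> t \<and> ennreal r \<le> T j w then ennreal (2 * left_intensity r w + 1) else 0) * ennreal (L r w) * indicator {0..} r"
          by (cases "0 \<le> r") (simp_all only: mult_right_mono zero_le indicator_simps atLeast_iff mult_zero_right order_refl not_False_eq_True)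
      qed
      also note stopped_compensator_bound[OF w(2)]
      finally show "(\<integral>\<^sup>+s\<in>{0..}. f (s, w) * ennreal (L s w) \<partial>lborel) \<le>
        3 * (\<integral>\<^sup>+r\<in>{0..t}. 1 + stopped_square (Suc j) r w \<partial>lborel)" .
    qed
    also have "\<dots> = 3 * (\<integral>\<^sup>+r\<in>{0..t}. 1 + localized_moment (Suc j) r \<partial>lborel)"
      unfolding nn_integral_localized_square[OF assms, symmetric]
      by (rule nn_integral_cmult[OF localized_integral_measurable])
    also have "\<dots> \<le> 3 * (\<integral>\<^sup>+r\<in>{0..t}. ennreal (1 + C) \<partial>lborel)"
    proof (intro mult_left_mono nn_integral_mono)
      fix r
      have "1 + localized_moment (Suc j) r \<le> ennreal (1 + C)" if "r \<in> {0..t}"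
        using C that by (auto simp: ennreal_plus intro!: add_left_mono)
      then show "(1 + localized_moment (Suc j) r) * indicator {0..t} r \<le> ennreal (1 + C) * indicator {0..t} r"
        by (cases "r \<in> {0..t}") simp_all
    qed simp
    also have "(\<integral>\<^sup>+r\<in>{0..t}. ennreal (1 + C) \<partial>lborel) = ennreal (1 + C) * ennreal t"
      using assms by (simp add: nn_integral_cmult_indicator)
    finally show ?thesis .
  qed
  then have "(\<Sum>n<j. emeasure M (?A n)) \<le> 3 * (ennreal (1 + C) * ennreal t)" for j
    by (cases j) simp_all
  then have "(\<Sum>n. emeasure M (?A n)) \<le> 3 * (ennreal (1 + C) * ennreal t)"
    unfolding suminf_eq_SUP by (rule SUP_least)
  also have "\<dots> < \<infinity>" by (simp add: ennreal_mult_less_top)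
  finally show ?thesis .
qed

text \<open>Borel-Cantelli: the probabilities of T n \<le> i are summable over \<open>n\<close> for
  each natural number \<open>i\<close>, so almost surely only finitely many events occur up to
  \<open>i\<close>; countably many \<open>i\<close> cover all times.\<close>

lemma AE_no_explosion: "AE w in M. \<forall>t. finite {n. T n w \<le> ennreal t}"
proof -
  have "AE w in M. finite {n. T n w \<le> ennreal (real i)}" for i
  proof -
    let ?A = "\<lambda>n. {w \<in> space M. T n w \<le> ennreal (real i)}"
    have "AE w in M. \<forall>\<^sub>F n in sequentially. w \<in> space M - ?A n"
    proof (rule borel_cantelli_AE1)
      show "?A n \<in> sets M" for n by measurable
      show "emeasure M (?A n) < \<infinity>" for n by (simp add: emeasure_eq_measure)
      have "(\<Sum>n. ennreal (measure M (?A n))) < \<infinity>"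
        using expected_events_finite[OF of_nat_0_le_iff[of i]] by (simp only: emeasure_eq_measure)
      then show "summable (\<lambda>n. measure M (?A n))"
        by (intro summable_suminf_not_top measure_nonneg) (simp only: infinity_ennreal_def less_imp_neq not_False_eq_True)
    qed
    then show ?thesis
    proof (rule AE_mp, intro AE_I2 impI)
      fix w assume "w \<in> space M" "\<forall>\<^sub>F n in sequentially. w \<in> space M - ?A n"
      then obtain N where "\<forall>n\<ge>N. \<not> T n w \<le> ennreal (real i)" by (auto simp: eventually_sequentially)
      then have "{n. T n w \<le> ennreal (real i)} \<subseteq> {..<N}" by (auto simp: not_le[symmetric])
      then show "finite {n. T n w \<le> ennreal (real i)}" by (rule finite_subset) simp
    qed
  qed
  then have "AE w in M. \<forall>i. finite {n. T n w \<le> ennreal (real i)}"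
    by (intro AE_all_countable[THEN iffD2] allI)
  then show ?thesis
  proof eventually_elim
    case (elim w)
    show ?case
    proof
      fix t :: real
      obtain i where "t \<le> real i" using real_arch_simple by blast
      then have "{n. T n w \<le> ennreal t} \<subseteq> {n. T n w \<le> ennreal (real i)}"
        by (auto intro: order_trans ennreal_leI)
      then show "finite {n. T n w \<le> ennreal t}" by (rule finite_subset) (rule elim[THEN spec])
    qed
  qed
qed

text \<open>Without explosion, s < T (Suc j) for all large \<open>j\<close>, so the localization
  disappears in the limit and monotone convergence preserves the bound uniform in
  \<open>j\<close>.\<close>

lemma second_moment_bound:
  assumes "0 \<le> t"
  shows "\<exists>C\<ge>0. \<forall>s\<in>{0..t}. (\<integral>\<^sup>+w. ennreal ((L s w)\<^sup>2) \<partial>M) \<le> ennreal C"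
proof -
  obtain C where C: "0 \<le> C" "\<forall>s\<in>{0..t}. \<forall>j. localized_moment (Suc j) s \<le> ennreal C"
    using localized_moment_bound[OF assms] by blast
  have "(\<integral>\<^sup>+w. ennreal ((L s w)\<^sup>2) \<partial>M) \<le> ennreal C" if s: "s \<in> {0..t}" for s
  proof -
    let ?q = "\<lambda>j w. if ennreal s < T (Suc j) w then ennreal ((L s w)\<^sup>2) else 0"
    have "(\<integral>\<^sup>+w. ennreal ((L s w)\<^sup>2) \<partial>M) \<le> (\<integral>\<^sup>+w. (SUP j. ?q j w) \<partial>M)"
    proof (rule nn_integral_mono_AE, rule AE_mp[OF AE_no_explosion], intro AE_I2 impI)
      fix w assume "\<forall>t. finite {n. T n w \<le> ennreal t}"
      then have "finite {n. T n w \<le> ennreal s}" ..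
      then obtain N where N: "\<forall>n\<in>{n. T n w \<le> ennreal s}. n < N"
        unfolding finite_nat_set_iff_bounded by blast
      have "\<not> T (Suc N) w \<le> ennreal s"
      proof
        assume "T (Suc N) w \<le> ennreal s"
        then have "Suc N < N" by (intro bspec[OF N]) simp
        then show False by simp
      qed
      then show "ennreal ((L s w)\<^sup>2) \<le> (SUP j. ?q j w)"
        by (intro SUP_upper2[of N]) (simp_all add: not_le)
    qed
    also have "\<dots> = (SUP j. \<integral>\<^sup>+w. ?q j w \<partial>M)"
    proof (rule nn_integral_monotone_convergence_SUP_AE)
      show "AE w in M. ?q j w \<le> ?q (Suc j) w" for j
      proof (rule AE_I2)
        fix w assume "w \<in> space M"
        then have "ennreal s < T (Suc j) w \<Longrightarrow> ennreal s < T (Suc (Suc j)) w"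
          using nondecreasing[of w "Suc j"] by (metis order_less_le_trans)
        then show "?q j w \<le> ?q (Suc j) w" by simp
      qed
      show "?q j \<in> borel_measurable M" for j
      proof -
        have [measurable]: "L s \<in> borel_measurable M" using s by (intro L_measurable) simp
        show ?thesis by measurable
      qed
    qed
    also have "\<dots> \<le> ennreal C"
      using C(2) s by (intro SUP_least) (auto simp: localized_moment_def)
    finally show ?thesis .
  qed
  with C(1) show ?thesis by blast
qed

subsection \<open>The integrated intensity\<close>

definition good_path :: "'a \<Rightarrow> bool" where
  "good_path w \<longleftrightarrow> regular_path w \<and> (\<forall>t. finite {n. T n w \<le> ennreal t})"

lemma AE_good_path: "AE w in M. good_path w"
  using AE_regular_path AE_no_explosion by eventually_elim (simp add: good_path_def)

lemma good_pathD:
  assumes "good_path w"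
  shows "regular_path w" "finite {n. T n w \<le> ennreal t}" "w \<in> space M"
  using assms by (auto simp: good_path_def regular_path_def)

lemma AE_left_intensity:
  assumes "good_path w"
  shows "AE r in lborel. 0 \<le> r \<longrightarrow> left_intensity r w = L r w"
proof -
  have "countable (range (\<lambda>n. event_time n w))" by simp
  then have "AE r in lborel. r \<notin> range (\<lambda>n. event_time n w)"
    by (intro AE_not_in countable_imp_null_set_lborel)
  then show ?thesis
  proof eventually_elim
    case (elim r)
    show ?case
      using left_intensity_off_events[OF good_pathD(1,2)[OF assms], of r] elim by blast
  qed
qed

lemma integrated_intensity_eq_integral:
  "w \<in> space M \<Longrightarrow> integrated_intensity L t w = integral {0..t} (\<lambda>s. L s w)"
  unfolding integrated_intensity_def by (rule set_borel_integral_eq_integral(2)[OF L_set_integrable])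

lemma integrated_intensity_nonneg: "w \<in> space M \<Longrightarrow> 0 \<le> integrated_intensity L t w"
  unfolding integrated_intensity_def set_lebesgue_integral_def
  using nonneg by (intro Bochner_Integration.integral_nonneg) (simp add: indicator_def)

lemma integrated_intensity_mono:
  assumes "w \<in> space M" "s \<le> t"
  shows "integrated_intensity L s w \<le> integrated_intensity L t w"
  unfolding integrated_intensity_eq_integral[OF assms(1)]
  using assms nonneg by (intro integral_subset_le set_borel_integral_eq_integral(1)[OF L_set_integrable]) auto

lemma left_intensity_section_measurable:
  assumes "w \<in> space M"
  shows "(\<lambda>s. if 0 \<le> s then left_intensity s w else 0) \<in> borel_measurable borel"
  using measurable_compose[OF measurable_Pair2'[OF assms] predictable_joint[OF left_intensity_predictable, of 0]]
  by (simp cong: if_cong)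

text \<open>Identifies the predictable process of \<open>left_integral_predictable\<close> with the
  integrated intensity: left limits differ from values only on a null set of times.\<close>

lemma left_integral_eq:
  assumes "good_path w"
  shows "(LBINT u. indicator {0<..s} u * left_intensity u w) = integrated_intensity L s w"
  unfolding integrated_intensity_def set_lebesgue_integral_def
proof (rule integral_cong_AE)
  note w = good_pathD(3)[OF assms]
  have "(\<lambda>u. indicator {0<..s} u * (if 0 \<le> u then left_intensity u w else 0)) \<in> borel_measurable lborel"
    unfolding measurable_lborel2
    by (intro borel_measurable_times borel_measurable_indicator left_intensity_section_measurable w) simp
  then show "(\<lambda>u. indicator {0<..s} u * left_intensity u w) \<in> borel_measurable lborel"
    by (rule measurable_cong[THEN iffD1, rotated]) (simp add: indicator_def)
  show "(\<lambda>u. indicator {0..s} u *\<^sub>R L u w) \<in> borel_measurable lborel"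
    using L_set_integrable[OF w, of s] by (auto simp: set_integrable_def)
  have "AE u in lborel. u \<noteq> (0::real)" by (rule AE_lborel_singleton)
  with AE_left_intensity[OF assms]
  show "AE u in lborel. indicator {0<..s} u * left_intensity u w = indicator {0..s} u *\<^sub>R L u w"
    by eventually_elim (auto simp: indicator_def)
qed

lemma integrated_intensity_square_le:
  assumes "w \<in> space M" "0 \<le> t"
  shows "(integrated_intensity L t w)\<^sup>2 \<le> t * (LBINT s:{0..t}. (L s w)\<^sup>2)"
proof (cases "t = 0")
  case True
  have "integral {0..0} (\<lambda>s. L s w) = 0" by simp
  then show ?thesis using True integrated_intensity_eq_integral[OF assms(1), of 0] by simp
next
  case False
  then have t: "0 < t" using assms by simp
  \<comment> \<open>The Cauchy-Schwarz inequality by integrating 2 m L \<le> L^2 + m^2; the average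
    of \<open>L\<close> over the interval is the best choice of \<open>m\<close>.\<close>
  define m where "m = integrated_intensity L t w / t"
  have int1: "set_integrable lborel {0..t} (\<lambda>s. 2 * m * L s w)"
    by (intro set_integrable_mult_right L_set_integrable assms)
  have const: "set_integrable lborel {0..t} (\<lambda>s. m\<^sup>2)"
    by (rule set_integrable_bounded_Icc) (auto simp: bounded_iff)
  have "(LBINT s:{0..t}. 2 * m * L s w) \<le> (LBINT s:{0..t}. (L s w)\<^sup>2 + m\<^sup>2)"
  proof (rule set_integral_mono[OF int1 set_integral_add(1)[OF set_integrable_L_square[OF assms(1)] const]])
    fix s
    show "2 * m * L s w \<le> (L s w)\<^sup>2 + m\<^sup>2"
      using zero_le_power2[of "L s w - m"] by (simp add: power2_diff mult.commute mult.left_commute)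
  qed
  also have "\<dots> = (LBINT s:{0..t}. (L s w)\<^sup>2) + (LBINT s:{0..t}. m\<^sup>2)"
    by (rule set_integral_add(2)[OF set_integrable_L_square[OF assms(1)] const])
  also have "(LBINT s:{0..t}. m\<^sup>2) = m\<^sup>2 * t" using t by (simp add: set_lebesgue_integral_def)
  also have "(LBINT s:{0..t}. 2 * m * L s w) = 2 * m * integrated_intensity L t w"
    unfolding integrated_intensity_def by (rule set_integral_mult_right)
  also have "2 * m * integrated_intensity L t w = 2 * (m\<^sup>2 * t)"
    using t by (simp add: m_def power2_eq_square)
  finally have "m\<^sup>2 * t \<le> (LBINT s:{0..t}. (L s w)\<^sup>2)" by linarith
  then have "t * (m\<^sup>2 * t) \<le> t * (LBINT s:{0..t}. (L s w)\<^sup>2)" using t by (intro mult_left_mono) auto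
  then show ?thesis using t by (simp add: m_def power2_eq_square)
qed

lemma expected_square_integral_finite:
  assumes "0 \<le> t"
  shows "(\<integral>\<^sup>+w. ennreal (LBINT s:{0..t}. (L s w)\<^sup>2) \<partial>M) < \<infinity>"
    "(\<lambda>w. LBINT s:{0..t}. (L s w)\<^sup>2) \<in> borel_measurable M"
proof -
  interpret P: pair_sigma_finite lborel M ..
  let ?q = "\<lambda>s w. indicator {0..t} s * (if 0 \<le> s then L s w else 0)\<^sup>2"
  have q: "(\<lambda>(s, w). ?q s w) \<in> borel_measurable (lborel \<Otimes>\<^sub>M M)"
  proof -
    have "(\<lambda>x. indicator {0..t} (fst x) * (case x of (s, w) \<Rightarrow> if 0 \<le> s then L s w else 0)\<^sup>2) \<in> borel_measurable (borel \<Otimes>\<^sub>M M)"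
      by (intro borel_measurable_times borel_measurable_power L_joint_measurable
        measurable_compose[OF measurable_fst borel_measurable_indicator]) simp
    moreover have "borel_measurable (borel \<Otimes>\<^sub>M M) = (borel_measurable (lborel \<Otimes>\<^sub>M M) :: (real \<times> 'a \<Rightarrow> real) set)"
      by (intro measurable_cong_sets sets_pair_measure_cong) auto
    ultimately show ?thesis by (simp only: case_prod_unfold)
  qed
  have "(\<lambda>w. LBINT s. ?q s w) \<in> borel_measurable M"
    using measurable_compose[OF measurable_pair_swap' q]
    by (intro lborel.borel_measurable_lebesgue_integral) (simp only: case_prod_unfold fst_conv snd_conv)
  moreover have Q: "(LBINT s. ?q s w) = (LBINT s:{0..t}. (L s w)\<^sup>2)" for w
    unfolding set_lebesgue_integral_def by (intro Bochner_Integration.integral_cong) (auto simp: indicator_def)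
  ultimately show "(\<lambda>w. LBINT s:{0..t}. (L s w)\<^sup>2) \<in> borel_measurable M" by simp
  obtain C where C: "0 \<le> C" "\<forall>s\<in>{0..t}. (\<integral>\<^sup>+w. ennreal ((L s w)\<^sup>2) \<partial>M) \<le> ennreal C"
    using second_moment_bound[OF assms] by blast
  have qe: "(\<lambda>(s, w). ennreal (?q s w)) \<in> borel_measurable (lborel \<Otimes>\<^sub>M M)"
    using measurable_compose[OF q measurable_ennreal] by (simp only: case_prod_unfold)
  have "(\<integral>\<^sup>+w. ennreal (LBINT s:{0..t}. (L s w)\<^sup>2) \<partial>M) = (\<integral>\<^sup>+w. \<integral>\<^sup>+s. ennreal (?q s w) \<partial>lborel \<partial>M)"
  proof (rule nn_integral_cong)
    fix w assume w: "w \<in> space M"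
    have "integrable lborel (\<lambda>s. indicator {0..t} s *\<^sub>R (L s w)\<^sup>2)"
      using set_integrable_L_square[OF w, of t] by (simp add: set_integrable_def)
    then have "integrable lborel (\<lambda>s. ?q s w)"
      by (rule Bochner_Integration.integrable_cong[THEN iffD1, rotated 2]) (auto simp: indicator_def)
    then show "ennreal (LBINT s:{0..t}. (L s w)\<^sup>2) = (\<integral>\<^sup>+s. ennreal (?q s w) \<partial>lborel)"
      unfolding Q[symmetric] by (intro nn_integral_eq_integral[symmetric]) auto
  qed
  also have "\<dots> = (\<integral>\<^sup>+s. \<integral>\<^sup>+w. ennreal (?q s w) \<partial>M \<partial>lborel)"
    using P.Fubini'[OF qe] by simp
  also have "\<dots> \<le> (\<integral>\<^sup>+s. ennreal C * indicator {0..t} s \<partial>lborel)"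
  proof (rule nn_integral_mono)
    fix s :: real
    show "(\<integral>\<^sup>+w. ennreal (?q s w) \<partial>M) \<le> ennreal C * indicator {0..t} s"
      using C(2) by (cases "s \<in> {0..t}") auto
  qed
  also have "\<dots> < \<infinity>" using assms by (simp add: nn_integral_cmult_indicator ennreal_mult_less_top)
  finally show "(\<integral>\<^sup>+w. ennreal (LBINT s:{0..t}. (L s w)\<^sup>2) \<partial>M) < \<infinity>" .
qed

text \<open>The integrability test for signed compensation. Linear growth of \<open>f\<close> in
  \<open>L\<close> and the integrated intensity makes the compensator quadratic, hence controlled by
  the time integral of L^2, whose mean is finite. Domination is asked only where the left limit
  equals the value, which is almost every time.\<close>

lemma dominated_compensator_finite:
  fixes f :: "real \<times> 'a \<Rightarrow> real"
  assumes "0 \<le> t" "0 \<le> c"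
    and dom: "\<And>w s. good_path w \<Longrightarrow> s \<in> {0..t} \<Longrightarrow> left_intensity s w = L s w \<Longrightarrow>
      \<bar>f (s, w)\<bar> \<le> c * (1 + integrated_intensity L t w + L s w)"
    and zero: "\<And>w s. t < s \<Longrightarrow> f (s, w) = 0"
  shows "(\<integral>\<^sup>+w. (\<integral>\<^sup>+s\<in>{0..}. ennreal \<bar>f (s, w)\<bar> * ennreal (L s w) \<partial>lborel) \<partial>M) < \<infinity>"
proof -
  let ?Q = "\<lambda>w. LBINT s:{0..t}. (L s w)\<^sup>2"
  let ?\<Lambda> = "integrated_intensity L t"
  have "(\<integral>\<^sup>+w. (\<integral>\<^sup>+s\<in>{0..}. ennreal \<bar>f (s, w)\<bar> * ennreal (L s w) \<partial>lborel) \<partial>M) \<le>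
    (\<integral>\<^sup>+w. ennreal c + ennreal (c * (2 * t + 1)) * ennreal (?Q w) \<partial>M)"
  proof (rule nn_integral_mono_AE, rule AE_mp[OF AE_good_path], intro AE_I2 impI)
    fix w assume w: "w \<in> space M" "good_path w"
    have Q0: "0 \<le> ?Q w"
      unfolding set_lebesgue_integral_def by (intro Bochner_Integration.integral_nonneg) simp
    have int: "set_integrable lborel {0..t} (\<lambda>s. c * ((1 + ?\<Lambda> w) * L s w + (L s w)\<^sup>2))"
      by (intro set_integrable_mult_right set_integral_add(1) L_set_integrable set_integrable_L_square w)
    have "(\<integral>\<^sup>+s\<in>{0..}. ennreal \<bar>f (s, w)\<bar> * ennreal (L s w) \<partial>lborel) \<le>
      (\<integral>\<^sup>+s. ennreal (indicator {0..t} s *\<^sub>R (c * ((1 + ?\<Lambda> w) * L s w + (L s w)\<^sup>2))) \<partial>lborel)"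
    proof (rule nn_integral_mono_AE, rule AE_mp[OF AE_left_intensity[OF w(2)]], intro AE_I2 impI)
      fix s assume s: "0 \<le> s \<longrightarrow> left_intensity s w = L s w"
      show "ennreal \<bar>f (s, w)\<bar> * ennreal (L s w) * indicator {0..} s \<le>
        ennreal (indicator {0..t} s *\<^sub>R (c * ((1 + ?\<Lambda> w) * L s w + (L s w)\<^sup>2)))"
      proof (cases "s \<in> {0..t}")
        case True
        then have L0: "0 \<le> L s w" using nonneg[OF _ w(1)] by simp
        have "\<bar>f (s, w)\<bar> * L s w \<le> c * (1 + ?\<Lambda> w + L s w) * L s w"
          using dom[OF w(2) True] s True L0 by (intro mult_right_mono) auto
        also have "\<dots> = c * ((1 + ?\<Lambda> w) * L s w + (L s w)\<^sup>2)"
          by (simp add: power2_eq_square algebra_simps)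
        finally have "ennreal (\<bar>f (s, w)\<bar> * L s w) \<le> ennreal (c * ((1 + ?\<Lambda> w) * L s w + (L s w)\<^sup>2))"
          by (rule ennreal_leI)
        then show ?thesis using True L0 by (simp add: ennreal_mult)
      next
        case False
        then show ?thesis using zero[of s w] by (cases "0 \<le> s") auto
      qed
    qed
    also have "\<dots> = ennreal (LBINT s:{0..t}. c * ((1 + ?\<Lambda> w) * L s w + (L s w)\<^sup>2))"
      unfolding set_lebesgue_integral_def
    proof (rule nn_integral_eq_integral)
      show "AE s in lborel. 0 \<le> indicator {0..t} s *\<^sub>R (c * ((1 + ?\<Lambda> w) * L s w + (L s w)\<^sup>2))"
        using nonneg[OF _ w(1)] integrated_intensity_nonneg[OF w(1)] assms(2)
        by (intro AE_I2) (simp add: indicator_def)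
    qed (use int in \<open>simp add: set_integrable_def\<close>)
    also have "(LBINT s:{0..t}. c * ((1 + ?\<Lambda> w) * L s w + (L s w)\<^sup>2)) = c * ((1 + ?\<Lambda> w) * ?\<Lambda> w + ?Q w)"
      unfolding set_integral_mult_right
        set_integral_add(2)[OF set_integrable_mult_right[OF L_set_integrable[OF w(1)]] set_integrable_L_square[OF w(1)]]
      by (simp add: integrated_intensity_def)
    \<comment> \<open>With x the integrated intensity and Q the integral of L^2, x \<le> 1 + x^2 and
      x^2 \<le> t Q give (1 + x) x + Q \<le> 1 + (2 t + 1) Q.\<close>
    also have "ennreal (c * ((1 + ?\<Lambda> w) * ?\<Lambda> w + ?Q w)) \<le> ennreal (c + c * (2 * t + 1) * ?Q w)"
    proof (rule ennreal_leI)
      have "?\<Lambda> w \<le> 1 + (?\<Lambda> w)\<^sup>2" using zero_le_power2[of "?\<Lambda> w - 1"] integrated_intensity_nonneg[OF w(1), of t]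
        by (simp add: power2_diff)
      then have "(1 + ?\<Lambda> w) * ?\<Lambda> w + ?Q w \<le> 1 + 2 * (t * ?Q w) + ?Q w"
        using integrated_intensity_square_le[OF w(1) assms(1)] by (simp add: power2_eq_square algebra_simps)
      then have "c * ((1 + ?\<Lambda> w) * ?\<Lambda> w + ?Q w) \<le> c * (1 + 2 * (t * ?Q w) + ?Q w)"
        using assms(2) by (rule mult_left_mono)
      then show "c * ((1 + ?\<Lambda> w) * ?\<Lambda> w + ?Q w) \<le> c + c * (2 * t + 1) * ?Q w"
        by (simp add: algebra_simps)
    qed
    also have "\<dots> = ennreal c + ennreal (c * (2 * t + 1)) * ennreal (?Q w)"
      using assms(1,2) Q0 by (simp add: ennreal_plus ennreal_mult)
    finally show "(\<integral>\<^sup>+s\<in>{0..}. ennreal \<bar>f (s, w)\<bar> * ennreal (L s w) \<partial>lborel) \<le>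
      ennreal c + ennreal (c * (2 * t + 1)) * ennreal (?Q w)" .
  qed
  also have "\<dots> = ennreal c + ennreal (c * (2 * t + 1)) * (\<integral>\<^sup>+w. ennreal (?Q w) \<partial>M)"
  proof -
    have m: "(\<lambda>w. ennreal (?Q w)) \<in> borel_measurable M"
      by (rule measurable_compose[OF expected_square_integral_finite(2)[OF assms(1)] measurable_ennreal])
    show ?thesis
      by (subst nn_integral_add) (simp_all only: nn_integral_cmult[OF m] nn_integral_const emeasure_space_1 mult_1_right
        borel_measurable_const borel_measurable_times_ennreal[OF borel_measurable_const m])
  qed
  also have "\<dots> < \<infinity>"
    using expected_square_integral_finite(1)[OF assms(1)] by (simp add: ennreal_mult_less_top)
  finally show ?thesis .
qed

lemma suminf_events:
  fixes h y :: "nat \<Rightarrow> real"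
  assumes "good_path w" "0 \<le> t"
  shows "(\<Sum>n. if T n w < \<infinity> then (if event_time n w \<le> t then h n else 0) * y n else 0) =
    (\<Sum>n<counting T t w. h n * y n)"
proof -
  note g = good_pathD(1,2)[OF assms(1)]
  have "(\<Sum>n. if T n w < \<infinity> then (if event_time n w \<le> t then h n else 0) * y n else 0) =
    (\<Sum>n<counting T t w. if T n w < \<infinity> then (if event_time n w \<le> t then h n else 0) * y n else 0)"
  proof (rule suminf_finite)
    fix n assume "n \<notin> {..<counting T t w}"
    then have "\<not> T n w \<le> ennreal t" using events_before[OF g, of t] by blast
    then have "T n w < \<infinity> \<Longrightarrow> \<not> event_time n w \<le> t"
      using ennreal_leI[of "event_time n w" t] by auto
    then show "(if T n w < \<infinity> then (if event_time n w \<le> t then h n else 0) * y n else 0) = 0" by simp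
  qed simp
  also have "\<dots> = (\<Sum>n<counting T t w. h n * y n)"
    using event_time_le(1,3)[OF g assms(2)] by (intro sum.cong) auto
  finally show ?thesis .
qed

lemma LBINT_cutoff:
  "(LBINT s:{0..}. (if s \<le> t then h s else 0) * L s w) = (LBINT s:{0..t}. h s * L s w)"
  unfolding set_lebesgue_integral_def by (intro Bochner_Integration.integral_cong) (auto simp: indicator_def)

section \<open>Mean identities for the intensity and its integral\<close>

text \<open>At \<open>u = t\<close> the condition \<theta> 0 = 0 removes \<open>L t\<close> from
  \<open>weighted_path_decomposition\<close>, and in the mean each jump size may be replaced by its
  expectation under the compensator. Thus the mean of an integral of h (t - s) \<open>L s\<close> is
  obtained by solving \<theta>' - \<rho> \<theta> = h with \<rho> = \<beta> E X - \<alpha>.\<close>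

lemma weighted_mean:
  fixes \<theta> \<theta>' \<Theta> :: "real \<Rightarrow> real"
  assumes t: "0 \<le> t" and "\<theta> 0 = 0"
    and \<theta>: "\<And>r. (\<theta> has_real_derivative \<theta>' r) (at r)" "continuous_on UNIV \<theta>'"
    and \<Theta>: "\<And>r. (\<Theta> has_real_derivative \<alpha> * lam\<^sub>0 * \<theta> r) (at r)"
  shows "(\<integral>w. (LBINT s:{0..t}. (\<theta>' (t - s) - (\<beta> * integral\<^sup>L M X - \<alpha>) * \<theta> (t - s)) * L s w) \<partial>M) = \<theta> t * l + \<Theta> t - \<Theta> 0"
    and "integrable M (\<lambda>w. LBINT s:{0..t}. (\<theta>' (t - s) - (\<beta> * integral\<^sup>L M X - \<alpha>) * \<theta> (t - s)) * L s w)"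
proof -
  define f where "f = (\<lambda>(s, w::'a). if s \<le> t then \<beta> * \<theta> (t - s) else 0)"
  have cont: "continuous_on UNIV \<theta>" using \<theta>(1) by (meson DERIV_isCont continuous_at_imp_continuous_on)
  have conts: "continuous_on UNIV (\<lambda>s. \<theta> (t - s))" "continuous_on UNIV (\<lambda>s. \<theta>' (t - s))"
    by (intro continuous_on_compose2[OF cont] continuous_on_compose2[OF \<theta>(2)] continuous_intros; simp)+
  have f: "f \<in> borel_measurable predictable"
  proof -
    have "(\<lambda>s. if s \<le> t then \<beta> * \<theta> (t - s) else 0) \<in> borel_measurable borel"
      using borel_measurable_continuous_onI[OF conts(1)] by measurable
    from measurable_compose[OF fst_predictable this] show ?thesis
      unfolding f_def by (simp only: case_prod_unfold)
  qed
  have "compact ((\<lambda>s. \<beta> * \<theta> (t - s)) ` {0..t})"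
    by (intro compact_continuous_image continuous_on_subset[OF continuous_on_mult_left[OF conts(1)]]) auto
  then obtain B where B: "\<forall>s\<in>{0..t}. \<bar>\<beta> * \<theta> (t - s)\<bar> \<le> B"
    using bounded_imp_abs_le[OF compact_imp_bounded] by blast
  have B0: "0 \<le> B" using bspec[OF B, of 0] t by (intro order_trans[OF abs_ge_zero]) auto
  have fin: "(\<integral>\<^sup>+w. (\<integral>\<^sup>+s\<in>{0..}. ennreal \<bar>f (s, w)\<bar> * ennreal (L s w) \<partial>lborel) \<partial>M) < \<infinity>"
  proof (rule dominated_compensator_finite[OF t B0])
    fix w s assume w: "good_path w" and s: "s \<in> {0..t}"
    have "\<bar>f (s, w)\<bar> \<le> B * 1" using bspec[OF B s] s by (simp add: f_def)
    also have "\<dots> \<le> B * (1 + integrated_intensity L t w + L s w)"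
      using B0 s integrated_intensity_nonneg[OF good_pathD(3)[OF w]] nonneg[OF _ good_pathD(3)[OF w]]
      by (intro mult_left_mono) auto
    finally show "\<bar>f (s, w)\<bar> \<le> B * (1 + integrated_intensity L t w + L s w)" .
  qed (simp add: f_def)
  note comp = compensation[OF f fin X_integrable measurable_ident_sets[OF refl]]
  let ?S = "\<lambda>w. \<Sum>n. if T n w < \<infinity> then f (event_time n w, w) * J n w else 0"
  let ?c = "\<theta> t * l + \<Theta> t - \<Theta> 0"
  let ?V = "\<lambda>w. LBINT s:{0..}. f (s, w) * L s w"
  let ?W = "\<lambda>w. LBINT s:{0..t}. (\<theta>' (t - s) - (\<beta> * integral\<^sup>L M X - \<alpha>) * \<theta> (t - s)) * L s w"
  have V: "?V w = (LBINT s:{0..t}. \<beta> * \<theta> (t - s) * L s w)" for w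
    unfolding f_def prod.case by (rule LBINT_cutoff)
  have AE: "AE w in M. ?W w = ?c + ?S w - integral\<^sup>L M X * ?V w"
    using AE_good_path
  proof eventually_elim
    case (elim w)
    note g = good_pathD[OF elim]
    have i: "set_integrable lborel {0..t} (\<lambda>s. (- \<theta>' (t - s) - \<alpha> * \<theta> (t - s)) * L s w)"
      using conts by (intro mult_L_set_integrable[OF g(3)] continuous_intros)
    have v: "set_integrable lborel {0..t} (\<lambda>s. \<beta> * \<theta> (t - s) * L s w)"
      using conts by (intro mult_L_set_integrable[OF g(3)] continuous_intros)
    have "\<Theta> 0 = \<theta> t * l + \<Theta> t +
      integral {0..t} (\<lambda>s. (- \<theta>' (t - s) - \<alpha> * \<theta> (t - s)) * L s w) +
      (\<Sum>n<counting T t w. if event_time n w \<le> t then \<beta> * \<theta> (t - event_time n w) * J n w else 0)"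
      using weighted_path_decomposition[OF g(1,2) _ \<theta> \<Theta>, of t t] t assms(2) by simp
    also have "integral {0..t} (\<lambda>s. (- \<theta>' (t - s) - \<alpha> * \<theta> (t - s)) * L s w) =
        (LBINT s:{0..t}. (- \<theta>' (t - s) - \<alpha> * \<theta> (t - s)) * L s w)"
      by (rule set_borel_integral_eq_integral(2)[OF i, symmetric])
    also have "(\<Sum>n<counting T t w. if event_time n w \<le> t then \<beta> * \<theta> (t - event_time n w) * J n w else 0) =
        (\<Sum>n<counting T t w. \<beta> * \<theta> (t - event_time n w) * J n w)"
      using event_time_le(1)[OF g(1,2) t] by (intro sum.cong) auto
    also have "\<dots> = ?S w"
      unfolding f_def prod.case by (rule suminf_events[OF elim t, symmetric])
    finally have eq: "(LBINT s:{0..t}. (- \<theta>' (t - s) - \<alpha> * \<theta> (t - s)) * L s w) = - ?c - ?S w" by simp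
    have "?W w = (LBINT s:{0..t}. - 1 * ((- \<theta>' (t - s) - \<alpha> * \<theta> (t - s)) * L s w) - integral\<^sup>L M X * (\<beta> * \<theta> (t - s) * L s w))"
      unfolding set_lebesgue_integral_def
      by (intro Bochner_Integration.integral_cong) (simp_all add: algebra_simps)
    also have "\<dots> = - 1 * (LBINT s:{0..t}. (- \<theta>' (t - s) - \<alpha> * \<theta> (t - s)) * L s w) -
        integral\<^sup>L M X * (LBINT s:{0..t}. \<beta> * \<theta> (t - s) * L s w)"
      unfolding set_integral_diff(2)[OF set_integrable_mult_right[OF i] set_integrable_mult_right[OF v]]
        set_integral_mult_right ..
    finally show ?case unfolding V eq by simp
  qed
  have int: "integrable M (\<lambda>w. ?c + ?S w - integral\<^sup>L M X * ?V w)"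
    using comp(1,2) by (intro Bochner_Integration.integrable_diff Bochner_Integration.integrable_add integrable_mult_right) simp_all
  have Wm: "?W \<in> borel_measurable M"
  proof -
    define h where "h = (\<lambda>(s, w::'a). if s \<le> t then \<theta>' (t - s) - (\<beta> * integral\<^sup>L M X - \<alpha>) * \<theta> (t - s) else 0)"
    have "(\<lambda>s. if s \<le> t then \<theta>' (t - s) - (\<beta> * integral\<^sup>L M X - \<alpha>) * \<theta> (t - s) else 0) \<in> borel_measurable borel"
      using borel_measurable_continuous_onI[OF conts(1)] borel_measurable_continuous_onI[OF conts(2)] by measurable
    from measurable_compose[OF fst_predictable this]
    have "h \<in> borel_measurable predictable"
      unfolding h_def by (simp only: case_prod_unfold)
    from measurable_compose[OF measurable_pair_swap' predictable_L_joint_measurable[OF this]]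
    have "(\<lambda>w. LBINT s. indicator {0..} s * (h (s, w) * L s w)) \<in> borel_measurable M"
      by (intro lborel.borel_measurable_lebesgue_integral) (simp only: case_prod_unfold fst_conv snd_conv)
    also have "(\<lambda>w. LBINT s. indicator {0..} s * (h (s, w) * L s w)) = ?W"
    proof (rule ext)
      fix w
      show "(LBINT s. indicator {0..} s * (h (s, w) * L s w)) = ?W w"
        using LBINT_cutoff[of t "\<lambda>s. \<theta>' (t - s) - (\<beta> * integral\<^sup>L M X - \<alpha>) * \<theta> (t - s)" w]
        unfolding set_lebesgue_integral_def h_def prod.case real_scaleR_def .
    qed
    finally show ?thesis .
  qed
  show "integrable M ?W"
    by (rule integrable_cong_AE[THEN iffD2, OF Wm borel_measurable_integrable[OF int] AE int])
  have "(\<integral>w. ?W w \<partial>M) = (\<integral>w. ?c + ?S w - integral\<^sup>L M X * ?V w \<partial>M)"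
    by (rule integral_cong_AE[OF Wm borel_measurable_integrable[OF int] AE])
  also have "\<dots> = ?c + (\<integral>w. ?S w \<partial>M) - integral\<^sup>L M X * (\<integral>w. ?V w \<partial>M)"
    using comp(1,2) by (simp add: prob_space)
  also have "(\<integral>w. ?S w \<partial>M) = integral\<^sup>L M X * (\<integral>w. ?V w \<partial>M)" by (rule comp(3))
  finally show "(\<integral>w. ?W w \<partial>M) = ?c" by simp
qed

text \<open>The isometry for the martingale with terminal value \<Lambda> t. The assumption
  \<open>ode\<close> is what reduces the drift of \<open>Z\<close> to minus the compensator of its
  jumps, and the initial conditions give \<open>Z t w\<close> the value \<Lambda> t.\<close>

lemma integrated_intensity_square:
  fixes \<psi> \<psi>' \<Psi> :: "real \<Rightarrow> real"
  assumes t: "0 \<le> t" and "\<psi> 0 = 0" "\<Psi> 0 = 0"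
    and \<psi>: "\<And>r. (\<psi> has_real_derivative \<psi>' r) (at r)" "continuous_on UNIV \<psi>'"
    and \<Psi>: "\<And>r. (\<Psi> has_real_derivative \<alpha> * lam\<^sub>0 * \<psi> r) (at r)"
    and ode: "\<And>r. \<psi>' r = 1 + (\<beta> * integral\<^sup>L M X - \<alpha>) * \<psi> r"
  shows "integrable M (\<lambda>w. (integrated_intensity L t w)\<^sup>2)"
    and "(\<integral>w. (integrated_intensity L t w)\<^sup>2 \<partial>M) = (\<psi> t * l + \<Psi> t)\<^sup>2 +
      \<beta>\<^sup>2 * (\<integral>w. (X w)\<^sup>2 \<partial>M) * (\<integral>w. (LBINT s:{0..t}. (\<psi> (t - s))\<^sup>2 * L s w) \<partial>M)"
proof -
  let ?\<kappa> = "integral\<^sup>L M X"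
  define Z where "Z s w = integrated_intensity L s w + \<psi> (t - s) * L s w + \<Psi> (t - s)" for s w
  define Z\<^sub>0 where "Z\<^sub>0 = \<psi> t * l + \<Psi> t"
  \<comment> \<open>The predictable version of \<open>Z\<close>: on a good path it agrees with
    \<open>Z\<close> at almost every time, while at an event it is the value of \<open>Z\<close>
    before the jump.\<close>
  define Zp where "Zp = (\<lambda>(s, w). (LBINT u. indicator {0<..s} u * left_intensity u w) +
    \<psi> (t - s) * left_intensity s w + \<Psi> (t - s))"
  \<comment> \<open>If \<open>Z\<close> jumps by y = \<beta> \<psi> (t - s) J, its square jumps by
    twice the value before the jump times y, plus y^2. The coefficients of J and J^2 are
    \<open>f\<^sub>1\<close> and \<open>f\<^sub>2\<close>.\<close>
  define f\<^sub>1 where "f\<^sub>1 = (\<lambda>(s, w). if s \<le> t then 2 * \<beta> * \<psi> (t - s) * Zp (s, w) else 0)"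
  define f\<^sub>2 where "f\<^sub>2 = (\<lambda>(s, w::'a). if s \<le> t then \<beta>\<^sup>2 * (\<psi> (t - s))\<^sup>2 else 0)"
  have cont_\<psi>: "continuous_on UNIV \<psi>" using \<psi>(1) by (meson DERIV_isCont continuous_at_imp_continuous_on)
  have cont_\<Psi>: "continuous_on UNIV \<Psi>" using \<Psi> by (meson DERIV_isCont continuous_at_imp_continuous_on)
  have conts: "continuous_on UNIV (\<lambda>s. \<psi> (t - s))" "continuous_on UNIV (\<lambda>s. \<Psi> (t - s))"
    by (intro continuous_on_compose2[OF cont_\<psi>] continuous_on_compose2[OF cont_\<Psi>] continuous_intros; simp)+
  note psi_meas [measurable] = measurable_compose[OF fst_predictable borel_measurable_continuous_onI[OF conts(1)]]
    measurable_compose[OF fst_predictable borel_measurable_continuous_onI[OF conts(2)]]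
  have Zp_meas: "Zp \<in> borel_measurable predictable"
    unfolding Zp_def using left_intensity_predictable left_integral_predictable psi_meas
    unfolding case_prod_unfold by (intro borel_measurable_add borel_measurable_times)
  have f\<^sub>1: "f\<^sub>1 \<in> borel_measurable predictable"
  proof -
    note [measurable] = Zp_meas
    have "(\<lambda>x. if fst x \<le> t then 2 * \<beta> * \<psi> (t - fst x) * Zp x else 0) \<in> borel_measurable predictable"
      by measurable
    then show ?thesis unfolding f\<^sub>1_def by (simp only: case_prod_unfold prod.collapse)
  qed
  have f\<^sub>2: "f\<^sub>2 \<in> borel_measurable predictable"
  proof -
    have "(\<lambda>x. if fst x \<le> t then \<beta>\<^sup>2 * (\<psi> (t - fst x))\<^sup>2 else 0) \<in> borel_measurable predictable"
      by measurable
    then show ?thesis unfolding f\<^sub>2_def by (simp only: case_prod_unfold)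
  qed
  have "compact ((\<lambda>s. \<psi> (t - s)) ` {0..t})"
    by (intro compact_continuous_image continuous_on_subset[OF conts(1)]) auto
  then obtain B\<^sub>1 where B\<^sub>1: "\<forall>s\<in>{0..t}. \<bar>\<psi> (t - s)\<bar> \<le> B\<^sub>1"
    using bounded_imp_abs_le[OF compact_imp_bounded] by blast
  have "compact ((\<lambda>s. \<Psi> (t - s)) ` {0..t})"
    by (intro compact_continuous_image continuous_on_subset[OF conts(2)]) auto
  then obtain B\<^sub>2 where B\<^sub>2: "\<forall>s\<in>{0..t}. \<bar>\<Psi> (t - s)\<bar> \<le> B\<^sub>2"
    using bounded_imp_abs_le[OF compact_imp_bounded] by blast
  define B where "B = max 0 (max B\<^sub>1 B\<^sub>2)"
  have B: "0 \<le> B" "\<bar>\<psi> (t - s)\<bar> \<le> B" "\<bar>\<Psi> (t - s)\<bar> \<le> B" if "s \<in> {0..t}" for s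
    using bspec[OF B\<^sub>1 that] bspec[OF B\<^sub>2 that] unfolding B_def by linarith+
  have B0: "0 \<le> B" by (simp add: B_def)
  have Zp_eq: "Zp (s, w) = Z s w" if "good_path w" "left_intensity s w = L s w" for s w
    using that left_integral_eq[OF that(1)] by (simp add: Zp_def Z_def)
  have fin\<^sub>1: "(\<integral>\<^sup>+w. (\<integral>\<^sup>+s\<in>{0..}. ennreal \<bar>f\<^sub>1 (s, w)\<bar> * ennreal (L s w) \<partial>lborel) \<partial>M) < \<infinity>"
  proof (rule dominated_compensator_finite[OF t, of "2 * \<bar>\<beta>\<bar> * B * (1 + B)"])
    show "0 \<le> 2 * \<bar>\<beta>\<bar> * B * (1 + B)" using B0 by simp
    fix w s assume w: "good_path w" and s: "s \<in> {0..t}" and left: "left_intensity s w = L s w"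
    note sp = good_pathD(3)[OF w]
    let ?\<Lambda> = "integrated_intensity L t w"
    have L0: "0 \<le> L s w" using nonneg[OF _ sp] s by simp
    have \<Lambda>: "0 \<le> integrated_intensity L s w" "integrated_intensity L s w \<le> ?\<Lambda>"
      using integrated_intensity_nonneg[OF sp] integrated_intensity_mono[OF sp] s by auto
    have "\<bar>\<psi> (t - s) * L s w\<bar> \<le> B * L s w"
      unfolding abs_mult using B(2)[OF s] L0 by (intro mult_mono) auto
    then have "\<bar>Z s w\<bar> \<le> ?\<Lambda> + B * L s w + B" using \<Lambda> B(3)[OF s] unfolding Z_def by linarith
    also have "\<dots> \<le> (1 + B) * (1 + ?\<Lambda> + L s w)"
    proof -
      have "0 \<le> B * ?\<Lambda>" using B0 \<Lambda> by (intro mult_nonneg_nonneg) auto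
      then show ?thesis using L0 by (simp add: algebra_simps)
    qed
    finally have "\<bar>2 * \<beta> * \<psi> (t - s)\<bar> * \<bar>Z s w\<bar> \<le> (2 * \<bar>\<beta>\<bar> * B) * ((1 + B) * (1 + ?\<Lambda> + L s w))"
      using B0 B(2)[OF s] by (intro mult_mono) (auto simp: abs_mult intro!: mult_left_mono)
    then show "\<bar>f\<^sub>1 (s, w)\<bar> \<le> 2 * \<bar>\<beta>\<bar> * B * (1 + B) * (1 + ?\<Lambda> + L s w)"
      using s Zp_eq[OF w left] by (simp add: f\<^sub>1_def abs_mult mult.assoc)
  qed (simp add: f\<^sub>1_def)
  have fin\<^sub>2: "(\<integral>\<^sup>+w. (\<integral>\<^sup>+s\<in>{0..}. ennreal \<bar>f\<^sub>2 (s, w)\<bar> * ennreal (L s w) \<partial>lborel) \<partial>M) < \<infinity>"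
  proof (rule dominated_compensator_finite[OF t, of "\<beta>\<^sup>2 * B\<^sup>2"])
    fix w s assume w: "good_path w" and s: "s \<in> {0..t}"
    have "\<bar>\<psi> (t - s)\<bar>\<^sup>2 \<le> B\<^sup>2" using B(2)[OF s] by (rule power_mono) simp
    then have "\<bar>f\<^sub>2 (s, w)\<bar> \<le> \<beta>\<^sup>2 * B\<^sup>2 * 1"
      using s by (simp add: f\<^sub>2_def abs_mult mult_left_mono)
    also have "\<dots> \<le> \<beta>\<^sup>2 * B\<^sup>2 * (1 + integrated_intensity L t w + L s w)"
      using s integrated_intensity_nonneg[OF good_pathD(3)[OF w]] nonneg[OF _ good_pathD(3)[OF w]]
      by (intro mult_left_mono) auto
    finally show "\<bar>f\<^sub>2 (s, w)\<bar> \<le> \<beta>\<^sup>2 * B\<^sup>2 * (1 + integrated_intensity L t w + L s w)" .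
  qed (simp_all add: f\<^sub>2_def)
  have sq_meas: "(\<lambda>x. x\<^sup>2) \<in> borel_measurable (borel :: real measure)" by measurable
  note comp\<^sub>1 = compensation[OF f\<^sub>1 fin\<^sub>1 X_integrable measurable_ident_sets[OF refl]]
  note comp\<^sub>2 = compensation[OF f\<^sub>2 fin\<^sub>2 X_square_integrable sq_meas]
  let ?S\<^sub>1 = "\<lambda>w. \<Sum>n. if T n w < \<infinity> then f\<^sub>1 (event_time n w, w) * J n w else 0"
  let ?S\<^sub>2 = "\<lambda>w. \<Sum>n. if T n w < \<infinity> then f\<^sub>2 (event_time n w, w) * (J n w)\<^sup>2 else 0"
  let ?V\<^sub>1 = "\<lambda>w. LBINT s:{0..}. f\<^sub>1 (s, w) * L s w"
  let ?V\<^sub>2 = "\<lambda>w. LBINT s:{0..}. f\<^sub>2 (s, w) * L s w"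
  interpret P: pair_sigma_finite M lborel ..
  \<comment> \<open>Integrability along single paths identifies the Lebesgue integral
    \<open>?V\<^sub>1 w\<close> with the gauge integral delivered by the product rule.\<close>
  have "AE w in M. integrable lborel (\<lambda>s. indicator {0..} s * (f\<^sub>1 (s, w) * L s w))"
    using P.AE_integrable_fst'[OF predictable_L_integrable[OF f\<^sub>1 fin\<^sub>1]] by simp
  with AE_good_path
  have AE: "AE w in M. (integrated_intensity L t w)\<^sup>2 = Z\<^sub>0\<^sup>2 + ?S\<^sub>1 w + ?S\<^sub>2 w - ?\<kappa> * ?V\<^sub>1 w"
  proof eventually_elim
    case (elim w)
    note g = good_pathD[OF elim(1)]
    let ?N = "counting T t w"
    let ?a = "\<lambda>s. - (\<beta> * ?\<kappa> * \<psi> (t - s)) * L s w"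
    let ?j = "\<lambda>n. \<beta> * \<psi> (t - event_time n w) * J n w"
    have a_int: "set_integrable lborel {0..u} ?a" for u
      using conts(1) by (intro mult_L_set_integrable[OF g(3)] continuous_intros)
    have a_HK: "?a integrable_on {0..u}" for u by (rule set_borel_integral_eq_integral(1)[OF a_int])
    have L_HK: "(\<lambda>s. L s w) integrable_on {0..u}" for u
      by (rule set_borel_integral_eq_integral(1)[OF L_set_integrable[OF g(3)]])
    have Z: "Z u w = Z\<^sub>0 + integral {0..u} ?a + (\<Sum>n<?N. if event_time n w \<le> u then ?j n else 0)"
      if u: "u \<in> {0..t}" for u
    proof -
      have "\<psi> (t - u) * L u w + \<Psi> (t - u) = Z\<^sub>0 +
        integral {0..u} (\<lambda>s. (- \<psi>' (t - s) - \<alpha> * \<psi> (t - s)) * L s w) +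
        (\<Sum>n<?N. if event_time n w \<le> u then ?j n else 0)"
        unfolding Z\<^sub>0_def by (rule weighted_path_decomposition[OF g(1,2) u \<psi> \<Psi>])
      \<comment> \<open>By \<open>ode\<close> the integrand is \<open>?a s - L s w\<close>; the
        second part cancels the integrated intensity contained in \<open>Z\<close>.\<close>
      also have "integral {0..u} (\<lambda>s. (- \<psi>' (t - s) - \<alpha> * \<psi> (t - s)) * L s w) =
        integral {0..u} (\<lambda>s. ?a s - L s w)"
        by (intro Henstock_Kurzweil_Integration.integral_cong) (simp add: ode algebra_simps)
      also have "\<dots> = integral {0..u} ?a - integrated_intensity L u w"
        unfolding integrated_intensity_eq_integral[OF g(3)]
        by (rule Henstock_Kurzweil_Integration.integral_diff[OF a_HK L_HK])
      finally show ?thesis unfolding Z_def by simp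
    qed
    have Zt: "Z t w = integrated_intensity L t w" by (simp add: Z_def assms(2,3))
    have Z_pre: "Z\<^sub>0 + integral {0..event_time n w} ?a + (\<Sum>m<n. ?j m) = Zp (event_time n w, w)"
      if n: "n < ?N" for n
    proof -
      note e = event_time_le(1)[OF g(1,2) t n]
      have jumps: "(\<Sum>m<?N. if event_time m w \<le> event_time n w then h m else 0) = (\<Sum>m<n. h m) + h n" for h :: "nat \<Rightarrow> real"
      proof -
        have "(\<Sum>m<?N. if event_time m w \<le> event_time n w then h m else 0) = (\<Sum>m<?N. if m \<in> {..<Suc n} then h m else 0)"
          using event_time_less_iff[OF g(1,2) t _ n] by (intro sum.cong) (auto simp: not_less[symmetric] less_Suc_eq_le)
        also have "\<dots> = sum h ({..<?N} \<inter> {..<Suc n})" by (rule sum.inter_restrict[symmetric]) simp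
        also have "{..<?N} \<inter> {..<Suc n} = {..<Suc n}" using n by auto
        finally show ?thesis by simp
      qed
      \<comment> \<open>The integrated intensity and the deterministic functions do not jump, so
        \<open>Z\<close> jumps at an event by \<psi> (t - s) times the jump of
        \<open>L\<close>.\<close>
      have "L (event_time n w) w = left_intensity (event_time n w) w + \<beta> * J n w"
        using path_decomposition[OF g(1,2) e] left_intensity_at_event[OF g(1,2) t n] unfolding jumps by simp
      then have "Zp (event_time n w, w) = Z (event_time n w) w - ?j n"
        unfolding Zp_def Z_def prod.case left_integral_eq[OF elim(1)] by (simp add: algebra_simps)
      then show ?thesis using Z[OF e] unfolding jumps by simp
    qed
    have off: "isCont ?a s" if "s \<in> {0<..<t} - (\<lambda>n. event_time n w) ` {..<?N}" for s
      using conts(1) by (intro continuous_intros path_continuous_off_events[OF g(1,2) that])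
        (simp add: continuous_on_eq_continuous_at)
    have prod: "((\<lambda>s. Z s w * ?a s + Z s w * ?a s) has_integral Z t w * Z t w - Z\<^sub>0 * Z\<^sub>0 -
      (\<Sum>n<?N. (Z\<^sub>0 + integral {0..event_time n w} ?a + (\<Sum>m<n. ?j m)) * ?j n +
        (Z\<^sub>0 + integral {0..event_time n w} ?a + (\<Sum>m<n. ?j m)) * ?j n + ?j n * ?j n)) {0..t}"
      by (rule jump_product_rule[where x = "\<lambda>s. Z s w" and y = "\<lambda>s. Z s w" and a = ?a and b = ?a
          and j = ?j and k = ?j and x\<^sub>0 = Z\<^sub>0 and y\<^sub>0 = Z\<^sub>0 and \<tau> = "\<lambda>n. event_time n w" and N = ?N,
          OF t event_time_le(1)[OF g(1,2) t] a_HK off a_HK off Z Z])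
    have sum_eq: "(\<Sum>n<?N. (Z\<^sub>0 + integral {0..event_time n w} ?a + (\<Sum>m<n. ?j m)) * ?j n +
        (Z\<^sub>0 + integral {0..event_time n w} ?a + (\<Sum>m<n. ?j m)) * ?j n + ?j n * ?j n) = ?S\<^sub>1 w + ?S\<^sub>2 w"
    proof -
      have "?S\<^sub>1 w = (\<Sum>n<?N. 2 * \<beta> * \<psi> (t - event_time n w) * Zp (event_time n w, w) * J n w)"
        unfolding f\<^sub>1_def prod.case by (rule suminf_events[OF elim(1) t])
      moreover have "?S\<^sub>2 w = (\<Sum>n<?N. \<beta>\<^sup>2 * (\<psi> (t - event_time n w))\<^sup>2 * (J n w)\<^sup>2)"
        unfolding f\<^sub>2_def prod.case by (rule suminf_events[OF elim(1) t])
      moreover have "(\<Sum>n<?N. (Z\<^sub>0 + integral {0..event_time n w} ?a + (\<Sum>m<n. ?j m)) * ?j n +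
        (Z\<^sub>0 + integral {0..event_time n w} ?a + (\<Sum>m<n. ?j m)) * ?j n + ?j n * ?j n) =
        (\<Sum>n<?N. Zp (event_time n w, w) * ?j n + Zp (event_time n w, w) * ?j n + ?j n * ?j n)"
        by (intro sum.cong refl) (simp only: Z_pre lessThan_iff)
      moreover have "\<dots> = (\<Sum>n<?N. 2 * \<beta> * \<psi> (t - event_time n w) * Zp (event_time n w, w) * J n w +
          \<beta>\<^sup>2 * (\<psi> (t - event_time n w))\<^sup>2 * (J n w)\<^sup>2)"
        by (intro sum.cong refl) (simp add: power2_eq_square algebra_simps)
      ultimately show ?thesis by (simp only: sum.distrib)
    qed
    have "((\<lambda>s. - ?\<kappa> * (f\<^sub>1 (s, w) * L s w)) has_integral (Z t w)\<^sup>2 - Z\<^sub>0\<^sup>2 - (?S\<^sub>1 w + ?S\<^sub>2 w)) {0..t}"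
    proof (rule has_integral_spike_finite)
      \<comment> \<open>The point 0 joins the exceptional set because \<open>event_time\<close> is 0
        for events that never occur; at other points, a time equal to some \<open>event_time\<close>
        is a genuine event.\<close>
      show "finite (insert 0 ((\<lambda>n. event_time n w) ` {..<?N}))" by simp
      show "((\<lambda>s. Z s w * ?a s + Z s w * ?a s) has_integral (Z t w)\<^sup>2 - Z\<^sub>0\<^sup>2 - (?S\<^sub>1 w + ?S\<^sub>2 w)) {0..t}"
        using prod unfolding sum_eq power2_eq_square .
      fix s assume s: "s \<in> {0..t} - insert 0 ((\<lambda>n. event_time n w) ` {..<?N})"
      have "event_time n w \<noteq> s" for n
      proof
        assume e: "event_time n w = s"
        then have "T n w = ennreal s" using s by (cases "T n w") auto
        then have "n \<in> {..<?N}" using s unfolding events_before[OF g(1,2), symmetric] by (auto intro: ennreal_leI)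
        then show False using e s by blast
      qed
      then have "left_intensity s w = L s w" using s by (intro left_intensity_off_events[OF g(1,2)]) auto
      then show "- ?\<kappa> * (f\<^sub>1 (s, w) * L s w) = Z s w * ?a s + Z s w * ?a s"
        using s Zp_eq[OF elim(1)] by (simp add: f\<^sub>1_def)
    qed
    moreover have "((\<lambda>s. - ?\<kappa> * (f\<^sub>1 (s, w) * L s w)) has_integral - ?\<kappa> * ?V\<^sub>1 w) {0..t}"
    proof -
      have "integrable lborel (\<lambda>s. indicator {0..t} s *\<^sub>R (f\<^sub>1 (s, w) * L s w))"
        by (rule Bochner_Integration.integrable_cong[THEN iffD1, OF refl _ elim(2)])
          (auto simp: f\<^sub>1_def indicator_def)
      then have i: "set_integrable lborel {0..t} (\<lambda>s. f\<^sub>1 (s, w) * L s w)" by (simp add: set_integrable_def)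
      have "(LBINT s:{0..t}. f\<^sub>1 (s, w) * L s w) = ?V\<^sub>1 w"
        unfolding set_lebesgue_integral_def
        by (intro Bochner_Integration.integral_cong) (auto simp: f\<^sub>1_def indicator_def)
      then have "integral {0..t} (\<lambda>s. f\<^sub>1 (s, w) * L s w) = ?V\<^sub>1 w"
        using set_borel_integral_eq_integral(2)[OF i] by simp
      then show ?thesis
        using has_integral_mult_right[OF integrable_integral[OF set_borel_integral_eq_integral(1)[OF i]], of "- ?\<kappa>"]
        by simp
    qed
    ultimately have "(Z t w)\<^sup>2 - Z\<^sub>0\<^sup>2 - (?S\<^sub>1 w + ?S\<^sub>2 w) = - ?\<kappa> * ?V\<^sub>1 w" by (rule has_integral_unique)
    then show ?case unfolding Zt by simp
  qed
  have int: "integrable M (\<lambda>w. Z\<^sub>0\<^sup>2 + ?S\<^sub>1 w + ?S\<^sub>2 w - ?\<kappa> * ?V\<^sub>1 w)"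
    using comp\<^sub>1(1,2) comp\<^sub>2(1)
    by (intro Bochner_Integration.integrable_diff Bochner_Integration.integrable_add integrable_mult_right) simp_all
  have meas: "(\<lambda>w. (integrated_intensity L t w)\<^sup>2) \<in> borel_measurable M"
  proof -
    have "(\<lambda>(s, w). indicator {0..} s * ((if s \<le> t then 1 else 0) * L s w)) \<in> borel_measurable (lborel \<Otimes>\<^sub>M M)"
    proof -
      have "(\<lambda>x. if fst x \<le> t then 1 else (0::real)) \<in> borel_measurable predictable" by measurable
      from predictable_L_joint_measurable[OF this] show ?thesis by (simp only: fst_conv)
    qed
    from measurable_compose[OF measurable_pair_swap' this]
    have "(\<lambda>w. LBINT s. indicator {0..} s * ((if s \<le> t then 1 else 0) * L s w)) \<in> borel_measurable M"
      by (intro lborel.borel_measurable_lebesgue_integral) (simp only: case_prod_unfold fst_conv snd_conv)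
    also have "(\<lambda>w. LBINT s. indicator {0..} s * ((if s \<le> t then 1 else 0) * L s w)) = integrated_intensity L t"
    proof (rule ext)
      fix w
      show "(LBINT s. indicator {0..} s * ((if s \<le> t then 1 else 0) * L s w)) = integrated_intensity L t w"
        using LBINT_cutoff[of t "\<lambda>_. 1" w]
        unfolding integrated_intensity_def set_lebesgue_integral_def real_scaleR_def by (simp only: mult_1_left)
    qed
    finally show ?thesis by (rule borel_measurable_power)
  qed
  show "integrable M (\<lambda>w. (integrated_intensity L t w)\<^sup>2)"
    by (rule integrable_cong_AE[THEN iffD2, OF meas borel_measurable_integrable[OF int] AE int])
  have "(\<integral>w. (integrated_intensity L t w)\<^sup>2 \<partial>M) = (\<integral>w. Z\<^sub>0\<^sup>2 + ?S\<^sub>1 w + ?S\<^sub>2 w - ?\<kappa> * ?V\<^sub>1 w \<partial>M)"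
    by (rule integral_cong_AE[OF meas borel_measurable_integrable[OF int] AE])
  also have "\<dots> = Z\<^sub>0\<^sup>2 + (\<integral>w. ?S\<^sub>1 w \<partial>M) + (\<integral>w. ?S\<^sub>2 w \<partial>M) - ?\<kappa> * (\<integral>w. ?V\<^sub>1 w \<partial>M)"
    using comp\<^sub>1(1,2) comp\<^sub>2(1) by (simp add: prob_space)
  \<comment> \<open>This is the cancellation: the mean of the cross term equals the mean of the
    compensator subtracted in the pathwise identity.\<close>
  also have "(\<integral>w. ?S\<^sub>1 w \<partial>M) = ?\<kappa> * (\<integral>w. ?V\<^sub>1 w \<partial>M)" by (rule comp\<^sub>1(3))
  also have "(\<integral>w. ?S\<^sub>2 w \<partial>M) = (\<integral>w. (X w)\<^sup>2 \<partial>M) * (\<integral>w. ?V\<^sub>2 w \<partial>M)" by (rule comp\<^sub>2(3))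
  also have "(\<integral>w. ?V\<^sub>2 w \<partial>M) = \<beta>\<^sup>2 * (\<integral>w. (LBINT s:{0..t}. (\<psi> (t - s))\<^sup>2 * L s w) \<partial>M)"
    unfolding f\<^sub>2_def prod.case LBINT_cutoff mult.assoc set_integral_mult_right by (rule integral_mult_right_zero)
  finally show "(\<integral>w. (integrated_intensity L t w)\<^sup>2 \<partial>M) = (\<psi> t * l + \<Psi> t)\<^sup>2 +
      \<beta>\<^sup>2 * (\<integral>w. (X w)\<^sup>2 \<partial>M) * (\<integral>w. (LBINT s:{0..t}. (\<psi> (t - s))\<^sup>2 * L s w) \<partial>M)"
    unfolding Z\<^sub>0_def by simp
qed

end

section \<open>Closed form of the second moment\<close>

text \<open>With exp (\<rho> t) replaced by a free variable \<open>E\<close> and \<alpha>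
  \<open>lam\<^sub>0\<close> by \<open>a\<close>, the comparison of coefficients is a rational
  identity. The factor \<open>A - 2 * a\<close> stands for \<beta>^2 E X^2, and the last subtracted
  term on the left is the value \<Theta> 0 from the main proof.\<close>

lemma second_moment_closed_form:
  fixes \<rho> a l A t E :: real
  assumes "\<rho> \<noteq> 0"
  shows "((E - 1) / \<rho> * l + a * ((E - 1) / \<rho>\<^sup>2 - t / \<rho>))\<^sup>2 +
      (A - 2 * a) * (((E\<^sup>2 - 1) / \<rho> ^ 3 - 2 * t * E / \<rho>\<^sup>2) * l +
        a * (E\<^sup>2 / (2 * \<rho> ^ 4) - t / \<rho> ^ 3 - 2 * t * E / \<rho> ^ 3 + 2 * E / \<rho> ^ 4) - a * (1 / (2 * \<rho> ^ 4) + 2 / \<rho> ^ 4)) =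
    (2 * (- (a / \<rho>)) * (- (a / \<rho>) - 2 * (a / \<rho> + l)) - 2 * (A * a / (2 * \<rho>\<^sup>2)) +
      2 * (- (A / \<rho>) * (a / \<rho> + l)) + (A / (2 * \<rho>\<^sup>2) * (a + 2 * \<rho> * l) + l\<^sup>2)) / \<rho>\<^sup>2 +
    (2 * (- (a / \<rho>)) * (- (a / \<rho>) - (a / \<rho> + l)) - 2 * (A * a / (2 * \<rho>\<^sup>2))) / \<rho> * t +
    (- (a / \<rho>))\<^sup>2 * t\<^sup>2 +
    (2 * (- (a / \<rho>) * (2 * (a / \<rho> + l) - - (a / \<rho>)) + A * a / (2 * \<rho>\<^sup>2) - - (A / \<rho>) * (a / \<rho> + l) -
      (A / (2 * \<rho>\<^sup>2) * (a + 2 * \<rho> * l) + l\<^sup>2)) / \<rho>\<^sup>2 +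
     2 * (- (A / \<rho>) * (a / \<rho> + l) - - (a / \<rho>) * (a / \<rho> + l)) / \<rho> * t) * E +
    (A / (2 * \<rho>\<^sup>2) * (a + 2 * \<rho> * l) + l\<^sup>2) / \<rho>\<^sup>2 * E\<^sup>2"
  using assms by (simp add: divide_simps) algebra

theorem mainTheorem4:
  fixes M :: "'a measure" and F :: "ennreal \<Rightarrow> 'a measure"
    and T :: "nat \<Rightarrow> 'a \<Rightarrow> ennreal" and J :: "nat \<Rightarrow> 'a \<Rightarrow> real" and X :: "'a \<Rightarrow> real"
    and L :: "real \<Rightarrow> 'a \<Rightarrow> real"
    and \<alpha> \<beta> lam\<^sub>0 l \<rho> A m\<^sub>0 m\<^sub>1 v\<^sub>0 v\<^sub>1 v\<^sub>2 k\<^sub>0 k\<^sub>1 k\<^sub>2 C\<^sub>0 C\<^sub>1 C\<^sub>2 t :: real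
  assumes "linear_self_exciting M F T J X L \<alpha> \<beta> lam\<^sub>0 l"
    and "l > 0"
    and "\<rho> = \<beta> * integral\<^sup>L M X - \<alpha>"
    and "A = 2 * \<alpha> * lam\<^sub>0 + \<beta>\<^sup>2 * integral\<^sup>L M (\<lambda>\<omega>. (X \<omega>)\<^sup>2)"
    and "\<rho> \<noteq> 0"
    and "m\<^sub>0 = - (\<alpha> * lam\<^sub>0 / \<rho>)"
    and "m\<^sub>1 = \<alpha> * lam\<^sub>0 / \<rho> + l"
    and "v\<^sub>0 = A * \<alpha> * lam\<^sub>0 / (2 * \<rho>\<^sup>2)"
    and "v\<^sub>1 = - (A / \<rho>) * (\<alpha> * lam\<^sub>0 / \<rho> + l)"
    and "v\<^sub>2 = A / (2 * \<rho>\<^sup>2) * (\<alpha> * lam\<^sub>0 + 2 * \<rho> * l) + l\<^sup>2"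
    and "k\<^sub>0 = (2 * m\<^sub>0 * (m\<^sub>0 - 2 * m\<^sub>1) - 2 * v\<^sub>0 + 2 * v\<^sub>1 + v\<^sub>2) / \<rho>\<^sup>2"
    and "k\<^sub>1 = (2 * m\<^sub>0 * (m\<^sub>0 - m\<^sub>1) - 2 * v\<^sub>0) / \<rho>"
    and "k\<^sub>2 = m\<^sub>0\<^sup>2"
    and "C\<^sub>0 = 2 * (m\<^sub>0 * (2 * m\<^sub>1 - m\<^sub>0) + v\<^sub>0 - v\<^sub>1 - v\<^sub>2) / \<rho>\<^sup>2"
    and "C\<^sub>1 = 2 * (v\<^sub>1 - m\<^sub>0 * m\<^sub>1) / \<rho>"
    and "C\<^sub>2 = v\<^sub>2 / \<rho>\<^sup>2"
    and "t \<ge> 0"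
  shows "integrable M (\<lambda>\<omega>. (integrated_intensity L t \<omega>)\<^sup>2) \<and>
    integral\<^sup>L M (\<lambda>\<omega>. (integrated_intensity L t \<omega>)\<^sup>2) =
      k\<^sub>0 + k\<^sub>1 * t + k\<^sub>2 * t\<^sup>2 + (C\<^sub>0 + C\<^sub>1 * t) * exp (\<rho> * t) + C\<^sub>2 * exp (2 * \<rho> * t)"
proof -
  interpret linear_self_exciting M F T J X L \<alpha> \<beta> lam\<^sub>0 l by fact
  note \<rho> = assms(5) and t = assms(17)
  define \<psi> where "\<psi> r = (exp (\<rho> * r) - 1) / \<rho>" for r
  \<comment> \<open>The antiderivative of \<alpha> \<open>lam\<^sub>0\<close> \<psi> vanishing at 0,
    so that \<open>Z\<close> ends exactly at \<Lambda> t.\<close>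
  define \<Psi> where "\<Psi> r = \<alpha> * lam\<^sub>0 * ((exp (\<rho> * r) - 1) / \<rho>\<^sup>2 - r / \<rho>)" for r
  \<comment> \<open>\<open>\<theta>\<close> solves \<open>\<theta>' - \<rho> \<theta> = \<psi>\<^sup>2\<close> with \<open>\<theta> 0 = 0\<close>, so that \<open>weighted_mean\<close> gives the mean of \<open>\<integral>\<psi>(t - s)\<^sup>2 L s ds\<close>.\<close>
  define \<theta> where "\<theta> r = (exp (2 * \<rho> * r) - 1) / \<rho> ^ 3 - 2 * r * exp (\<rho> * r) / \<rho>\<^sup>2" for r
  define \<theta>' where "\<theta>' r = 2 * exp (2 * \<rho> * r) / \<rho>\<^sup>2 - 2 * exp (\<rho> * r) / \<rho>\<^sup>2 - 2 * r * exp (\<rho> * r) / \<rho>" for r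
  \<comment> \<open>An antiderivative of \<alpha> \<open>lam\<^sub>0\<close> \<theta>. Its additive
    constant is left free, since only the difference \<Theta> t - \<Theta> 0 enters.\<close>
  define \<Theta> where "\<Theta> r = \<alpha> * lam\<^sub>0 * (exp (2 * \<rho> * r) / (2 * \<rho> ^ 4) - r / \<rho> ^ 3 -
    2 * r * exp (\<rho> * r) / \<rho> ^ 3 + 2 * exp (\<rho> * r) / \<rho> ^ 4)" for r
  have \<psi>: "(\<psi> has_real_derivative exp (\<rho> * r)) (at r)" for r
    unfolding \<psi>_def using \<rho> by (auto intro!: derivative_eq_intros)
  have \<Psi>: "(\<Psi> has_real_derivative \<alpha> * lam\<^sub>0 * \<psi> r) (at r)" for r
    unfolding \<Psi>_def \<psi>_def using \<rho>
    by (auto intro!: derivative_eq_intros simp: field_simps power2_eq_square)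
  have \<theta>: "(\<theta> has_real_derivative \<theta>' r) (at r)" for r
    unfolding \<theta>_def \<theta>'_def using \<rho>
    by (auto intro!: derivative_eq_intros simp: field_simps power2_eq_square power3_eq_cube)
  have \<Theta>: "(\<Theta> has_real_derivative \<alpha> * lam\<^sub>0 * \<theta> r) (at r)" for r
    unfolding \<Theta>_def \<theta>_def using \<rho>
    by (auto intro!: derivative_eq_intros simp: field_simps power2_eq_square power3_eq_cube power4_eq_xxxx)
  have cont: "continuous_on UNIV (\<lambda>r. exp (\<rho> * r))" "continuous_on UNIV \<theta>'"
    unfolding \<theta>'_def by (intro continuous_intros; use \<rho> in simp)+
  \<comment> \<open>Writing exp (2 \<rho> r) as a square makes every expression polynomial in exp
    (\<rho> r) and \<open>r\<close>, as \<open>second_moment_closed_form\<close> expects.\<close>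
  have exp2: "exp (2 * \<rho> * r) = (exp (\<rho> * r))\<^sup>2" for r
    by (simp add: power2_eq_square flip: exp_add)
  have ode: "\<theta>' r - \<rho> * \<theta> r = (\<psi> r)\<^sup>2" for r
    unfolding \<theta>'_def \<theta>_def \<psi>_def exp2 using \<rho>
    by (simp add: field_simps power2_eq_square power3_eq_cube)
  have "\<psi> 0 = 0" "\<Psi> 0 = 0" "\<theta> 0 = 0" by (simp_all add: \<psi>_def \<Psi>_def \<theta>_def)
  moreover have "exp (\<rho> * r) = 1 + (\<beta> * integral\<^sup>L M X - \<alpha>) * \<psi> r" for r
    using \<rho> unfolding assms(3)[symmetric] by (simp add: \<psi>_def)
  ultimately have square: "integrable M (\<lambda>w. (integrated_intensity L t w)\<^sup>2)"
    "(\<integral>w. (integrated_intensity L t w)\<^sup>2 \<partial>M) = (\<psi> t * l + \<Psi> t)\<^sup>2 +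
      \<beta>\<^sup>2 * (\<integral>w. (X w)\<^sup>2 \<partial>M) * (\<integral>w. (LBINT s:{0..t}. (\<psi> (t - s))\<^sup>2 * L s w) \<partial>M)"
    using integrated_intensity_square[OF t _ _ \<psi> cont(1) \<Psi>] by blast+
  have "(\<integral>w. (LBINT s:{0..t}. (\<psi> (t - s))\<^sup>2 * L s w) \<partial>M) = \<theta> t * l + \<Theta> t - \<Theta> 0"
    using weighted_mean(1)[OF t \<open>\<theta> 0 = 0\<close> \<theta> cont(2) \<Theta>]
    unfolding assms(3)[symmetric] ode .
  moreover have "\<beta>\<^sup>2 * (\<integral>w. (X w)\<^sup>2 \<partial>M) = A - 2 * (\<alpha> * lam\<^sub>0)" using assms(4) by simp
  ultimately have "(\<integral>w. (integrated_intensity L t w)\<^sup>2 \<partial>M) = (\<psi> t * l + \<Psi> t)\<^sup>2 +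
      (A - 2 * (\<alpha> * lam\<^sub>0)) * (\<theta> t * l + \<Theta> t - \<Theta> 0)"
    using square(2) by simp
  also have "\<dots> = k\<^sub>0 + k\<^sub>1 * t + k\<^sub>2 * t\<^sup>2 + (C\<^sub>0 + C\<^sub>1 * t) * exp (\<rho> * t) + C\<^sub>2 * exp (2 * \<rho> * t)"
    using second_moment_closed_form[OF \<rho>, of "exp (\<rho> * t)" l "\<alpha> * lam\<^sub>0" t A]
    unfolding assms(6-16) \<psi>_def \<Psi>_def \<theta>_def \<Theta>_def exp2 by (simp add: mult.assoc)
  finally show ?thesis using square(1) by blast
qed

end
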